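(* Let $u\in[0,1]$ and let $\{X_{t,T}\}$ satisfy the model assumption (Model) of the context at $u$, with local memory parameter $d(u)\in(-\infty,p+1/2)$. Assume that $\phi,\psi$ satisfy the wavelet conditions (1)--(4) of the context with $M\geq \max(p,\,d(u)-1/2)$ and $\alpha>1/2-d(u)$. Let $j=j_T\ge 0$ depend on $T$ and suppose that the weights satisfy, for $q=0,1,2$, $$\Gamma_q(u;j,T)=O\left(\delta_{j,T}^{-q}\right)\quad\text{as }T\to\infty .$$ Then, as $T\to\infty$, $$\mathbb{E}\left[\left(\widehat{\sigma}^2_{j,T}(u)-\widetilde{\sigma}^2_{j,T}(u)\right)^2\right]= O\left(2^{(6+4p)j}\,T^{-4}\, \delta_{j,T}^{-4} + 2^{(3+2p+2d(u))j}\,T^{-2}\, \delta_{j,T}^{-2}\right).$$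
   Context: **Model.** Fix an integer $p\ge 0$; $[\Delta X]_k=X_k-X_{k-1}$ and $\Delta^p$ is its $p$-th iterate, acting on the time index $t$. $\{X_{t,T}\}$ is an array of real-valued random variables such that $$\Delta^pX_{t,T}=\int_{-\pi}^{\pi}A^0_{t,T}(\lambda)e^{\mathrm i\lambda t}\,dZ(\lambda),\quad 1\le t\le T,\ T\ge1,$$ where the $A^0_{t,T}\in L^2([-\pi,\pi])$ have real-valued Fourier coefficients, $Z$ is a Hermitian complex-valued process on $[-\pi,\pi]$ with weakly stationary orthogonal increments, normalized by $\mathbb E|dZ(\lambda)|^2=d\lambda$, and $\varepsilon_t=(2\pi)^{-1/2}\int_{-\pi}^{\pi}e^{\mathrm i\lambda t}dZ(\lambda)$, $t\in\mathbb Z$, is a centered weak white noise with unit variance. Assumption (Model) at $u\in[0,1]$ with local memory parameter $d(u)\in(-\infty,p+1/2)$ means the following. - There are a function $A\in L^2([0,1]\times[-\pi,\pi])$ and constants $c>0$, $D<1/2$ such that $|A^0_{t,T}(\lambda)-A(t/T,\lambda)|\le cT^{-1}|\lambda|^{-D}$ for $1\le t\le T$, $\lambda\in[-\pi,\pi]$, and $|A(u',\lambda)-A(v,\lambda)|\le c|u'-v||\lambda|^{-D}$ for $u',v\in[0,1]$, $\lambda\in[-\pi,\pi]$. - The generalized local spectral density $f(u,\lambda)=|1-e^{-\mathrm i\lambda}|^{-2p}|A(u,\lambda)|^2$ satisfies $f(u,\lambda)=|1-e^{-\mathrm i\lambda}|^{-2d(u)}f^*(u,\lambda)$ with $f^*(u,0)>0$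 and $|f^*(u,\lambda)-f^*(u,0)|\le C f^*(u,0)|\lambda|^\beta$ for $\lambda\in[-\pi,\pi]$, for some $C>0$, $\beta\in(0,2]$. - $\mathbb E[\varepsilon_t^4]<\infty$ for all $t$, and the fourth-order cumulants satisfy $\mathrm{Cum}(dZ(\lambda_k),1\le k\le4)=\hat\kappa_4(\lambda_1,\lambda_2,\lambda_3)\,d\mu(\lambda)$, where $\hat\kappa_4$ is a bounded function on $[-\pi,\pi]^3$ and $\mu$ is the measure on $[-\pi,\pi]^4$ with $\int\prod_{k=1}^4A_k(\lambda_k)d\mu(\lambda)=\int_{[-\pi,\pi]^3}A_4(-\lambda_1-\lambda_2-\lambda_3)\prod_{k=1}^3A_k(\lambda_k)d\lambda$ for $2\pi$-periodic $A_k$. **Wavelets.** Conditions on the scale function $\phi$ and the wavelet $\psi$, for a positive integer $M$ and a real $\alpha$: (1) $\phi,\psi$ are compactly supported and integrable, $\int\phi=1$, $\int\psi^2=1$; (2) $\alpha>1$ and $\sup_{\xi\in\mathbb R}|\hat\psi(\xi)|(1+|\xi|)^\alpha<\infty$, where $\hat\psi(\xi)=\int\psi(t)e^{-\mathrm i\xi t}dt$; (3) $\int t^m\psi(t)dt=0$ for $m=0,\dots,M-1$; (4) $t\mapsto\sum_{k\in\mathbb Z}k^m\phi(t-k)$ is a polynomial of degree $m$ for $m=0,\dots,M-1$. The filter at scale $j\ge0$ is $h_{j,t}=2^{-j/2}\int\phi(s+t)\psi(2^{-j}s)ds$. The wavelet coefficients are $W_{j,k;T}=\sum_{t=1}^Th_{j,2^jk-t}X_{t,T}$,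 $k=0,\dots,T_j-1$, where $T_j$ is the number of available coefficients at scale $j$: $\{t:h_{j,2^jk-t}\ne0\}\subset\{1,\dots,T\}$ for $0\le k<T_j$, and $T2^{-j}-c'\le T_j\le T2^{-j}$ with $c'$ independent of $j$ (and $T$). When $M\ge p$, $h_{j,\cdot}=\tilde h_{j,\cdot}*\Delta^p$ for a finitely supported $\tilde h_{j,\cdot}$ (convolution with the filter $\Delta^p$), so $W_{j,k;T}=\sum_{t}\tilde h_{j,2^jk-t}(\Delta^pX)_{t,T}$. The tangent process at $u$ is $\Delta^pX_t(u)=\int_{-\pi}^\pi A(u,\lambda)e^{\mathrm i\lambda t}dZ(\lambda)$ (same $Z$), with wavelet coefficients $W_{j,k}(u)=\sum_{t}\tilde h_{j,2^jk-t}(\Delta^pX)_t(u)$. **Scalograms and weights.** $\gamma_{j,T}(k)\ge0$, $0\le k<T_j$, are deterministic weights (possibly depending on $u$) with $\sum_{k=0}^{T_j-1}\gamma_{j,T}(k)=1$. The local scalogram is $\widehat\sigma^2_{j,T}(u)=\sum_{k=0}^{T_j-1}\gamma_{j,T}(k)W_{j,k;T}^2$ and the tangent scalogram is $\widetilde\sigma^2_{j,T}(u)=\sum_{k=0}^{T_j-1}\gamma_{j,T}(k)W_{j,k}^2(u)$. Further, $\delta_{j,T}=\sup_{0\le k<T_j}|\gamma_{j,T}(k)|$ and $\Gamma_q(u;j,T)=\sum_{k=0}^{T_j-1}|\gamma_{j,T}(k)|\,|k-Tu2^{-j}|^q$. *)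

theory Defs
  imports
    "HOL-Probability.Probability"
    "HOL-Library.Landau_Symbols"
    "HOL-Computational_Algebra.Polynomial"
begin

definition bdiff :: "(int \<Rightarrow> 'b::ab_group_add) \<Rightarrow> int \<Rightarrow> 'b" where
  "bdiff x k = x k - x (k - 1)"

definition L2_on :: "'b::euclidean_space set \<Rightarrow> ('b \<Rightarrow> complex) \<Rightarrow> bool" where
  "L2_on S f \<longleftrightarrow> set_borel_measurable lborel S f \<and> set_integrable lborel S (\<lambda>x. (cmod (f x))\<^sup>2)"

text \<open>
  The measure \<open>dZ\<close> is given by a process \<open>Z\<close> on \<open>[-\<pi>, \<pi>]\<close> through \<open>dZ (a, b] = Z b - Z a\<close>.
  The third clause is the Hermitian property \<open>dZ(-\<lambda>) = cnj (dZ(\<lambda>))\<close>.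
\<close>

definition orthogonal_increments :: "'a measure \<Rightarrow> (real \<Rightarrow> 'a \<Rightarrow> complex) \<Rightarrow> bool" where
  "orthogonal_increments P Z \<longleftrightarrow>
     (\<forall>a b. -pi \<le> a \<and> a \<le> b \<and> b \<le> pi \<longrightarrow>
        (\<lambda>\<omega>. Z b \<omega> - Z a \<omega>) \<in> borel_measurable P \<and>
        integrable P (\<lambda>\<omega>. (cmod (Z b \<omega> - Z a \<omega>))\<^sup>2) \<and>
        (LINT \<omega>|P. (cmod (Z b \<omega> - Z a \<omega>))\<^sup>2) = b - a) \<and>
     (\<forall>a b a' b'. -pi \<le> a \<and> a \<le> b \<and> b \<le> a' \<and> a' \<le> b' \<and> b' \<le> pi \<longrightarrow>
        (LINT \<omega>|P. (Z b \<omega> - Z a \<omega>) * cnj (Z b' \<omega> - Z a' \<omega>)) = 0) \<and>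
     (\<forall>a b. -pi \<le> a \<and> a \<le> b \<and> b \<le> pi \<longrightarrow>
        (AE \<omega> in P. Z (-a) \<omega> - Z (-b) \<omega> = cnj (Z b \<omega> - Z a \<omega>)))"

text \<open>
  A list of triples \<open>(c, a, b)\<close> represents the step function \<open>\<Sum> c * indicator {a<..b}\<close>.
\<close>

definition steps_ok :: "(complex \<times> real \<times> real) list \<Rightarrow> bool" where
  "steps_ok ps \<longleftrightarrow> (\<forall>(c, a, b) \<in> set ps. -pi \<le> a \<and> a \<le> b \<and> b \<le> pi)"

definition step_fun :: "(complex \<times> real \<times> real) list \<Rightarrow> real \<Rightarrow> complex" where
  "step_fun ps l = (\<Sum>(c, a, b)\<leftarrow>ps. c * indicator {a<..b} l)"

definition step_integral ::
    "(real \<Rightarrow> 'a \<Rightarrow> complex) \<Rightarrow> (complex \<times> real \<times> real) list \<Rightarrow> 'a \<Rightarrow> complex" where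
  "step_integral Z ps \<omega> = (\<Sum>(c, a, b)\<leftarrow>ps. c * (Z b \<omega> - Z a \<omega>))"

text \<open>
  \<open>has_spectral_integral P Z f I\<close>: the random variable \<open>I\<close> is a version of \<open>\<integral> f dZ\<close>, i.e. the limit
  in mean square of the integrals of step functions converging to \<open>f\<close> in \<open>L\<^sup>2[-\<pi>, \<pi>]\<close>.
  It determines \<open>I\<close> up to a null set.
\<close>

definition has_spectral_integral ::
    "'a measure \<Rightarrow> (real \<Rightarrow> 'a \<Rightarrow> complex) \<Rightarrow> (real \<Rightarrow> complex) \<Rightarrow> ('a \<Rightarrow> complex) \<Rightarrow> bool" where
  "has_spectral_integral P Z f I \<longleftrightarrow>
     L2_on {-pi..pi} f \<and>
     I \<in> borel_measurable P \<and> integrable P (\<lambda>\<omega>. (cmod (I \<omega>))\<^sup>2) \<and>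
     (\<exists>ps. (\<forall>n::nat. steps_ok (ps n)) \<and>
        (\<lambda>n. LINT l:{-pi..pi}|lborel. (cmod (f l - step_fun (ps n) l))\<^sup>2) \<longlonglongrightarrow> 0 \<and>
        (\<lambda>n. LINT \<omega>|P. (cmod (I \<omega> - step_integral Z (ps n) \<omega>))\<^sup>2) \<longlonglongrightarrow> 0)"

definition weak_white_noise :: "'a measure \<Rightarrow> (int \<Rightarrow> 'a \<Rightarrow> real) \<Rightarrow> bool" where
  "weak_white_noise P \<epsilon> \<longleftrightarrow>
     (\<forall>t. \<epsilon> t \<in> borel_measurable P \<and> integrable P (\<lambda>\<omega>. (\<epsilon> t \<omega>)\<^sup>2) \<and> (LINT \<omega>|P. \<epsilon> t \<omega>) = 0) \<and>
     (\<forall>s t. (LINT \<omega>|P. \<epsilon> s \<omega> * \<epsilon> t \<omega>) = (if s = t then 1 else 0))"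

text \<open>
  \<open>has_cumulant4 P X\<^sub>1 X\<^sub>2 X\<^sub>3 X\<^sub>4 c\<close>: the joint cumulant of the four variables exists (finite fourth
  moments) and equals \<open>c\<close>. Cumulants of order at least two are invariant under translation, so the
  moment formula for the cumulant is written for the centered variables \<open>X\<^sub>i - E X\<^sub>i\<close>, where all
  terms containing a first moment vanish. No conjugates occur: the cumulant is multilinear.
\<close>

definition centered :: "'a measure \<Rightarrow> ('a \<Rightarrow> complex) \<Rightarrow> 'a \<Rightarrow> complex" where
  "centered P X \<omega> = X \<omega> - (LINT \<omega>'|P. X \<omega>')"

definition has_cumulant4 ::
    "'a measure \<Rightarrow> ('a \<Rightarrow> complex) \<Rightarrow> ('a \<Rightarrow> complex) \<Rightarrow> ('a \<Rightarrow> complex) \<Rightarrow> ('a \<Rightarrow> complex) \<Rightarrow>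
      complex \<Rightarrow> bool" where
  "has_cumulant4 P X1 X2 X3 X4 c \<longleftrightarrow>
     (\<forall>X \<in> {X1, X2, X3, X4}. X \<in> borel_measurable P \<and> integrable P (\<lambda>\<omega>. (cmod (X \<omega>)) ^ 4)) \<and>
     (let Y1 = centered P X1; Y2 = centered P X2; Y3 = centered P X3; Y4 = centered P X4 in
        c = (LINT \<omega>|P. Y1 \<omega> * Y2 \<omega> * Y3 \<omega> * Y4 \<omega>)
            - (LINT \<omega>|P. Y1 \<omega> * Y2 \<omega>) * (LINT \<omega>|P. Y3 \<omega> * Y4 \<omega>)
            - (LINT \<omega>|P. Y1 \<omega> * Y3 \<omega>) * (LINT \<omega>|P. Y2 \<omega> * Y4 \<omega>)
            - (LINT \<omega>|P. Y1 \<omega> * Y4 \<omega>) * (LINT \<omega>|P. Y2 \<omega> * Y3 \<omega>))"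

text \<open>
  The identity \<open>Cum(dZ(\<lambda>\<^sub>1), \<dots>, dZ(\<lambda>\<^sub>4)) = \<kappa>(\<lambda>\<^sub>1, \<lambda>\<^sub>2, \<lambda>\<^sub>3) d\<mu>(\<lambda>)\<close>, integrated against products of
  square integrable \<open>2\<pi>\<close>-periodic functions.
\<close>

definition fourth_cumulant_density ::
    "'a measure \<Rightarrow> (real \<Rightarrow> 'a \<Rightarrow> complex) \<Rightarrow> (real \<times> real \<times> real \<Rightarrow> complex) \<Rightarrow> bool" where
  "fourth_cumulant_density P Z \<kappa> \<longleftrightarrow>
     (\<forall>f1 f2 f3 f4 I1 I2 I3 I4.
        (\<forall>f \<in> {f1, f2, f3, f4}. \<forall>l. f (l + 2 * pi) = f l) \<and>
        has_spectral_integral P Z f1 I1 \<and> has_spectral_integral P Z f2 I2 \<and>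
        has_spectral_integral P Z f3 I3 \<and> has_spectral_integral P Z f4 I4 \<longrightarrow>
        has_cumulant4 P I1 I2 I3 I4
          (LINT (x, y, z):({-pi..pi} \<times> {-pi..pi} \<times> {-pi..pi})|lborel.
             \<kappa> (x, y, z) * f1 x * f2 y * f3 z * f4 (- x - y - z)))"

text \<open>
  The bounds involving \<open>\<bar>\<lambda>\<bar> powr (-D)\<close> and \<open>\<bar>1 - exp(-\<i>\<lambda>)\<bar> powr r\<close> are required for \<open>\<lambda> \<noteq> 0\<close> only,
  since \<open>0 powr r = 0\<close> for all \<open>r\<close>.
\<close>

definition locally_stationary ::
    "'a measure \<Rightarrow> (real \<Rightarrow> 'a \<Rightarrow> complex) \<Rightarrow> (int \<Rightarrow> nat \<Rightarrow> 'a \<Rightarrow> real) \<Rightarrow> nat \<Rightarrow>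
      (int \<Rightarrow> nat \<Rightarrow> real \<Rightarrow> complex) \<Rightarrow> (real \<Rightarrow> real \<Rightarrow> complex) \<Rightarrow> bool" where
  "locally_stationary P Z X p A0 A \<longleftrightarrow>
     (\<forall>T\<ge>1. \<forall>t \<in> {1 - int p..int T}. X t T \<in> borel_measurable P) \<and>
     (\<forall>T\<ge>1. \<forall>t \<in> {1..int T}.
        L2_on {-pi..pi} (A0 t T) \<and>
        (\<forall>n::int. (LINT l:{-pi..pi}|lborel. A0 t T l * cis (of_int n * l)) \<in> \<real>) \<and>
        has_spectral_integral P Z (\<lambda>l. A0 t T l * cis (l * of_int t))
          (\<lambda>\<omega>. complex_of_real ((bdiff ^^ p) (\<lambda>s. X s T \<omega>) t))) \<and>
     L2_on ({0..1} \<times> {-pi..pi}) (\<lambda>(v, l). A v l) \<and>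
     (\<exists>c D. c > 0 \<and> D < 1/2 \<and>
        (\<forall>T\<ge>1. \<forall>t \<in> {1..int T}. \<forall>l \<in> {-pi..pi} - {0}.
           cmod (A0 t T l - A (of_int t / real T) l) \<le> c / real T * \<bar>l\<bar> powr (-D)) \<and>
        (\<forall>v \<in> {0..1}. \<forall>w \<in> {0..1}. \<forall>l \<in> {-pi..pi} - {0}.
           cmod (A v l - A w l) \<le> c * \<bar>v - w\<bar> * \<bar>l\<bar> powr (-D)))"

definition local_spectral_density ::
    "nat \<Rightarrow> (real \<Rightarrow> real \<Rightarrow> complex) \<Rightarrow> real \<Rightarrow> real \<Rightarrow> real" where
  "local_spectral_density p A u l = cmod (1 - cis (-l)) powr (- 2 * real p) * (cmod (A u l))\<^sup>2"

definition local_memory :: "nat \<Rightarrow> (real \<Rightarrow> real \<Rightarrow> complex) \<Rightarrow> real \<Rightarrow> real \<Rightarrow> bool" where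
  "local_memory p A u d \<longleftrightarrow>
     (\<exists>fstar C \<beta>. C > 0 \<and> 0 < \<beta> \<and> \<beta> \<le> 2 \<and> fstar 0 > 0 \<and>
        (\<forall>l \<in> {-pi..pi} - {0}.
           local_spectral_density p A u l = cmod (1 - cis (-l)) powr (- 2 * d) * fstar l) \<and>
        (\<forall>l \<in> {-pi..pi}. \<bar>fstar l - fstar 0\<bar> \<le> C * fstar 0 * \<bar>l\<bar> powr \<beta>))"

definition model_assumption ::
    "'a measure \<Rightarrow> (real \<Rightarrow> 'a \<Rightarrow> complex) \<Rightarrow> (int \<Rightarrow> 'a \<Rightarrow> real) \<Rightarrow>
      (int \<Rightarrow> nat \<Rightarrow> 'a \<Rightarrow> real) \<Rightarrow> nat \<Rightarrow> (int \<Rightarrow> nat \<Rightarrow> real \<Rightarrow> complex) \<Rightarrow>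
      (real \<Rightarrow> real \<Rightarrow> complex) \<Rightarrow> real \<Rightarrow> real \<Rightarrow> bool" where
  "model_assumption P Z \<epsilon> X p A0 A u d \<longleftrightarrow>
     orthogonal_increments P Z \<and>
     (\<forall>t. has_spectral_integral P Z (\<lambda>l. cis (l * of_int t) / complex_of_real (sqrt (2 * pi)))
            (\<lambda>\<omega>. complex_of_real (\<epsilon> t \<omega>))) \<and>
     weak_white_noise P \<epsilon> \<and>
     locally_stationary P Z X p A0 A \<and>
     local_memory p A u d \<and>
     (\<forall>t. integrable P (\<lambda>\<omega>. (\<epsilon> t \<omega>) ^ 4)) \<and>
     (\<exists>\<kappa>. set_borel_measurable lborel ({-pi..pi} \<times> {-pi..pi} \<times> {-pi..pi}) \<kappa> \<and>
          bounded (\<kappa> ` ({-pi..pi} \<times> {-pi..pi} \<times> {-pi..pi})) \<and>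
          fourth_cumulant_density P Z \<kappa>)"

definition tangent_differences ::
    "'a measure \<Rightarrow> (real \<Rightarrow> 'a \<Rightarrow> complex) \<Rightarrow> (real \<Rightarrow> real \<Rightarrow> complex) \<Rightarrow> real \<Rightarrow>
      (int \<Rightarrow> 'a \<Rightarrow> real) \<Rightarrow> bool" where
  "tangent_differences P Z A u Y \<longleftrightarrow>
     (\<forall>t. has_spectral_integral P Z (\<lambda>l. A u l * cis (l * of_int t))
            (\<lambda>\<omega>. complex_of_real (Y t \<omega>)))"

definition fourier :: "(real \<Rightarrow> real) \<Rightarrow> real \<Rightarrow> complex" where
  "fourier \<psi> \<xi> = (LINT t|lborel. complex_of_real (\<psi> t) * cis (- \<xi> * t))"

definition wavelet_conditions ::
    "(real \<Rightarrow> real) \<Rightarrow> (real \<Rightarrow> real) \<Rightarrow> nat \<Rightarrow> real \<Rightarrow> bool" where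
  "wavelet_conditions \<phi> \<psi> M \<alpha> \<longleftrightarrow>
     M \<ge> 1 \<and>
     bounded {t. \<phi> t \<noteq> 0} \<and> bounded {t. \<psi> t \<noteq> 0} \<and>
     integrable lborel \<phi> \<and> integrable lborel \<psi> \<and>
     (LINT t|lborel. \<phi> t) = 1 \<and> (LINT t|lborel. (\<psi> t)\<^sup>2) = 1 \<and>
     \<alpha> > 1 \<and> bdd_above (range (\<lambda>\<xi>. cmod (fourier \<psi> \<xi>) * (1 + \<bar>\<xi>\<bar>) powr \<alpha>)) \<and>
     (\<forall>m<M. (LINT t|lborel. t ^ m * \<psi> t) = 0) \<and>
     (\<forall>m<M. \<exists>q :: real poly. degree q = m \<and>
        (\<forall>t. (\<Sum>\<^sub>\<infinity>k::int. of_int k ^ m * \<phi> (t - of_int k)) = poly q t))"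

definition filt :: "(real \<Rightarrow> real) \<Rightarrow> (real \<Rightarrow> real) \<Rightarrow> nat \<Rightarrow> int \<Rightarrow> real" where
  "filt \<phi> \<psi> j t = 2 powr (- real j / 2) * (LINT s|lborel. \<phi> (s + of_int t) * \<psi> (s / 2 ^ j))"

text \<open>
  Convolving with the filter of \<open>\<Delta>\<^sup>p\<close> is applying \<open>\<Delta>\<^sup>p\<close>; a finitely supported \<open>g\<close> with
  \<open>\<Delta>\<^sup>p g = h\<^sub>j\<close> is unique.
\<close>

definition filt_tilde ::
    "nat \<Rightarrow> (real \<Rightarrow> real) \<Rightarrow> (real \<Rightarrow> real) \<Rightarrow> nat \<Rightarrow> int \<Rightarrow> real" where
  "filt_tilde p \<phi> \<psi> j = (THE g. finite {t. g t \<noteq> 0} \<and> (bdiff ^^ p) g = filt \<phi> \<psi> j)"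

definition wavelet_coeff ::
    "(real \<Rightarrow> real) \<Rightarrow> (real \<Rightarrow> real) \<Rightarrow> (int \<Rightarrow> nat \<Rightarrow> 'a \<Rightarrow> real) \<Rightarrow> nat \<Rightarrow> nat \<Rightarrow> nat \<Rightarrow> 'a \<Rightarrow> real"
  where
  "wavelet_coeff \<phi> \<psi> X j T k \<omega> = (\<Sum>t = 1..int T. filt \<phi> \<psi> j (2 ^ j * int k - t) * X t T \<omega>)"

definition tangent_coeff ::
    "nat \<Rightarrow> (real \<Rightarrow> real) \<Rightarrow> (real \<Rightarrow> real) \<Rightarrow> (int \<Rightarrow> 'a \<Rightarrow> real) \<Rightarrow> nat \<Rightarrow> nat \<Rightarrow> 'a \<Rightarrow> real" where
  "tangent_coeff p \<phi> \<psi> Y j k \<omega> =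
     (\<Sum>t | filt_tilde p \<phi> \<psi> j (2 ^ j * int k - t) \<noteq> 0.
        filt_tilde p \<phi> \<psi> j (2 ^ j * int k - t) * Y t \<omega>)"

text \<open>\<open>N j T\<close> is the number \<open>T\<^sub>j\<close> of available coefficients at scale \<open>j\<close> for the sample size \<open>T\<close>.\<close>

definition available_coeffs ::
    "(real \<Rightarrow> real) \<Rightarrow> (real \<Rightarrow> real) \<Rightarrow> (nat \<Rightarrow> nat \<Rightarrow> nat) \<Rightarrow> bool" where
  "available_coeffs \<phi> \<psi> N \<longleftrightarrow>
     (\<forall>j. \<forall>T\<ge>1. \<forall>k < N j T. {t. filt \<phi> \<psi> j (2 ^ j * int k - t) \<noteq> 0} \<subseteq> {1..int T}) \<and>
     (\<exists>c'. \<forall>j. \<forall>T\<ge>1. real T / 2 ^ j - c' \<le> real (N j T) \<and> real (N j T) \<le> real T / 2 ^ j)"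

text \<open>
  In the following, \<open>n\<close> stands for \<open>T\<^sub>j\<close> and \<open>\<gamma> k\<close>, \<open>k < n\<close>, for the weights at given \<open>j\<close> and \<open>T\<close>.
\<close>

definition weights :: "nat \<Rightarrow> (nat \<Rightarrow> real) \<Rightarrow> bool" where
  "weights n \<gamma> \<longleftrightarrow> (\<forall>k<n. \<gamma> k \<ge> 0) \<and> (\<Sum>k<n. \<gamma> k) = 1"

definition weight_sup :: "nat \<Rightarrow> (nat \<Rightarrow> real) \<Rightarrow> real" where
  "weight_sup n \<gamma> = (SUP k\<in>{..<n}. \<bar>\<gamma> k\<bar>)"

definition weight_moment :: "nat \<Rightarrow> real \<Rightarrow> nat \<Rightarrow> nat \<Rightarrow> nat \<Rightarrow> (nat \<Rightarrow> real) \<Rightarrow> real" where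
  "weight_moment q u j T n \<gamma> = (\<Sum>k<n. \<bar>\<gamma> k\<bar> * \<bar>real k - real T * u / 2 ^ j\<bar> ^ q)"

definition scalogram :: "nat \<Rightarrow> (nat \<Rightarrow> real) \<Rightarrow> (nat \<Rightarrow> 'a \<Rightarrow> real) \<Rightarrow> 'a \<Rightarrow> real" where
  "scalogram n \<gamma> W \<omega> = (\<Sum>k<n. \<gamma> k * (W k \<omega>)\<^sup>2)"

end

theory Submission
  imports Defs
begin

text \<open>
  Let \<open>W\<^sub>k\<close> be the tangent coefficient at position \<open>k\<close> and \<open>D\<^sub>k\<close> the difference between the coefficient of
  the observed process and \<open>W\<^sub>k\<close>. The two scalograms differ by \<open>\<Sum>\<^sub>k \<gamma>(k) (D\<^sub>k\<^sup>2 + 2 D\<^sub>k W\<^sub>k)\<close>; the squares produce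
  the first term of the bound and the products the second. Since \<open>D\<^sub>k\<close> and \<open>W\<^sub>k\<close> are spectral integrals
  of explicit functions, everything reduces to three facts.

  The fourth moment of a spectral integral is at most a constant times the squared integral of
  \<open>\<bar>f\<bar>\<^sup>2\<close> (\<open>spectral_integral_fourth_moment\<close>). Products of variances have this size, and what remains is a
  cumulant, the integral of the bounded density against \<open>f(x) f(y) f(z) f(-x-y-z)\<close>, to which the
  Cauchy-Schwarz inequality applies in \<open>z\<close> because \<open>f\<close> is periodic. Hence only \<open>L\<^sup>2\<close> norms of
  spectral functions have to be estimated.

  The \<open>L\<^sup>4\<close> norm of \<open>D\<^sub>k\<close> is of order \<open>2\<^bsup>(p+3/2)j\<^esup> T\<^bsup>-1\<^esup> (1 + \<bar>k - Tu2\<^bsup>-j\<^esup>\<bar>)\<close> (\<open>coeff_difference_L4_norm\<close>): the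
  filter \<open>filt_tilde\<close> has total mass of order \<open>2\<^bsup>(p+1/2)j\<^esup>\<close> and only sees times \<open>t\<close> within \<open>O(2\<^bsup>j\<^esup>)\<close> of \<open>2\<^bsup>j\<^esup>k\<close>,
  where the amplitudes differ by at most \<open>O(T\<^bsup>-1\<^esup> (1 + \<bar>t - Tu\<bar>) \<bar>\<lambda>\<bar>\<^bsup>-D\<^esup>)\<close>, a square integrable function.
  Averaging \<open>1 + \<bar>k - Tu2\<^bsup>-j\<^esup>\<bar>\<close> and its square against the weights gives the powers of \<open>\<delta>\<close>.

  The \<open>L\<^sup>4\<close> norm of \<open>W\<^sub>k\<close> is of order \<open>2\<^bsup>dj\<^esup>\<close> (\<open>tangent_coeff_L4_norm\<close>). For \<open>\<bar>\<lambda>\<bar> \<le> 2\<^bsup>-j\<^esup>\<close> the total mass bounds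
  the transfer function well enough, because \<open>d < p + 1/2\<close>. For larger \<open>\<bar>\<lambda>\<bar>\<close> the transfer function of \<open>filt\<close>
  is \<open>O(2\<^bsup>j/2\<^esup> (2\<^bsup>j\<^esup>\<bar>\<lambda>\<bar>)\<^bsup>-\<alpha>\<^esup>)\<close> (\<open>filt_transfer_decay\<close>), and \<open>\<alpha> > 1/2 - d\<close> makes the tail converge. This decay is a
  form of Poisson summation. Up to the factor \<open>2\<^bsup>-j/2\<^esup>\<close>, the transfer function is the integral of \<open>\<phi>(s) e\<^bsup>-i\<lambda>s\<^esup>\<close> against
  the periodization of \<open>\<psi>(2\<^bsup>-j\<^esup>s) e\<^bsup>i\<lambda>s\<^esup>\<close>. The Fourier coefficients of the periodization are values of the Fourier
  transform of \<open>\<psi>\<close>, which are summable as \<open>\<alpha> > 1\<close>, and a function is essentially bounded by a multiple of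
  the sum of the moduli of its Fourier coefficients (\<open>fourier_sup_bound\<close>). The same argument at a
  small scale shows that \<open>\<psi>\<close> is essentially bounded (\<open>AE_bounded_of_fourier_decay\<close>), so that the products
  \<open>\<phi>(s + t) \<psi>(2\<^bsup>-j\<^esup>s)\<close> are integrable although \<open>\<phi>\<close> is merely integrable.

  Finally, \<open>filt_tilde\<close> exists because the polynomial reproduction of \<open>\<phi>\<close> and the vanishing moments
  of \<open>\<psi>\<close> annihilate the moments \<open>\<Sum>\<^sub>t t\<^sup>m filt(t)\<close> for \<open>m < M\<close>, and a finitely supported sequence with \<open>p\<close> vanishing
  moments is the \<open>p\<close>-th difference of a sequence supported in the same interval
  (\<open>exists_bdiff_funpow_primitive\<close>).
\<close>

definition sq_integrable :: "'a measure \<Rightarrow> ('a \<Rightarrow> complex) \<Rightarrow> bool" where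
  "sq_integrable M f \<longleftrightarrow> f \<in> borel_measurable M \<and> integrable M (\<lambda>x. (cmod (f x))\<^sup>2)"

section \<open>Spectral integrals of square integrable functions\<close>

abbreviation sqnorm :: "'a measure \<Rightarrow> ('a \<Rightarrow> complex) \<Rightarrow> real" where
  "sqnorm M f \<equiv> LINT x|M. (cmod (f x))\<^sup>2"

lemma cmod_add_squared_le: "(cmod (a + b))\<^sup>2 \<le> 2 * (cmod a)\<^sup>2 + 2 * (cmod b)\<^sup>2"
proof -
  have "(cmod (a + b))\<^sup>2 \<le> (cmod a + cmod b)\<^sup>2"
    by (intro power_mono norm_triangle_ineq) auto
  also have "\<dots> \<le> 2 * (cmod a)\<^sup>2 + 2 * (cmod b)\<^sup>2"
    using sum_squares_bound[of "cmod a" "cmod b"] by (simp add: power2_sum)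
  finally show ?thesis .
qed

lemma sq_integrable_add:
  assumes "sq_integrable M f" "sq_integrable M g"
  shows "sq_integrable M (\<lambda>x. f x + g x)"
    and "sqnorm M (\<lambda>x. f x + g x) \<le> 2 * sqnorm M f + 2 * sqnorm M g"
proof -
  have m[measurable]: "f \<in> borel_measurable M" "g \<in> borel_measurable M"
    and i: "integrable M (\<lambda>x. (cmod (f x))\<^sup>2)" "integrable M (\<lambda>x. (cmod (g x))\<^sup>2)"
    using assms by (auto simp: sq_integrable_def)
  have i2: "integrable M (\<lambda>x. 2 * (cmod (f x))\<^sup>2 + 2 * (cmod (g x))\<^sup>2)"
    using i by simp
  have i3: "integrable M (\<lambda>x. (cmod (f x + g x))\<^sup>2)"
    by (rule Bochner_Integration.integrable_bound[OF i2])
       (auto intro!: order.trans[OF cmod_add_squared_le])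
  then show "sq_integrable M (\<lambda>x. f x + g x)"
    by (simp add: sq_integrable_def)
  have "sqnorm M (\<lambda>x. f x + g x) \<le> (LINT x|M. 2 * (cmod (f x))\<^sup>2 + 2 * (cmod (g x))\<^sup>2)"
    by (rule integral_mono[OF i3 i2]) (rule cmod_add_squared_le)
  then show "sqnorm M (\<lambda>x. f x + g x) \<le> 2 * sqnorm M f + 2 * sqnorm M g"
    using i by simp
qed

lemma sq_integrable_scale:
  assumes "sq_integrable M f"
  shows "sq_integrable M (\<lambda>x. c * f x)"
    and "sqnorm M (\<lambda>x. c * f x) = (cmod c)\<^sup>2 * sqnorm M f"
  using assms by (auto simp: sq_integrable_def norm_mult power_mult_distrib)

lemma sq_integrable_diff:
  assumes "sq_integrable M f" "sq_integrable M g"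
  shows "sq_integrable M (\<lambda>x. f x - g x)"
    and "sqnorm M (\<lambda>x. f x - g x) \<le> 2 * sqnorm M f + 2 * sqnorm M g"
  using sq_integrable_add[OF assms(1) sq_integrable_scale(1)[OF assms(2), of "-1"]] by simp_all

lemma sq_integrable_zero [simp]: "sq_integrable M (\<lambda>x. 0)"
  by (simp add: sq_integrable_def)

lemma borel_measurable_cnj [measurable (raw)]:
  "f \<in> borel_measurable M \<Longrightarrow> (\<lambda>x. cnj (f x)) \<in> borel_measurable M"
  by (rule measurable_compose[OF _ borel_measurable_continuous_onI]) (auto intro: continuous_intros)

lemma sq_integrable_mult_cnj:
  assumes "sq_integrable M f" "sq_integrable M g"
  shows "integrable M (\<lambda>x. f x * cnj (g x))"
proof -
  have m[measurable]: "f \<in> borel_measurable M" "g \<in> borel_measurable M"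
    and i: "integrable M (\<lambda>x. (cmod (f x))\<^sup>2)" "integrable M (\<lambda>x. (cmod (g x))\<^sup>2)"
    using assms by (auto simp: sq_integrable_def)
  have i2: "integrable M (\<lambda>x. (cmod (f x))\<^sup>2 + (cmod (g x))\<^sup>2)"
    using i by simp
  have "cmod (f x) * cmod (g x) \<le> (cmod (f x))\<^sup>2 + (cmod (g x))\<^sup>2" for x
    using sum_squares_bound[of "cmod (f x)" "cmod (g x)"]
      mult_nonneg_nonneg[of "cmod (f x)" "cmod (g x)"] norm_ge_zero[of "f x"] norm_ge_zero[of "g x"]
    by linarith
  then show ?thesis
    by (intro Bochner_Integration.integrable_bound[OF i2]) (auto simp: norm_mult)
qed

text \<open>
  Second moments of linear combinations are determined by the matrix of inner products. Two families
  with the same matrix, one in \<open>L\<^sup>2\<close> of the probability space and one in \<open>L\<^sup>2[-\<pi>, \<pi>]\<close>, therefore give the same norms;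
  the isometry below is an instance.
\<close>

lemma sq_integrable_gram:
  assumes "\<And>i. i \<in> I \<Longrightarrow> sq_integrable M (F i)"
  shows "complex_of_real (sqnorm M (\<lambda>x. \<Sum>i\<in>I. c i * F i x))
    = (\<Sum>i\<in>I. \<Sum>k\<in>I. c i * cnj (c k) * (LINT x|M. F i x * cnj (F k x)))"
proof -
  have int: "integrable M (\<lambda>x. F i x * cnj (F k x))" if "i \<in> I" "k \<in> I" for i k
    using that assms by (intro sq_integrable_mult_cnj)
  have "complex_of_real (sqnorm M (\<lambda>x. \<Sum>i\<in>I. c i * F i x))
    = (LINT x|M. complex_of_real ((cmod (\<Sum>i\<in>I. c i * F i x))\<^sup>2))"
    by (rule integral_complex_of_real[symmetric])
  also have "\<dots> = (LINT x|M. (\<Sum>i\<in>I. \<Sum>k\<in>I. c i * cnj (c k) * (F i x * cnj (F k x))))"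
    unfolding complex_norm_square cnj_sum sum_product by (simp add: mult_ac)
  also have "\<dots> = (\<Sum>i\<in>I. \<Sum>k\<in>I. c i * cnj (c k) * (LINT x|M. F i x * cnj (F k x)))"
    using int by (simp add: Bochner_Integration.integral_sum Bochner_Integration.integrable_sum)
  finally show ?thesis .
qed

abbreviation freq :: "real measure" where
  "freq \<equiv> restrict_space lborel {-pi..pi}"

lemma L2_on_freq: "L2_on {-pi..pi} f \<longleftrightarrow> sq_integrable freq f"
  by (simp add: L2_on_def sq_integrable_def set_borel_measurable_def set_integrable_def
      borel_measurable_restrict_space_iff integrable_restrict_space)

lemma has_spectral_integral_iff:
  "has_spectral_integral P Z f I \<longleftrightarrow> sq_integrable freq f \<and> sq_integrable P I \<and>
     (\<exists>ps. (\<forall>n::nat. steps_ok (ps n)) \<and>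
        (\<lambda>n. sqnorm freq (\<lambda>l. f l - step_fun (ps n) l)) \<longlonglongrightarrow> 0 \<and>
        (\<lambda>n. sqnorm P (\<lambda>\<omega>. I \<omega> - step_integral Z (ps n) \<omega>)) \<longlonglongrightarrow> 0)"
  unfolding has_spectral_integral_def L2_on_freq sq_integrable_def[of P]
  by (simp add: set_lebesgue_integral_def integral_restrict_space)

lemma step_Nil [simp]: "step_fun [] l = 0" "step_integral Z [] \<omega> = 0" "steps_ok []"
  by (simp_all add: step_fun_def step_integral_def steps_ok_def)

lemma step_Cons [simp]:
  "step_fun ((c, a, b) # ps) l = c * indicator {a<..b} l + step_fun ps l"
  "step_integral Z ((c, a, b) # ps) \<omega> = c * (Z b \<omega> - Z a \<omega>) + step_integral Z ps \<omega>"
  "steps_ok ((c, a, b) # ps) \<longleftrightarrow> -pi \<le> a \<and> a \<le> b \<and> b \<le> pi \<and> steps_ok ps"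
  by (auto simp add: step_fun_def step_integral_def steps_ok_def)

lemma step_append:
  "step_fun (ps @ qs) l = step_fun ps l + step_fun qs l"
  "step_integral Z (ps @ qs) \<omega> = step_integral Z ps \<omega> + step_integral Z qs \<omega>"
  "steps_ok (ps @ qs) \<longleftrightarrow> steps_ok ps \<and> steps_ok qs"
  by (simp_all add: step_fun_def step_integral_def steps_ok_def ball_Un)

definition scale_steps :: "complex \<Rightarrow> (complex \<times> real \<times> real) list \<Rightarrow> (complex \<times> real \<times> real) list" where
  "scale_steps c = map (\<lambda>(x, y). (c * x, y))"

lemma step_scale:
  "step_fun (scale_steps c ps) l = c * step_fun ps l"
  "step_integral Z (scale_steps c ps) \<omega> = c * step_integral Z ps \<omega>"
  "steps_ok (scale_steps c ps) \<longleftrightarrow> steps_ok ps"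
  by (induction ps) (auto simp: scale_steps_def algebra_simps)

lemma sq_integrable_indicator_freq: "sq_integrable freq (\<lambda>l. indicator {a<..b} l)"
proof -
  have "(\<lambda>l. (cmod (indicator {a<..b} l))\<^sup>2) = (indicator {a<..b} :: real \<Rightarrow> real)"
    by (auto simp: fun_eq_iff indicator_def)
  moreover have "integrable freq (indicator {a<..b} :: real \<Rightarrow> real)"
  proof -
    have "emeasure lborel ({-pi..pi} \<inter> {a<..b}) \<le> emeasure lborel {-pi..pi}"
      by (intro emeasure_mono) auto
    also have "\<dots> < \<infinity>" by (simp add: emeasure_lborel_Icc_eq)
    finally have "integrable lborel (indicator ({-pi..pi} \<inter> {a<..b}) :: real \<Rightarrow> real)"
      by (intro integrable_real_indicator) auto
    then show ?thesis
      by (simp add: integrable_restrict_space indicator_inter_arith[abs_def])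
  qed
  ultimately show ?thesis by (simp add: sq_integrable_def measurable_restrict_space1)
qed

lemma sq_integrable_step_fun: "sq_integrable freq (step_fun ps)"
proof (induction ps)
  case Nil
  have "step_fun [] = (\<lambda>l. 0)" by (simp add: fun_eq_iff)
  then show ?case by simp
next
  case (Cons x ps)
  obtain c a b where x: "x = (c, a, b)" by (cases x)
  have "step_fun (x # ps) = (\<lambda>l. c * indicator {a<..b} l + step_fun ps l)"
    by (simp add: fun_eq_iff x)
  then show ?case
    using Cons by (auto intro!: sq_integrable_add sq_integrable_scale sq_integrable_indicator_freq)
qed

lemma sq_integrable_step_integral:
  assumes "orthogonal_increments P Z" "steps_ok ps"
  shows "sq_integrable P (step_integral Z ps)"
  using assms(2)
proof (induction ps)
  case Nil
  have "step_integral Z [] = (\<lambda>l. 0)" by (simp add: fun_eq_iff)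
  then show ?case by simp
next
  case (Cons x ps)
  obtain c a b where x: "x = (c, a, b)" by (cases x)
  have ok: "-pi \<le> a" "a \<le> b" "b \<le> pi" using Cons.prems by (auto simp: x)
  have "sq_integrable P (\<lambda>\<omega>. Z b \<omega> - Z a \<omega>)"
    using assms(1) ok unfolding orthogonal_increments_def sq_integrable_def by blast
  moreover have "step_integral Z (x # ps) = (\<lambda>\<omega>. c * (Z b \<omega> - Z a \<omega>) + step_integral Z ps \<omega>)"
    by (simp add: fun_eq_iff x)
  ultimately show ?case
    using Cons by (auto simp: x intro!: sq_integrable_add sq_integrable_scale)
qed

lemma has_spectral_integralE:
  assumes "has_spectral_integral P Z f I"
  obtains ps where "\<And>n::nat. steps_ok (ps n)"
    "(\<lambda>n. sqnorm freq (\<lambda>l. f l - step_fun (ps n) l)) \<longlonglongrightarrow> 0"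
    "(\<lambda>n. sqnorm P (\<lambda>\<omega>. I \<omega> - step_integral Z (ps n) \<omega>)) \<longlonglongrightarrow> 0"
    "sq_integrable freq f" "sq_integrable P I"
  using assms unfolding has_spectral_integral_iff by blast

lemma sqnorm_add_tendsto_0:
  assumes "\<And>n. sq_integrable M (f n)" "\<And>n. sq_integrable M (g n)"
    and "(\<lambda>n::nat. sqnorm M (f n)) \<longlonglongrightarrow> 0" "(\<lambda>n. sqnorm M (g n)) \<longlonglongrightarrow> 0"
  shows "(\<lambda>n. sqnorm M (\<lambda>x. f n x + g n x)) \<longlonglongrightarrow> 0"
proof (rule Lim_null_comparison)
  show "\<forall>\<^sub>F n in sequentially. norm (sqnorm M (\<lambda>x. f n x + g n x)) \<le> 2 * sqnorm M (f n) + 2 * sqnorm M (g n)"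
    using sq_integrable_add(2)[OF assms(1,2)] by simp
  show "(\<lambda>n. 2 * sqnorm M (f n) + 2 * sqnorm M (g n)) \<longlonglongrightarrow> 0"
    using tendsto_add[OF tendsto_mult_left[OF assms(3), of 2] tendsto_mult_left[OF assms(4), of 2]] by simp
qed

lemma has_spectral_integral_add:
  assumes Z: "orthogonal_increments P Z"
    and f: "has_spectral_integral P Z f I" and g: "has_spectral_integral P Z g K"
  shows "has_spectral_integral P Z (\<lambda>l. f l + g l) (\<lambda>\<omega>. I \<omega> + K \<omega>)"
proof -
  from f obtain ps where ps: "\<And>n::nat. steps_ok (ps n)"
    "(\<lambda>n. sqnorm freq (\<lambda>l. f l - step_fun (ps n) l)) \<longlonglongrightarrow> 0"
    "(\<lambda>n. sqnorm P (\<lambda>\<omega>. I \<omega> - step_integral Z (ps n) \<omega>)) \<longlonglongrightarrow> 0"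
    and sf: "sq_integrable freq f" "sq_integrable P I"
    by (rule has_spectral_integralE) (rule that)
  from g obtain qs where qs: "\<And>n::nat. steps_ok (qs n)"
    "(\<lambda>n. sqnorm freq (\<lambda>l. g l - step_fun (qs n) l)) \<longlonglongrightarrow> 0"
    "(\<lambda>n. sqnorm P (\<lambda>\<omega>. K \<omega> - step_integral Z (qs n) \<omega>)) \<longlonglongrightarrow> 0"
    and sg: "sq_integrable freq g" "sq_integrable P K"
    by (rule has_spectral_integralE) (rule that)
  have "(\<lambda>n. sqnorm freq (\<lambda>l. f l + g l - step_fun (ps n @ qs n) l)) \<longlonglongrightarrow> 0"
    using sqnorm_add_tendsto_0[OF sq_integrable_diff(1)[OF sf(1) sq_integrable_step_fun]
        sq_integrable_diff(1)[OF sg(1) sq_integrable_step_fun] ps(2) qs(2)]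
    by (simp add: step_append algebra_simps)
  moreover have "(\<lambda>n. sqnorm P (\<lambda>\<omega>. I \<omega> + K \<omega> - step_integral Z (ps n @ qs n) \<omega>)) \<longlonglongrightarrow> 0"
    using sqnorm_add_tendsto_0[OF sq_integrable_diff(1)[OF sf(2) sq_integrable_step_integral[OF Z ps(1)]]
        sq_integrable_diff(1)[OF sg(2) sq_integrable_step_integral[OF Z qs(1)]] ps(3) qs(3)]
    by (simp add: step_append algebra_simps)
  ultimately show ?thesis
    unfolding has_spectral_integral_iff using sf sg ps(1) qs(1)
    by (intro conjI sq_integrable_add exI[of _ "\<lambda>n. ps n @ qs n"]) (auto simp: step_append)
qed

lemma has_spectral_integral_scale:
  assumes f: "has_spectral_integral P Z f I"
  shows "has_spectral_integral P Z (\<lambda>l. c * f l) (\<lambda>\<omega>. c * I \<omega>)"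
proof -
  from f obtain ps where ps: "\<And>n::nat. steps_ok (ps n)"
    "(\<lambda>n. sqnorm freq (\<lambda>l. f l - step_fun (ps n) l)) \<longlonglongrightarrow> 0"
    "(\<lambda>n. sqnorm P (\<lambda>\<omega>. I \<omega> - step_integral Z (ps n) \<omega>)) \<longlonglongrightarrow> 0"
    and sf: "sq_integrable freq f" "sq_integrable P I"
    by (rule has_spectral_integralE) (rule that)
  have "(cmod (c * x - c * y))\<^sup>2 = (cmod c)\<^sup>2 * (cmod (x - y))\<^sup>2" for x y
    by (simp add: norm_mult power_mult_distrib flip: right_diff_distrib)
  then show ?thesis
    unfolding has_spectral_integral_iff using sf ps(1)
      tendsto_mult_left[OF ps(2), of "(cmod c)\<^sup>2"] tendsto_mult_left[OF ps(3), of "(cmod c)\<^sup>2"]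
    by (intro conjI sq_integrable_scale exI[of _ "\<lambda>n. scale_steps c (ps n)"]) (auto simp: step_scale)
qed

lemma has_spectral_integral_zero: "has_spectral_integral P Z (\<lambda>l. 0) (\<lambda>\<omega>. 0)"
  unfolding has_spectral_integral_iff by (auto intro!: exI[of _ "\<lambda>_. []"])

lemma has_spectral_integral_sum:
  assumes "orthogonal_increments P Z" "\<And>i. i \<in> I \<Longrightarrow> has_spectral_integral P Z (f i) (K i)"
  shows "has_spectral_integral P Z (\<lambda>l. \<Sum>i\<in>I. c i * f i l) (\<lambda>\<omega>. \<Sum>i\<in>I. c i * K i \<omega>)"
  using assms(2)
  by (induction I rule: infinite_finite_induct)
     (auto intro!: has_spectral_integral_zero has_spectral_integral_add[OF assms(1)] has_spectral_integral_scale)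

text \<open>
  The variables \<open>Z s - Z(-\<pi>)\<close> behave like the indicators of \<open>(-\<pi>, s]\<close>: splitting the larger of two nested
  intervals leaves, by orthogonality, only the variance of the smaller one.
\<close>

lemma increments_gram:
  assumes Z: "orthogonal_increments P Z" and "-pi \<le> s" "s \<le> pi" "-pi \<le> t" "t \<le> pi"
  shows "(LINT \<omega>|P. (Z s \<omega> - Z (-pi) \<omega>) * cnj (Z t \<omega> - Z (-pi) \<omega>))
    = (LINT l|freq. indicator {-pi<..s} l * cnj (indicator {-pi<..t} l :: complex))"
proof -
  have le: "(LINT \<omega>|P. (Z s \<omega> - Z (-pi) \<omega>) * cnj (Z t \<omega> - Z (-pi) \<omega>)) = complex_of_real (s + pi)"
    if st: "-pi \<le> s" "s \<le> t" "t \<le> pi" for s t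
  proof -
    have sq: "sq_integrable P (\<lambda>\<omega>. Z b \<omega> - Z a \<omega>)" if "-pi \<le> a" "a \<le> b" "b \<le> pi" for a b
      using Z that unfolding orthogonal_increments_def sq_integrable_def by blast
    have "(LINT \<omega>|P. (Z s \<omega> - Z (-pi) \<omega>) * cnj (Z t \<omega> - Z (-pi) \<omega>)) =
       (LINT \<omega>|P. (Z s \<omega> - Z (-pi) \<omega>) * cnj (Z s \<omega> - Z (-pi) \<omega>) + (Z s \<omega> - Z (-pi) \<omega>) * cnj (Z t \<omega> - Z s \<omega>))"
      by (rule Bochner_Integration.integral_cong) (auto simp: algebra_simps)
    also have "\<dots> = (LINT \<omega>|P. (Z s \<omega> - Z (-pi) \<omega>) * cnj (Z s \<omega> - Z (-pi) \<omega>)) + (LINT \<omega>|P. (Z s \<omega> - Z (-pi) \<omega>) * cnj (Z t \<omega> - Z s \<omega>))"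
      using st by (intro Bochner_Integration.integral_add sq_integrable_mult_cnj sq) auto
    also have "(LINT \<omega>|P. (Z s \<omega> - Z (-pi) \<omega>) * cnj (Z t \<omega> - Z s \<omega>)) = 0"
      using Z st unfolding orthogonal_increments_def by (metis order_refl)
    also have "(LINT \<omega>|P. (Z s \<omega> - Z (-pi) \<omega>) * cnj (Z s \<omega> - Z (-pi) \<omega>)) = complex_of_real (sqnorm P (\<lambda>\<omega>. Z s \<omega> - Z (-pi) \<omega>))"
      unfolding complex_norm_square[symmetric] by (rule integral_complex_of_real)
    also have "sqnorm P (\<lambda>\<omega>. Z s \<omega> - Z (-pi) \<omega>) = s - (-pi)"
      using Z st unfolding orthogonal_increments_def by (meson order.trans order_refl)
    finally show ?thesis by simp
  qed
  have "(LINT \<omega>|P. (Z s \<omega> - Z (-pi) \<omega>) * cnj (Z t \<omega> - Z (-pi) \<omega>)) = complex_of_real (min s t + pi)"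
  proof (cases "s \<le> t")
    case True
    then show ?thesis using le[of s t] assms by simp
  next
    case False
    then have "(LINT \<omega>|P. (Z t \<omega> - Z (-pi) \<omega>) * cnj (Z s \<omega> - Z (-pi) \<omega>)) = complex_of_real (t + pi)"
      using le[of t s] assms by simp
    moreover have "(LINT \<omega>|P. (Z s \<omega> - Z (-pi) \<omega>) * cnj (Z t \<omega> - Z (-pi) \<omega>))
        = cnj (LINT \<omega>|P. (Z t \<omega> - Z (-pi) \<omega>) * cnj (Z s \<omega> - Z (-pi) \<omega>))"
      by (subst Bochner_Integration.integral_cnj[symmetric]) (simp only: complex_cnj_mult complex_cnj_cnj mult.commute)
    ultimately show ?thesis using False by simp
  qed
  moreover have "(LINT l|freq. indicator {-pi<..s} l * cnj (indicator {-pi<..t} l :: complex)) = complex_of_real (min s t + pi)"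
  proof -
    have "(LINT l|freq. indicator {-pi<..s} l * cnj (indicator {-pi<..t} l :: complex)) =
      (LINT l|lborel. complex_of_real (indicator {-pi<..min s t} l))"
      by (subst integral_restrict_space, simp, rule Bochner_Integration.integral_cong)
         (use assms in \<open>auto split: split_indicator\<close>)
    also have "\<dots> = complex_of_real (min s t + pi)"
      unfolding integral_complex_of_real using assms by simp
    finally show ?thesis .
  qed
  ultimately show ?thesis by simp
qed

text \<open>
  Writing every increment as a difference of increments that start at \<open>-\<pi>\<close> reduces overlapping intervals
  to nested ones.
\<close>

lemma step_integral_isometry:
  assumes Z: "orthogonal_increments P Z" and ok: "steps_ok ps"
  shows "sqnorm P (step_integral Z ps) = sqnorm freq (step_fun ps)"
proof -
  have "\<exists>n::nat. \<exists>c s. (\<forall>i<n. -pi \<le> s i \<and> s i \<le> pi) \<and>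
     (\<forall>\<omega>. step_integral Z ps \<omega> = (\<Sum>i<n. c i * (Z (s i) \<omega> - Z (-pi) \<omega>))) \<and>
     (\<forall>l. step_fun ps l = (\<Sum>i<n. c i * indicator {-pi<..s i} l))"
    using ok
  proof (induction ps)
    case Nil
    show ?case by (intro exI[of _ 0]) auto
  next
    case (Cons x ps)
    obtain c a b where x: "x = (c, a, b)" by (cases x)
    have ok: "-pi \<le> a" "a \<le> b" "b \<le> pi" using Cons.prems by (auto simp: x)
    have "steps_ok ps" using Cons.prems by (simp add: x)
    from Cons.IH[OF this] obtain n :: nat and d s where IH: "\<forall>i<n. -pi \<le> s i \<and> s i \<le> pi"
      "\<And>\<omega>. step_integral Z ps \<omega> = (\<Sum>i<n. d i * (Z (s i) \<omega> - Z (-pi) \<omega>))"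
      "\<And>l. step_fun ps l = (\<Sum>i<n. d i * indicator {-pi<..s i} l)"
      by blast
    \<comment> \<open>The triple \<open>(c, a, b)\<close> contributes the end point \<open>b\<close> with coefficient \<open>c\<close> and \<open>a\<close> with coefficient \<open>-c\<close>.\<close>
    let ?d = "\<lambda>i. if i = n then c else if i = Suc n then - c else d i"
    let ?s = "\<lambda>i. if i = n then b else if i = Suc n then a else s i"
    show ?case
    proof (intro exI[of _ "Suc (Suc n)"] exI[of _ ?d] exI[of _ ?s] conjI allI impI)
      fix \<omega> show "step_integral Z (x # ps) \<omega> = (\<Sum>i<Suc (Suc n). ?d i * (Z (?s i) \<omega> - Z (-pi) \<omega>))"
        by (simp add: x IH algebra_simps)
    next
      fix l show "step_fun (x # ps) l = (\<Sum>i<Suc (Suc n). ?d i * indicator {-pi<..?s i} l)"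
        using ok by (simp add: x IH split: split_indicator)
    qed (use IH ok in auto)
  qed
  then obtain n :: nat and c s where s: "\<forall>i<n. -pi \<le> s i \<and> s i \<le> pi"
      "\<And>\<omega>. step_integral Z ps \<omega> = (\<Sum>i<n. c i * (Z (s i) \<omega> - Z (-pi) \<omega>))"
      "\<And>l. step_fun ps l = (\<Sum>i<n. c i * indicator {-pi<..s i} l)"
    by blast
  have sq: "sq_integrable P (\<lambda>\<omega>. Z (s i) \<omega> - Z (-pi) \<omega>)" if "i \<in> {..<n}" for i
    using Z s(1) that unfolding orthogonal_increments_def sq_integrable_def lessThan_iff by blast
  have "complex_of_real (sqnorm P (step_integral Z ps))
    = (\<Sum>i<n. \<Sum>k<n. c i * cnj (c k) * (LINT \<omega>|P. (Z (s i) \<omega> - Z (-pi) \<omega>) * cnj (Z (s k) \<omega> - Z (-pi) \<omega>)))"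
    unfolding s(2) by (rule sq_integrable_gram) (rule sq)
  also have "\<dots> = (\<Sum>i<n. \<Sum>k<n. c i * cnj (c k) * (LINT l|freq. indicator {-pi<..s i} l * cnj (indicator {-pi<..s k} l :: complex)))"
    by (intro sum.cong refl arg_cong2[where f = "(*)"] increments_gram[OF Z]) (use s(1) in auto)
  also have "\<dots> = complex_of_real (sqnorm freq (step_fun ps))"
    unfolding s(3) by (rule sq_integrable_gram[symmetric]) (rule sq_integrable_indicator_freq)
  finally have "complex_of_real (sqnorm P (step_integral Z ps))
    = complex_of_real (sqnorm freq (step_fun ps))" .
  then show ?thesis by simp
qed

text \<open>
  In the limit the isometry gives equality without the factor. The factor comes from
  applying \<open>\<bar>a + b\<bar>\<^sup>2 \<le> 2\<bar>a\<bar>\<^sup>2 + 2\<bar>b\<bar>\<^sup>2\<close> twice, in place of Minkowski's inequality; only the order of magnitude matters.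
\<close>

lemma has_spectral_integral_norm_le:
  assumes Z: "orthogonal_increments P Z" and f: "has_spectral_integral P Z f I"
  shows "sqnorm P I \<le> 4 * sqnorm freq f"
proof -
  from f obtain ps where ps: "\<And>n::nat. steps_ok (ps n)"
    "(\<lambda>n. sqnorm freq (\<lambda>l. f l - step_fun (ps n) l)) \<longlonglongrightarrow> 0"
    "(\<lambda>n. sqnorm P (\<lambda>\<omega>. I \<omega> - step_integral Z (ps n) \<omega>)) \<longlonglongrightarrow> 0"
    and sf: "sq_integrable freq f" "sq_integrable P I"
    by (rule has_spectral_integralE) (rule that)
  let ?a = "\<lambda>n. sqnorm freq (\<lambda>l. f l - step_fun (ps n) l)"
  let ?b = "\<lambda>n. sqnorm P (\<lambda>\<omega>. I \<omega> - step_integral Z (ps n) \<omega>)"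
  have "sqnorm P I \<le> 2 * ?b n + 4 * ?a n + 4 * sqnorm freq f" for n
  proof -
    note s = sq_integrable_step_integral[OF Z ps(1)[of n]]
    have "sqnorm P I \<le> 2 * ?b n + 2 * sqnorm P (step_integral Z (ps n))"
      using sq_integrable_add(2)[OF sq_integrable_diff(1)[OF sf(2) s] s] by simp
    also have "sqnorm P (step_integral Z (ps n)) = sqnorm freq (step_fun (ps n))"
      by (rule step_integral_isometry[OF Z ps(1)])
    also have "\<dots> \<le> 2 * sqnorm freq f + 2 * ?a n"
      using sq_integrable_diff(2)[OF sf(1) sq_integrable_diff(1)[OF sf(1) sq_integrable_step_fun[of "ps n"]]] by simp
    finally show ?thesis by simp
  qed
  moreover have "(\<lambda>n. 2 * ?b n + 4 * ?a n + 4 * sqnorm freq f) \<longlonglongrightarrow> 2 * 0 + 4 * 0 + 4 * sqnorm freq f"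
    by (intro tendsto_intros ps)
  ultimately show ?thesis
    by (intro LIMSEQ_le_const[of _ "4 * sqnorm freq f"]) auto
qed

section \<open>Fourth moments of spectral integrals\<close>

text \<open>
  The representative of \<open>x\<close> modulo \<open>2\<pi>\<close> in \<open>[-\<pi>, \<pi>)\<close>. Composition with \<open>wrap\<close> extends a function on \<open>[-\<pi>, \<pi>]\<close> periodically,
  changing it at most at \<open>\<pi>\<close>.
\<close>

definition wrap :: "real \<Rightarrow> real" where
  "wrap x = x - 2 * pi * of_int \<lfloor>(x + pi) / (2 * pi)\<rfloor>"

lemma wrap_bounds: "-pi \<le> wrap x" "wrap x < pi"
proof -
  define q where "q = (x + pi) / (2 * pi)"
  have x: "x = 2 * pi * q - pi" by (simp add: q_def)
  have "2 * pi * of_int \<lfloor>q\<rfloor> \<le> 2 * pi * q" by (intro mult_left_mono) auto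
  moreover have "2 * pi * q < 2 * pi * (of_int \<lfloor>q\<rfloor> + 1)"
    by (intro mult_strict_left_mono) (auto simp: pi_gt_zero)
  ultimately show "-pi \<le> wrap x" "wrap x < pi"
    unfolding wrap_def q_def[symmetric] by (simp_all add: x algebra_simps)
qed

lemma wrap_periodic: "wrap (x + 2 * pi) = wrap x"
proof -
  have "(x + 2 * pi + pi) / (2 * pi) = (x + pi) / (2 * pi) + 1" by (simp add: field_simps)
  then show ?thesis by (simp add: wrap_def algebra_simps)
qed

lemma wrap_id: "-pi \<le> x \<Longrightarrow> x < pi \<Longrightarrow> wrap x = x"
proof -
  assume "-pi \<le> x" "x < pi"
  then have "\<lfloor>(x + pi) / (2 * pi)\<rfloor> = 0"
    by (intro floor_unique) (auto simp: field_simps)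
  then show ?thesis by (simp add: wrap_def)
qed

lemma wrap_measurable [measurable]: "wrap \<in> borel_measurable borel"
  unfolding wrap_def by measurable

lemma AE_freq: "(\<And>l. -pi \<le> l \<Longrightarrow> l \<le> pi \<Longrightarrow> l \<noteq> a \<Longrightarrow> Q l) \<Longrightarrow> AE l in freq. Q l"
  using AE_lborel_singleton[of a] by (subst AE_restrict_space_iff) (auto elim!: eventually_mono)

text \<open>
  Needed for the periodic extension of a spectral function, which may change its value at an end point.
\<close>

lemma has_spectral_integral_cong_AE:
  assumes f: "has_spectral_integral P Z f I" and g[measurable]: "g \<in> borel_measurable freq"
    and eq: "AE l in freq. f l = g l"
  shows "has_spectral_integral P Z g I"
proof -
  have [measurable]: "f \<in> borel_measurable freq" using f by (simp add: has_spectral_integral_iff sq_integrable_def)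
  have m[measurable]: "step_fun ps \<in> borel_measurable freq" for ps
    using sq_integrable_step_fun by (simp add: sq_integrable_def)
  have "sqnorm freq (\<lambda>l. f l - step_fun (ps n) l) = sqnorm freq (\<lambda>l. g l - step_fun (ps n) l)"
    for ps :: "nat \<Rightarrow> (complex \<times> real \<times> real) list" and n
    by (rule integral_cong_AE) (measurable, use eq in \<open>auto elim!: eventually_mono\<close>)
  moreover have "integrable freq (\<lambda>l. (cmod (g l))\<^sup>2) \<longleftrightarrow> integrable freq (\<lambda>l. (cmod (f l))\<^sup>2)"
    by (rule integrable_cong_AE) (measurable, use eq in \<open>auto elim!: eventually_mono\<close>)
  ultimately show ?thesis
    using f by (simp add: has_spectral_integral_iff sq_integrable_def)
qed

text \<open>
  The reflected window is contained in three adjacent periods once \<open>c\<close> is reduced modulo \<open>2\<pi>\<close>; this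
  crude covering costs a factor 3 compared with the exact invariance.
\<close>

lemma nn_integral_periodic_window:
  fixes H :: "real \<Rightarrow> ennreal"
  assumes [measurable]: "H \<in> borel_measurable borel" and per: "\<And>x. H (x + 2 * pi) = H x"
  shows "(\<integral>\<^sup>+z. indicator {-pi..pi} z * H (c - z) \<partial>lborel) \<le> 3 * (\<integral>\<^sup>+z. indicator {-pi..pi} z * H z \<partial>lborel)"
proof -
  have perm: "H (x + 2 * pi * of_nat n) = H x" for x and n :: nat
  proof (induction n)
    case (Suc n)
    then show ?case using per[of "x + 2 * pi * of_nat n"] by (simp add: algebra_simps)
  qed simp
  have perz: "H (x + 2 * pi * of_int n) = H x" for x n
  proof (cases "n \<ge> 0")
    case True
    then show ?thesis using perm[of x "nat n"] by simp
  next
    case False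
    then show ?thesis using perm[of "x + 2 * pi * of_int n" "nat (-n)"] by (simp add: algebra_simps)
  qed
  \<comment> \<open>Then \<open>c' - x\<close> lies in \<open>[-\<pi>, \<pi>]\<close> only if \<open>x\<close> lies in \<open>[-2\<pi>, 2\<pi>]\<close>.\<close>
  define c' where "c' = wrap c"
  have "H (c - z) = H (c' - z)" for z
    using perz[of "c - z" "- \<lfloor>(c + pi) / (2 * pi)\<rfloor>"] by (simp add: c'_def wrap_def algebra_simps)
  then have "(\<integral>\<^sup>+z. indicator {-pi..pi} z * H (c - z) \<partial>lborel) = (\<integral>\<^sup>+z. indicator {-pi..pi} z * H (c' - z) \<partial>lborel)"
    by simp
  also have "\<dots> = (\<integral>\<^sup>+x. indicator {-pi..pi} (c' - x) * H x \<partial>lborel)"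
    by (subst nn_integral_real_affine[of _ "-1" c']) auto
  also have "\<dots> \<le> (\<integral>\<^sup>+x. indicator {-pi..pi} (x + 2 * pi) * H x + indicator {-pi..pi} x * H x + indicator {-pi..pi} (x - 2 * pi) * H x \<partial>lborel)"
    using wrap_bounds[of c] unfolding c'_def[symmetric]
    by (intro nn_integral_mono) (auto split: split_indicator)
  also have "\<dots> = (\<integral>\<^sup>+x. indicator {-pi..pi} (x + 2 * pi) * H x \<partial>lborel) + (\<integral>\<^sup>+x. indicator {-pi..pi} x * H x \<partial>lborel)
     + (\<integral>\<^sup>+x. indicator {-pi..pi} (x - 2 * pi) * H x \<partial>lborel)"
    by (simp add: nn_integral_add)
  also have "(\<integral>\<^sup>+x. indicator {-pi..pi} (x + 2 * pi) * H x \<partial>lborel) = (\<integral>\<^sup>+x. indicator {-pi..pi} x * H x \<partial>lborel)"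
    using perz[of _ "-1"] by (subst nn_integral_real_affine[of _ 1 "-2*pi"]) auto
  also have "(\<integral>\<^sup>+x. indicator {-pi..pi} (x - 2 * pi) * H x \<partial>lborel) = (\<integral>\<^sup>+x. indicator {-pi..pi} x * H x \<partial>lborel)"
    using per by (subst nn_integral_real_affine[of _ 1 "2*pi"]) (auto simp: add.commute)
  finally have le: "(\<integral>\<^sup>+z. indicator {-pi..pi} z * H (c - z) \<partial>lborel) \<le> (\<integral>\<^sup>+z. indicator {-pi..pi} z * H z \<partial>lborel)
    + (\<integral>\<^sup>+z. indicator {-pi..pi} z * H z \<partial>lborel) + (\<integral>\<^sup>+z. indicator {-pi..pi} z * H z \<partial>lborel)" .
  have "3 * a = a + a + a" for a :: ennreal
    using distrib_right[of 2 1 a] by (simp add: mult_2)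
  then show ?thesis using le by simp
qed

lemma ennreal_mult_le_squares: "0 \<le> a \<Longrightarrow> 0 \<le> b \<Longrightarrow> ennreal (a * b) \<le> ennreal (a\<^sup>2) + ennreal (b\<^sup>2)"
proof -
  assume "0 \<le> a" "0 \<le> b"
  then have "a * b \<le> a\<^sup>2 + b\<^sup>2"
    using sum_squares_bound[of a b] mult_nonneg_nonneg[of a b] by linarith
  then show ?thesis
    unfolding ennreal_plus[symmetric, OF zero_le_power2 zero_le_power2] by (rule ennreal_leI)
qed

text \<open>
  For fixed \<open>x\<close> and \<open>y\<close> the integral over \<open>z\<close> is an inner product of \<open>G\<close> with a reflected translate of itself,
  hence bounded by the squared norm. The remaining product \<open>G(x) G(y)\<close> is integrated in the same way.
  Products are replaced by sums of squares throughout.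
\<close>

lemma nn_integral_fourfold:
  fixes G :: "real \<Rightarrow> real"
  assumes G[measurable]: "G \<in> borel_measurable borel" and per: "\<And>x. G (x + 2 * pi) = G x" and pos: "\<And>x. G x \<ge> 0"
  defines "S \<equiv> \<integral>\<^sup>+z. indicator {-pi..pi} z * ennreal ((G z)\<^sup>2) \<partial>lborel"
  shows "(\<integral>\<^sup>+(x, y, z). indicator {-pi..pi} x * indicator {-pi..pi} y * indicator {-pi..pi} z *
      ennreal (G x * G y * G z * G (- x - y - z)) \<partial>lborel) \<le> ennreal (16 * pi) * S * S"
proof -
  let ?I = "indicator {-pi..pi} :: real \<Rightarrow> ennreal"
  have S3: "(\<integral>\<^sup>+z. ?I z * ennreal (G z * G (c - z)) \<partial>lborel) \<le> 4 * S" for c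
  proof -
    have "(\<integral>\<^sup>+z. ?I z * ennreal (G z * G (c - z)) \<partial>lborel)
       \<le> (\<integral>\<^sup>+z. ?I z * ennreal ((G z)\<^sup>2) + ?I z * ennreal ((G (c - z))\<^sup>2) \<partial>lborel)"
      by (intro nn_integral_mono) (auto simp: pos ennreal_mult_le_squares split: split_indicator)
    also have "\<dots> = S + (\<integral>\<^sup>+z. ?I z * ennreal ((G (c - z))\<^sup>2) \<partial>lborel)"
      unfolding S_def by (simp add: nn_integral_add)
    also have "(\<integral>\<^sup>+z. ?I z * ennreal ((G (c - z))\<^sup>2) \<partial>lborel) \<le> 3 * S"
      unfolding S_def by (rule nn_integral_periodic_window) (auto simp: per)
    finally show ?thesis using distrib_right[of 1 3 S] by (simp add: add_left_mono)
  qed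
  have I: "(\<integral>\<^sup>+z. ?I z \<partial>lborel) = ennreal (2 * pi)"
    by (simp add: emeasure_lborel_Icc_eq)
  have "(\<integral>\<^sup>+(x, y, z). ?I x * ?I y * ?I z * ennreal (G x * G y * G z * G (- x - y - z)) \<partial>lborel)
    = (\<integral>\<^sup>+x. \<integral>\<^sup>+y. \<integral>\<^sup>+z. ?I x * ?I y * ?I z * ennreal (G x * G y * G z * G (- x - y - z)) \<partial>lborel \<partial>lborel \<partial>lborel)"
  proof -
    let ?h = "\<lambda>(x, y, z). ?I x * ?I y * ?I z * ennreal (G x * G y * G z * G (- x - y - z))"
    have m[measurable]: "?h \<in> borel_measurable (lborel \<Otimes>\<^sub>M lborel \<Otimes>\<^sub>M lborel)" by measurable
    have "integral\<^sup>N (lborel \<Otimes>\<^sub>M lborel) ?h = (\<integral>\<^sup>+x. \<integral>\<^sup>+w. ?h (x, w) \<partial>lborel \<partial>lborel)"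
      using m by (intro lborel.nn_integral_fst[symmetric]) (simp add: lborel_prod)
    also have "\<dots> = (\<integral>\<^sup>+x. \<integral>\<^sup>+y. \<integral>\<^sup>+z. ?h (x, y, z) \<partial>lborel \<partial>lborel \<partial>lborel)"
    proof (rule nn_integral_cong)
      fix x :: real
      have "integral\<^sup>N (lborel \<Otimes>\<^sub>M lborel) (\<lambda>w. ?h (x, w)) = (\<integral>\<^sup>+y. \<integral>\<^sup>+z. ?h (x, (y, z)) \<partial>lborel \<partial>lborel)"
        by (intro lborel.nn_integral_fst[symmetric]) measurable
      then show "(\<integral>\<^sup>+w. ?h (x, w) \<partial>lborel) = (\<integral>\<^sup>+y. \<integral>\<^sup>+z. ?h (x, y, z) \<partial>lborel \<partial>lborel)"
        by (simp add: lborel_prod)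
    qed
    finally show ?thesis by (simp add: lborel_prod)
  qed
  also have "\<dots> = (\<integral>\<^sup>+x. \<integral>\<^sup>+y. ?I x * ?I y * ennreal (G x * G y) *
      (\<integral>\<^sup>+z. ?I z * ennreal (G z * G (- x - y - z)) \<partial>lborel) \<partial>lborel \<partial>lborel)"
    by (intro nn_integral_cong, subst nn_integral_cmult[symmetric])
       (auto intro!: nn_integral_cong simp: pos ennreal_mult[symmetric] mult_ac split: split_indicator)
  also have "\<dots> \<le> (\<integral>\<^sup>+x. \<integral>\<^sup>+y. ?I x * ?I y * ennreal (G x * G y) * (4 * S) \<partial>lborel \<partial>lborel)"
    by (intro nn_integral_mono mult_left_mono S3) auto
  also have "\<dots> \<le> (\<integral>\<^sup>+x. \<integral>\<^sup>+y. (?I y * (?I x * ennreal ((G x)\<^sup>2)) + ?I x * (?I y * ennreal ((G y)\<^sup>2))) * (4 * S) \<partial>lborel \<partial>lborel)"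
    by (intro nn_integral_mono mult_right_mono)
       (auto simp: pos ennreal_mult_le_squares split: split_indicator)
  also have "\<dots> = (\<integral>\<^sup>+x. (ennreal (2 * pi) * (?I x * ennreal ((G x)\<^sup>2)) + ?I x * S) * (4 * S) \<partial>lborel)"
    by (simp add: nn_integral_multc nn_integral_cmult nn_integral_add I S_def)
  also have "\<dots> = (ennreal (2 * pi) * S + ennreal (2 * pi) * S) * (4 * S)"
    by (simp add: nn_integral_multc nn_integral_cmult nn_integral_add I flip: S_def)
  also have "\<dots> = ennreal (16 * pi) * S * S"
  proof -
    have "ennreal (16 * pi) = (ennreal (2 * pi) + ennreal (2 * pi)) * 4"
      by (subst ennreal_plus[symmetric], simp, simp, subst ennreal_numeral[symmetric], subst ennreal_mult[symmetric]) auto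
    then show ?thesis by (simp add: algebra_simps)
  qed
  finally show ?thesis .
qed

text \<open>
  A bound for the integral of the modulus suffices: it applies if the integrand is integrable,
  and otherwise the value of the integral is \<open>0\<close>.
\<close>

lemma cumulant_integral_bound:
  assumes f: "f \<in> borel_measurable borel" and per: "\<And>x. f (x + 2 * pi) = f x"
    and sq: "sq_integrable freq f"
    and K: "\<And>x y z. (x, y, z) \<in> {-pi..pi} \<times> {-pi..pi} \<times> {-pi..pi} \<Longrightarrow> cmod (\<kappa> (x, y, z)) \<le> K" and "K \<ge> 0"
  shows "cmod (LINT (x, y, z):({-pi..pi} \<times> {-pi..pi} \<times> {-pi..pi})|lborel.
             \<kappa> (x, y, z) * f x * f y * f z * f (- x - y - z))
       \<le> 16 * pi * K * (sqnorm freq f)\<^sup>2"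
proof -
  let ?C = "{-pi..pi} \<times> {-pi..pi} \<times> {-pi..pi::real}"
  let ?g = "\<lambda>w. indicator ?C w *\<^sub>R (case w of (x, y, z) \<Rightarrow> \<kappa> (x, y, z) * f x * f y * f z * f (- x - y - z))"
  let ?s = "sqnorm freq f"
  have [measurable]: "(\<lambda>x. cmod (f x)) \<in> borel_measurable borel" using f by measurable
  have S: "(\<integral>\<^sup>+z. indicator {-pi..pi} z * ennreal ((cmod (f z))\<^sup>2) \<partial>lborel) = ennreal ?s"
    using sq by (subst nn_integral_eq_integral[symmetric])
      (auto simp: sq_integrable_def nn_integral_restrict_space mult.commute)
  have "(\<integral>\<^sup>+w. ennreal (norm (?g w)) \<partial>lborel) \<le>
    (\<integral>\<^sup>+w. ennreal K * (case w of (x, y, z) \<Rightarrow> indicator {-pi..pi} x * indicator {-pi..pi} y * indicator {-pi..pi} z *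
      ennreal (cmod (f x) * cmod (f y) * cmod (f z) * cmod (f (- x - y - z)))) \<partial>lborel)"
  proof (intro nn_integral_mono, clarify)
    fix x y z :: real
    show "ennreal (norm (indicator ?C (x, y, z) *\<^sub>R (\<kappa> (x, y, z) * f x * f y * f z * f (- x - y - z)))) \<le>
      ennreal K * (indicator {-pi..pi} x * indicator {-pi..pi} y * indicator {-pi..pi} z *
      ennreal (cmod (f x) * cmod (f y) * cmod (f z) * cmod (f (- x - y - z))))"
    proof (cases "(x, y, z) \<in> ?C")
      case True
      have "norm (\<kappa> (x, y, z) * f x * f y * f z * f (- x - y - z))
         = cmod (\<kappa> (x, y, z)) * (cmod (f x) * cmod (f y) * cmod (f z) * cmod (f (- x - y - z)))"
        by (simp add: norm_mult)
      also have "\<dots> \<le> K * (cmod (f x) * cmod (f y) * cmod (f z) * cmod (f (- x - y - z)))"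
        by (intro mult_right_mono K True) auto
      finally show ?thesis
        using True \<open>K \<ge> 0\<close> by (simp add: ennreal_mult[symmetric] ennreal_leI)
    qed simp
  qed
  also have "\<dots> \<le> ennreal K * (ennreal (16 * pi) * ennreal ?s * ennreal ?s)"
    using nn_integral_fourfold[of "\<lambda>x. cmod (f x)"] per
    by (subst nn_integral_cmult) (auto simp: S intro!: mult_left_mono simp flip: lborel_prod)
  also have "\<dots> = ennreal (16 * pi * K * ?s\<^sup>2)"
    using \<open>K \<ge> 0\<close> by (simp add: ennreal_mult[symmetric] power2_eq_square mult_ac)
  finally have le: "(\<integral>\<^sup>+w. ennreal (norm (?g w)) \<partial>lborel) \<le> ennreal (16 * pi * K * ?s\<^sup>2)" .
  show ?thesis
  proof (cases "integrable lborel ?g")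
    case True
    have "ennreal (norm (integral\<^sup>L lborel ?g)) \<le> ennreal (16 * pi * K * ?s\<^sup>2)"
      using integral_norm_bound_ennreal[OF True] le by simp
    then show ?thesis
      using \<open>K \<ge> 0\<close> by (simp add: set_lebesgue_integral_def ennreal_le_iff)
  next
    case False
    then show ?thesis
      using \<open>K \<ge> 0\<close> not_integrable_integral_eq[OF False] by (simp add: set_lebesgue_integral_def)
  qed
qed

text \<open>
  With \<open>Y\<close> the centered variable, \<open>E Y\<^sup>4\<close> is the cumulant plus \<open>3 (E Y\<^sup>2)\<^sup>2\<close>. The mean is bounded by the second
  moment, so that \<open>(Y + m)\<^sup>4 \<le> 8Y\<^sup>4 + 8m\<^sup>4\<close> carries the estimate over to \<open>W\<close> itself.
\<close>

lemma spectral_integral_fourth_moment: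
  assumes "prob_space P" and Z: "orthogonal_increments P Z"
    and cum: "fourth_cumulant_density P Z \<kappa>"
    and K: "\<And>x y z. (x, y, z) \<in> {-pi..pi} \<times> {-pi..pi} \<times> {-pi..pi} \<Longrightarrow> cmod (\<kappa> (x, y, z)) \<le> K" and "K \<ge> 0"
    and f: "has_spectral_integral P Z f (\<lambda>\<omega>. complex_of_real (W \<omega>))"
  shows "W \<in> borel_measurable P" "integrable P (\<lambda>\<omega>. W \<omega> ^ 4)"
    and "(LINT \<omega>|P. W \<omega> ^ 4) \<le> (128 * pi * K + 512) * (sqnorm freq f)\<^sup>2"
proof -
  interpret prob_space P by fact
  let ?S = "sqnorm freq f"
  let ?I = "\<lambda>\<omega>. complex_of_real (W \<omega>)"
  define fp where "fp = (\<lambda>x. f (wrap x))"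
  have fm: "(\<lambda>x. indicator {-pi..pi} x *\<^sub>R f x) \<in> borel_measurable borel"
    using f by (simp add: has_spectral_integral_def L2_on_def set_borel_measurable_def)
  have "fp = (\<lambda>x. (\<lambda>x. indicator {-pi..pi} x *\<^sub>R f x) (wrap x))"
    using wrap_bounds by (auto simp: fp_def fun_eq_iff less_imp_le)
  then have fpm[measurable]: "fp \<in> borel_measurable borel"
    using measurable_compose[OF wrap_measurable fm] by simp
  have eq: "AE l in freq. f l = fp l"
    by (rule AE_freq[of pi]) (auto simp: fp_def wrap_id)
  have fp: "has_spectral_integral P Z fp ?I"
    by (rule has_spectral_integral_cong_AE[OF f _ eq]) (simp add: measurable_restrict_space1)
  have per: "fp (l + 2 * pi) = fp l" for l by (simp add: fp_def wrap_periodic)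
  have sqf: "sq_integrable freq f" and sqfp: "sq_integrable freq fp" using f fp by (auto simp: has_spectral_integral_iff)
  have Seq: "sqnorm freq fp = ?S"
    using sqf sqfp eq unfolding sq_integrable_def by (intro integral_cong_AE) (auto elim!: eventually_mono)
  define c where "c = (LINT (x, y, z):({-pi..pi} \<times> {-pi..pi} \<times> {-pi..pi})|lborel.
             \<kappa> (x, y, z) * fp x * fp y * fp z * fp (- x - y - z))"
  have c_le: "cmod c \<le> 16 * pi * K * ?S\<^sup>2"
    unfolding c_def Seq[symmetric] by (rule cumulant_integral_bound) (use fpm per sqfp K \<open>K \<ge> 0\<close> in auto)
  have hc: "has_cumulant4 P ?I ?I ?I ?I c"
    unfolding c_def by (rule cum[unfolded fourth_cumulant_density_def, rule_format]) (use per fp in auto)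
  have Im: "?I \<in> borel_measurable P" and I4: "integrable P (\<lambda>\<omega>. cmod (?I \<omega>) ^ 4)"
    using hc by (auto simp: has_cumulant4_def)
  have "(\<lambda>\<omega>. Re (?I \<omega>)) \<in> borel_measurable P" using Im by measurable
  then show Wm[measurable]: "W \<in> borel_measurable P" by simp
  show W4: "integrable P (\<lambda>\<omega>. W \<omega> ^ 4)" using I4 by simp
  have W2: "integrable P (\<lambda>\<omega>. (W \<omega>)\<^sup>2)" and W2le: "(LINT \<omega>|P. (W \<omega>)\<^sup>2) \<le> 4 * ?S"
    using f has_spectral_integral_norm_le[OF Z f] by (auto simp: has_spectral_integral_iff sq_integrable_def)
  have W1: "integrable P W" by (rule square_integrable_imp_integrable[OF Wm W2])
  define m where "m = expectation W"
  define Y where "Y = (\<lambda>\<omega>. W \<omega> - m)"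
  have Ym[measurable]: "Y \<in> borel_measurable P" unfolding Y_def by measurable
  have cent: "centered P ?I \<omega> = complex_of_real (Y \<omega>)" for \<omega>
    unfolding centered_def Y_def m_def integral_complex_of_real by simp
  have var: "expectation (\<lambda>\<omega>. (Y \<omega>)\<^sup>2) = expectation (\<lambda>\<omega>. (W \<omega>)\<^sup>2) - m\<^sup>2"
    using variance_eq[OF W1 W2] by (simp add: Y_def m_def)
  have "expectation (\<lambda>\<omega>. (Y \<omega>)\<^sup>2) \<ge> 0" by simp
  then have m2: "m\<^sup>2 \<le> 4 * ?S" and Y2: "expectation (\<lambda>\<omega>. (Y \<omega>)\<^sup>2) \<le> 4 * ?S"
    using var W2le zero_le_power2[of m] by linarith+
  have "c = complex_of_real (expectation (\<lambda>\<omega>. Y \<omega> ^ 4)) - 3 * (complex_of_real (expectation (\<lambda>\<omega>. (Y \<omega>)\<^sup>2)))\<^sup>2"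
    using hc unfolding has_cumulant4_def Let_def cent
    by (simp add: power2_eq_square power4_eq_xxxx flip: of_real_mult)
  then have "complex_of_real (expectation (\<lambda>\<omega>. Y \<omega> ^ 4) - 3 * (expectation (\<lambda>\<omega>. (Y \<omega>)\<^sup>2))\<^sup>2) = c"
    by simp
  then have "expectation (\<lambda>\<omega>. Y \<omega> ^ 4) - 3 * (expectation (\<lambda>\<omega>. (Y \<omega>)\<^sup>2))\<^sup>2 = Re c"
    by (metis Re_complex_of_real)
  also have "\<dots> \<le> 16 * pi * K * ?S\<^sup>2" using c_le complex_Re_le_cmod order.trans by blast
  finally have "expectation (\<lambda>\<omega>. Y \<omega> ^ 4) \<le> 16 * pi * K * ?S\<^sup>2 + 3 * (expectation (\<lambda>\<omega>. (Y \<omega>)\<^sup>2))\<^sup>2" by simp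
  moreover have "(expectation (\<lambda>\<omega>. (Y \<omega>)\<^sup>2))\<^sup>2 \<le> (4 * ?S)\<^sup>2"
    using Y2 by (intro power_mono) auto
  ultimately have Y4: "expectation (\<lambda>\<omega>. Y \<omega> ^ 4) \<le> (16 * pi * K + 48) * ?S\<^sup>2"
    by (simp add: power_mult_distrib algebra_simps)
  have q4: "(a + b) ^ 4 \<le> 8 * a ^ 4 + 8 * b ^ 4" for a b :: real
  proof -
    have sq: "(x + y)\<^sup>2 \<le> 2 * x\<^sup>2 + 2 * y\<^sup>2" for x y :: real
      using sum_squares_bound[of x y] by (simp add: power2_sum)
    have "(a + b) ^ 4 = ((a + b)\<^sup>2)\<^sup>2" by simp
    also have "\<dots> \<le> (2 * a\<^sup>2 + 2 * b\<^sup>2)\<^sup>2" by (intro power_mono sq) auto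
    also have "\<dots> \<le> 2 * (2 * a\<^sup>2)\<^sup>2 + 2 * (2 * b\<^sup>2)\<^sup>2" by (rule sq)
    finally show ?thesis by (simp add: power_mult_distrib)
  qed
  have Y4i: "integrable P (\<lambda>\<omega>. Y \<omega> ^ 4)"
  proof (rule Bochner_Integration.integrable_bound)
    show "integrable P (\<lambda>\<omega>. 8 * W \<omega> ^ 4 + 8 * m ^ 4)" using W4 by simp
    show "AE \<omega> in P. norm (Y \<omega> ^ 4) \<le> norm (8 * W \<omega> ^ 4 + 8 * m ^ 4)"
      using q4[of _ "-m"] by (auto simp: Y_def)
  qed measurable
  \<comment> \<open>The mean contributes \<open>8 (4S)\<^sup>2\<close>, so the constant is \<open>8 (16\<pi>K + 48) + 128\<close>.\<close>
  have "expectation (\<lambda>\<omega>. W \<omega> ^ 4) \<le> expectation (\<lambda>\<omega>. 8 * Y \<omega> ^ 4 + 8 * m ^ 4)"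
    using W4 Y4i q4[of "Y _" m] by (intro integral_mono) (auto simp: Y_def)
  also have "\<dots> = 8 * expectation (\<lambda>\<omega>. Y \<omega> ^ 4) + 8 * (m\<^sup>2)\<^sup>2"
    using Y4i by (simp add: prob_space)
  also have "\<dots> \<le> 8 * ((16 * pi * K + 48) * ?S\<^sup>2) + 8 * (4 * ?S)\<^sup>2"
    using m2 by (intro add_mono mult_left_mono Y4 power_mono) auto
  also have "\<dots> = (128 * pi * K + 512) * ?S\<^sup>2"
    by (simp add: power_mult_distrib algebra_simps)
  finally show "(LINT \<omega>|P. W \<omega> ^ 4) \<le> (128 * pi * K + 512) * ?S\<^sup>2" .
qed

section \<open>Finite differences of finitely supported sequences\<close>

lemma finite_supp_bound:
  fixes g :: "int \<Rightarrow> 'b::zero"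
  assumes "finite {t. g t \<noteq> 0}"
  obtains a where "a \<ge> 0" "\<And>t. \<bar>t\<bar> > a \<Longrightarrow> g t = 0"
proof -
  define a where "a = Max (insert 0 (abs ` {t. g t \<noteq> 0}))"
  have "g t = 0" if "\<bar>t\<bar> > a" for t
  proof (rule ccontr)
    assume "g t \<noteq> 0"
    then have "\<bar>t\<bar> \<le> a" unfolding a_def using assms by (intro Max_ge) auto
    then show False using that by simp
  qed
  moreover have "a \<ge> 0" unfolding a_def using assms by (intro Max_ge) auto
  ultimately show ?thesis using that by blast
qed

lemma bdiff_supp: "bdiff g t \<noteq> 0 \<Longrightarrow> g t \<noteq> 0 \<or> g (t - 1) \<noteq> 0"
  by (auto simp: bdiff_def)

lemma finite_supp_bdiff:
  assumes "finite {t. g t \<noteq> 0}"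
  shows "finite {t. bdiff g t \<noteq> 0}"
proof (rule finite_subset)
  show "{t. bdiff g t \<noteq> 0} \<subseteq> {t. g t \<noteq> 0} \<union> (\<lambda>t. t + 1) ` {t. g t \<noteq> 0}"
  proof
    fix t assume "t \<in> {t. bdiff g t \<noteq> 0}"
    then have "g t \<noteq> 0 \<or> g (t - 1) \<noteq> 0" using bdiff_supp by blast
    moreover have "t = (t - 1) + 1" by simp
    ultimately show "t \<in> {t. g t \<noteq> 0} \<union> (\<lambda>t. t + 1) ` {t. g t \<noteq> 0}" by blast
  qed
qed (use assms in auto)

lemma finite_supp_bdiff_funpow:
  "finite {t. g t \<noteq> 0} \<Longrightarrow> finite {t. (bdiff ^^ i) g t \<noteq> 0}"
  by (induction i) (auto intro: finite_supp_bdiff)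

text \<open>
  Both sequences vanish far to the left, and equal increments propagate equality to the right.
\<close>

lemma bdiff_inj:
  assumes "finite {t. g t \<noteq> 0}" "finite {t. g' t \<noteq> 0}" "bdiff g = bdiff g'"
  shows "g = g'"
proof -
  obtain a where a: "\<And>t. \<bar>t\<bar> > a \<Longrightarrow> g t = 0" "a \<ge> 0" using finite_supp_bound[OF assms(1)] by metis
  obtain b where b: "\<And>t. \<bar>t\<bar> > b \<Longrightarrow> g' t = 0" "b \<ge> 0" using finite_supp_bound[OF assms(2)] by metis
  have step: "g t - g (t - 1) = g' t - g' (t - 1)" for t
    using fun_cong[OF assms(3), of t] by (simp add: bdiff_def)
  have "g t = g' t" if "t \<ge> - a - b - 1" for t
    using that
  proof (induction t rule: int_ge_induct)
    case base
    then show ?case using a b by simp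
  next
    case (step i)
    then show ?case using \<open>g (i + 1) - g (i + 1 - 1) = g' (i + 1) - g' (i + 1 - 1)\<close> by simp
  qed
  moreover have "g t = g' t" if "\<not> t \<ge> - a - b - 1" for t
    using that a b by simp
  ultimately show ?thesis by blast
qed

lemma bdiff_funpow_inj:
  assumes "finite {t. g t \<noteq> 0}" "finite {t. g' t \<noteq> 0}" "(bdiff ^^ p) g = (bdiff ^^ p) g'"
  shows "g = g'"
  using assms(3)
proof (induction p)
  case (Suc p)
  then show ?case
    using bdiff_inj[OF finite_supp_bdiff_funpow[OF assms(1), of p] finite_supp_bdiff_funpow[OF assms(2), of p]] by simp
qed simp

text \<open>
  The difference of the two sums telescopes, and the boundary terms lie outside the support of \<open>g\<close>.
\<close>

lemma summation_by_parts:
  fixes g :: "int \<Rightarrow> real" and x :: "int \<Rightarrow> 'b::real_vector"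
  assumes "\<And>t. \<bar>t\<bar> > a \<Longrightarrow> g t = 0" and "L > a + \<bar>m\<bar> + 1"
  shows "(\<Sum>t\<in>{-L..L}. bdiff g (m - t) *\<^sub>R x t) = (\<Sum>t\<in>{-L..L}. g (m - t) *\<^sub>R bdiff x t)"
proof -
  have tele: "(\<Sum>t\<in>{-L..-L + int n}. h t - h (t + 1)) = h (-L) - h (-L + int n + 1)" for h :: "int \<Rightarrow> 'b" and n
  proof (induction n)
    case (Suc n)
    have "{-L..-L + int (Suc n)} = insert (-L + int n + 1) {-L..-L + int n}" by auto
    then show ?case using Suc by (simp add: algebra_simps)
  qed simp
  show ?thesis
  proof (cases "L \<ge> 0")
    case True
    have "(\<Sum>t\<in>{-L..L}. bdiff g (m - t) *\<^sub>R x t) - (\<Sum>t\<in>{-L..L}. g (m - t) *\<^sub>R bdiff x t)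
      = (\<Sum>t\<in>{-L..L}. g (m - t) *\<^sub>R x (t - 1) - g (m - (t + 1)) *\<^sub>R x (t + 1 - 1))"
      unfolding sum_subtractf[symmetric] by (rule sum.cong) (auto simp: bdiff_def algebra_simps)
    also have "\<dots> = g (m + L) *\<^sub>R x (- L - 1) - g (m - L - 1) *\<^sub>R x L"
      using tele[of "\<lambda>t. g (m - t) *\<^sub>R x (t - 1)" "nat (2 * L)"] True by (simp add: algebra_simps)
    also have "\<dots> = 0" using assms by simp
    finally show ?thesis by simp
  qed simp
qed

lemma summation_by_parts_funpow:
  fixes g :: "int \<Rightarrow> real" and x :: "int \<Rightarrow> 'b::real_vector"
  assumes "finite {t. g t \<noteq> 0}"
  shows "\<exists>L0. \<forall>L\<ge>L0. (\<Sum>t\<in>{-L..L}. (bdiff ^^ p) g (m - t) *\<^sub>R x t) = (\<Sum>t\<in>{-L..L}. g (m - t) *\<^sub>R (bdiff ^^ p) x t)"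
proof (induction p arbitrary: x)
  case (Suc p)
  obtain a where a: "\<And>t. \<bar>t\<bar> > a \<Longrightarrow> (bdiff ^^ p) g t = 0"
    using finite_supp_bound[OF finite_supp_bdiff_funpow[OF assms, of p]] by metis
  from Suc[of "bdiff x"] obtain L0 where
    L0: "\<forall>L\<ge>L0. (\<Sum>t\<in>{-L..L}. (bdiff ^^ p) g (m - t) *\<^sub>R bdiff x t) = (\<Sum>t\<in>{-L..L}. g (m - t) *\<^sub>R (bdiff ^^ p) (bdiff x) t)" ..
  show ?case
  proof (intro exI[of _ "max L0 (a + \<bar>m\<bar> + 2)"] allI impI)
    fix L assume L: "L \<ge> max L0 (a + \<bar>m\<bar> + 2)"
    show "(\<Sum>t\<in>{-L..L}. (bdiff ^^ Suc p) g (m - t) *\<^sub>R x t) = (\<Sum>t\<in>{-L..L}. g (m - t) *\<^sub>R (bdiff ^^ Suc p) x t)"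
      using summation_by_parts[where a = a and L = L and m = m and x = x and g = "(bdiff ^^ p) g"] a L0[rule_format, of L] L by (simp add: funpow_swap1)
  qed
qed (auto intro!: exI[of _ 0])

lemma sum_finite_supp_window:
  fixes F :: "int \<Rightarrow> 'b::comm_monoid_add"
  assumes "finite {t. F t \<noteq> 0}"
  shows "\<exists>L0. \<forall>L\<ge>L0. (\<Sum>t\<in>{-L..L}. F t) = (\<Sum>t | F t \<noteq> 0. F t)"
proof -
  obtain a where a: "\<And>t. \<bar>t\<bar> > a \<Longrightarrow> F t = 0" using finite_supp_bound[OF assms] by metis
  have "(\<Sum>t | F t \<noteq> 0. F t) = (\<Sum>t\<in>{-L..L}. F t)" if "L \<ge> a" for L
  proof (rule sum.mono_neutral_left)
    show "{t. F t \<noteq> 0} \<subseteq> {-L..L}"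
    proof
      fix t assume "t \<in> {t. F t \<noteq> 0}"
      then have "\<not> \<bar>t\<bar> > a" using a by blast
      then show "t \<in> {-L..L}" using that by auto
    qed
  qed auto
  then show ?thesis by metis
qed

text \<open>
  Both sums effectively run over all integers. Allowing any finite sets that contain the supports makes
  the formula applicable both to the observation window and to the support of the filter.
\<close>

lemma sum_bdiff_funpow:
  fixes g :: "int \<Rightarrow> real" and x :: "int \<Rightarrow> 'b::real_vector"
  assumes g: "finite {t. g t \<noteq> 0}"
    and S: "finite S" "\<And>t. (bdiff ^^ p) g (m - t) \<noteq> 0 \<Longrightarrow> t \<in> S"
    and R: "finite R" "\<And>t. g (m - t) \<noteq> 0 \<Longrightarrow> t \<in> R"
  shows "(\<Sum>t\<in>S. (bdiff ^^ p) g (m - t) *\<^sub>R x t) = (\<Sum>t\<in>R. g (m - t) *\<^sub>R (bdiff ^^ p) x t)"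
proof -
  let ?F = "\<lambda>t. (bdiff ^^ p) g (m - t) *\<^sub>R x t" and ?G = "\<lambda>t. g (m - t) *\<^sub>R (bdiff ^^ p) x t"
  have subS: "{t. ?F t \<noteq> 0} \<subseteq> S" using S(2) by (metis (mono_tags, lifting) mem_Collect_eq scale_eq_0_iff subsetI)
  have subR: "{t. ?G t \<noteq> 0} \<subseteq> R" using R(2) by (metis (mono_tags, lifting) mem_Collect_eq scale_eq_0_iff subsetI)
  have F: "finite {t. ?F t \<noteq> 0}" by (rule finite_subset[OF subS S(1)])
  have G: "finite {t. ?G t \<noteq> 0}" by (rule finite_subset[OF subR R(1)])
  from sum_finite_supp_window[OF F] obtain L1 where L1: "\<forall>L\<ge>L1. (\<Sum>t\<in>{-L..L}. ?F t) = (\<Sum>t | ?F t \<noteq> 0. ?F t)" ..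
  from sum_finite_supp_window[OF G] obtain L2 where L2: "\<forall>L\<ge>L2. (\<Sum>t\<in>{-L..L}. ?G t) = (\<Sum>t | ?G t \<noteq> 0. ?G t)" ..
  from summation_by_parts_funpow[OF g, of p m x]
  obtain L3 where L3: "\<forall>L\<ge>L3. (\<Sum>t\<in>{-L..L}. ?F t) = (\<Sum>t\<in>{-L..L}. ?G t)" ..
  define L where "L = max L1 (max L2 L3)"
  have L: "L1 \<le> L" "L2 \<le> L" "L3 \<le> L" by (auto simp: L_def)
  have "(\<Sum>t\<in>S. ?F t) = (\<Sum>t | ?F t \<noteq> 0. ?F t)"
    by (rule sum.mono_neutral_right[OF S(1) subS]) blast
  also have "\<dots> = (\<Sum>t | ?G t \<noteq> 0. ?G t)"
    using L1[rule_format, OF L(1)] L2[rule_format, OF L(2)] L3[rule_format, OF L(3)] by (simp only:)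
  also have "\<dots> = (\<Sum>t\<in>R. ?G t)"
    by (rule sum.mono_neutral_left[OF R(1) subR]) blast
  finally show ?thesis .
qed

text \<open>
  Binomial coefficients replace powers of \<open>t\<close> because the difference of \<open>t gchoose Suc m\<close> is \<open>t gchoose m\<close>:
  taking differences shifts these moments without producing lower order terms.
\<close>

definition binomial_moment :: "nat \<Rightarrow> (int \<Rightarrow> real) \<Rightarrow> real" where
  "binomial_moment m h = (\<Sum>t | h t \<noteq> 0. h t * (of_int t gchoose m))"

text \<open>
  The partial sums of \<open>h\<close> vanish beyond \<open>b\<close> because the total sum does. Summation by parts turns the
  remaining vanishing moments of \<open>h\<close> into those of the partial sums, which allows iteration.
\<close>

lemma exists_bdiff_primitive:
  fixes h :: "int \<Rightarrow> real"
  assumes supp: "\<And>t. t \<notin> {a..b} \<Longrightarrow> h t = 0" and B: "\<And>t. \<bar>h t\<bar> \<le> B"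
    and van: "\<And>m. m < Suc p \<Longrightarrow> binomial_moment m h = 0" and ab: "a \<le> b"
  obtains g where "bdiff g = h" "\<And>t. t \<notin> {a..b} \<Longrightarrow> g t = 0" "\<And>t. \<bar>g t\<bar> \<le> of_int (b - a + 1) * B"
    "\<And>m. m < p \<Longrightarrow> binomial_moment m g = 0"
proof -
  define g where "g t = (\<Sum>i\<in>{a..t}. h i)" for t
  have bm: "binomial_moment m f = (\<Sum>t\<in>{a..b}. f t * (of_int t gchoose m))"
    if "\<And>t. t \<notin> {a..b} \<Longrightarrow> f t = 0" for f m
    unfolding binomial_moment_def by (rule sum.mono_neutral_left) (simp, use that in blast, simp)
  have sum0: "(\<Sum>i\<in>{a..b}. h i) = 0"
    using van[of 0] bm[where m = 0, OF supp] by simp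
  have dg: "bdiff g = h"
  proof
    fix t show "bdiff g t = h t"
    proof (cases "a \<le> t")
      case True
      then have "{a..t} = insert t {a..t - 1}" by auto
      then show ?thesis by (simp add: bdiff_def g_def)
    next
      case False
      then show ?thesis using supp[of t] by (simp add: bdiff_def g_def)
    qed
  qed
  have g0: "g t = 0" if "t \<notin> {a..b}" for t
  proof (cases "t < a")
    case False
    then have "(\<Sum>i\<in>{a..t}. h i) = (\<Sum>i\<in>{a..b}. h i)"
      using that supp by (intro sum.mono_neutral_right) auto
    then show ?thesis using sum0 by (simp add: g_def)
  qed (simp add: g_def)
  have gB: "\<bar>g t\<bar> \<le> of_int (b - a + 1) * B" for t
  proof (cases "t \<in> {a..b}")
    case True
    have "\<bar>g t\<bar> \<le> (\<Sum>i\<in>{a..t}. B)"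
      unfolding g_def by (rule order.trans[OF sum_abs sum_mono]) (rule B)
    also have "\<dots> \<le> (\<Sum>i\<in>{a..b}. B)"
      using True order.trans[OF abs_ge_zero B] by (intro sum_mono2) auto
    finally show ?thesis using ab by simp
  next
    case False
    then show ?thesis using g0[OF False] order.trans[OF abs_ge_zero B] ab by simp
  qed
  have ge: "finite {t. g t \<noteq> 0}" by (rule finite_subset[of _ "{a..b}"]) (use g0 in blast, simp)
  have "binomial_moment m g = 0" if "m < p" for m
  proof -
    \<comment> \<open>The sign is reversed because summation by parts evaluates \<open>g\<close> at \<open>-t\<close>.\<close>
    define x :: "int \<Rightarrow> real" where "x t = (of_int (- t) gchoose Suc m)" for t
    have dx: "bdiff x t = - (of_int (- t) gchoose m)" for t
    proof -
      have "(of_int (- t) + 1 :: real) gchoose Suc m = (of_int (- t) gchoose m) + (of_int (- t) gchoose Suc m)"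
        by (rule gbinomial_Suc_Suc)
      then show ?thesis by (simp add: bdiff_def x_def add.commute)
    qed
    have "(\<Sum>t\<in>{-b..-a}. (bdiff ^^ 1) g (0 - t) *\<^sub>R x t) = (\<Sum>t\<in>{-b..-a}. g (0 - t) *\<^sub>R (bdiff ^^ 1) x t)"
    proof (rule sum_bdiff_funpow[OF ge])
      show "t \<in> {-b..-a}" if "(bdiff ^^ 1) g (0 - t) \<noteq> 0" for t
      proof -
        have "- t \<in> {a..b}" by (rule ccontr) (use that supp[of "- t"] dg in auto)
        then show ?thesis by auto
      qed
      show "t \<in> {-b..-a}" if "g (0 - t) \<noteq> 0" for t
      proof -
        have "- t \<in> {a..b}" by (rule ccontr) (use that g0[of "- t"] in auto)
        then show ?thesis by auto
      qed
    qed auto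
    then have "(\<Sum>t\<in>{-b..-a}. h (- t) * x t) = (\<Sum>t\<in>{-b..-a}. g (- t) * - (of_int (- t) gchoose m))"
      by (simp add: dg dx)
    moreover have "(\<Sum>t\<in>{-b..-a}. h (- t) * x t) = (\<Sum>t\<in>{a..b}. h t * (of_int t gchoose Suc m))"
      by (rule sum.reindex_bij_witness[of _ uminus uminus]) (auto simp: x_def)
    moreover have "(\<Sum>t\<in>{-b..-a}. g (- t) * - (of_int (- t) gchoose m)) = (\<Sum>t\<in>{a..b}. - (g t * (of_int t gchoose m)))"
      by (rule sum.reindex_bij_witness[of _ uminus uminus]) auto
    ultimately have "binomial_moment m g = - binomial_moment (Suc m) h"
      using bm[where m = "Suc m", OF supp] bm[where m = m, OF g0] by (simp add: sum_negf)
    then show ?thesis using van[of "Suc m"] that by simp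
  qed
  then show ?thesis using that dg g0 gB by blast
qed

lemma exists_bdiff_funpow_primitive:
  fixes h :: "int \<Rightarrow> real"
  assumes supp: "\<And>t. t \<notin> {a..b} \<Longrightarrow> h t = 0" and B: "\<And>t. \<bar>h t\<bar> \<le> B"
    and van: "\<And>m. m < p \<Longrightarrow> binomial_moment m h = 0" and ab: "a \<le> b"
  shows "\<exists>g. (bdiff ^^ p) g = h \<and> (\<forall>t. t \<notin> {a..b} \<longrightarrow> g t = 0) \<and> (\<forall>t. \<bar>g t\<bar> \<le> of_int (b - a + 1) ^ p * B)"
  using supp B van
proof (induction p arbitrary: h B)
  case 0
  then show ?case by auto
next
  case (Suc p)
  obtain g where g: "bdiff g = h" "\<And>t. t \<notin> {a..b} \<Longrightarrow> g t = 0" "\<And>t. \<bar>g t\<bar> \<le> of_int (b - a + 1) * B"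
    "\<And>m. m < p \<Longrightarrow> binomial_moment m g = 0"
    using exists_bdiff_primitive[of a b h B p] Suc.prems ab by metis
  obtain k where k: "(bdiff ^^ p) k = g" "\<forall>t. t \<notin> {a..b} \<longrightarrow> k t = 0"
    "\<forall>t. \<bar>k t\<bar> \<le> of_int (b - a + 1) ^ p * (of_int (b - a + 1) * B)"
    using Suc.IH[OF g(2,3,4)] by blast
  then show ?case using g(1) by (intro exI[of _ k]) (auto simp: mult_ac)
qed

section \<open>Functions with summable Fourier coefficients\<close>

text \<open>
  The half-open interval is used because its translates by multiples of \<open>2\<pi>\<close> partition the line.
\<close>

abbreviation period :: "real measure" where
  "period \<equiv> restrict_space lborel {-pi..<pi}"

lemma finite_measure_period: "finite_measure period"
  by (rule finite_measureI) (simp add: space_restrict_space emeasure_restrict_space)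

lemma integrable_period_mult_bounded:
  fixes f g :: "real \<Rightarrow> 'b::{real_normed_algebra,second_countable_topology,banach}"
  assumes f: "integrable period f" and g: "g \<in> borel_measurable period" "\<And>x. norm (g x) \<le> c"
  shows "integrable period (\<lambda>x. f x * g x)"
proof (rule Bochner_Integration.integrable_bound)
  show "integrable period (\<lambda>x. c * norm (f x))" using f by simp
  have "norm (f x * g x) \<le> norm (c * norm (f x))" for x
  proof -
    have "0 \<le> c" using g(2)[of x] norm_ge_zero order.trans by blast
    have "norm (f x * g x) \<le> norm (f x) * norm (g x)" by (rule norm_mult_ineq)
    also have "\<dots> \<le> norm (f x) * c" by (intro mult_left_mono g) auto
    finally show ?thesis using \<open>0 \<le> c\<close> by (simp add: mult.commute)
  qed
  then show "AE x in period. norm (f x * g x) \<le> norm (c * norm (f x))" by simp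
qed (use f g in auto)

lemma integrable_period_bounded:
  fixes g :: "real \<Rightarrow> 'b::{second_countable_topology,banach}"
  assumes g: "g \<in> borel_measurable period" "\<And>x. norm (g x) \<le> c"
  shows "integrable period g"
  by (rule Bochner_Integration.integrable_bound[of _ "\<lambda>_. c"])
     (use assms in \<open>auto intro!: finite_measure.integrable_const finite_measure_period order.trans[OF g(2)]\<close>)

lemma cis_measurable [measurable (raw)]:
  "f \<in> borel_measurable M \<Longrightarrow> (\<lambda>x. cis (f x)) \<in> borel_measurable M"
  by (rule measurable_compose[OF _ borel_measurable_continuous_onI]) (auto intro: continuous_intros)

lemma cis_measurable_period [simp]: "(\<lambda>\<theta>. cis (a * \<theta>)) \<in> borel_measurable period"
  by (rule measurable_restrict_space1) simp

lemma integral_cis_period: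
  "(LINT \<theta>|period. cis (of_int n * \<theta>)) = (if n = 0 then complex_of_real (2 * pi) else 0)"
proof (cases "n = 0")
  case True
  then show ?thesis by (simp add: measure_restrict_space scaleR_conv_of_real)
next
  case False
  have "(LINT \<theta>|period. cis (of_int n * \<theta>)) = (LINT \<theta>|lborel. indicator {-pi..<pi} \<theta> *\<^sub>R cis (of_int n * \<theta>))"
    by (simp add: integral_restrict_space)
  also have "\<dots> = (LINT \<theta>|lborel. indicator {-pi..pi} \<theta> *\<^sub>R cis (of_int n * \<theta>))"
    by (rule integral_cong_AE, measurable) (use AE_lborel_singleton[of pi] in \<open>auto elim!: eventually_mono split: split_indicator\<close>)
  also have "\<dots> = cis (of_int n * pi) / (\<i> * of_int n) - cis (of_int n * - pi) / (\<i> * of_int n)"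
  proof (rule integral_FTC_Icc)
    fix x :: real
    have "((\<lambda>z. exp (\<i> * of_int n * z) / (\<i> * of_int n)) has_field_derivative exp (\<i> * of_int n * complex_of_real x)) (at (complex_of_real x))"
      using False by (auto intro!: derivative_eq_intros)
    from has_vector_derivative_real_field[OF this, of "{-pi..pi}"]
    show "((\<lambda>x. cis (of_int n * x) / (\<i> * of_int n)) has_vector_derivative cis (of_int n * x)) (at x within {-pi..pi})"
      by (simp add: cis_conv_exp mult.assoc)
  qed (auto intro!: continuous_intros)
  also have "\<dots> = 0"
  proof -
    have "cis (of_int n * pi) = cis (of_int n * - pi)"
      using sin_zero_iff_int2[of "of_int n * pi"] by (simp add: complex_eq_iff)
    then show ?thesis by simp
  qed
  finally show ?thesis using False by simp
qed

definition trig_poly :: "(real \<Rightarrow> complex) \<Rightarrow> bool" where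
  "trig_poly q \<longleftrightarrow> (\<exists>K c. finite (K :: int set) \<and> (\<forall>\<theta>. q \<theta> = (\<Sum>k\<in>K. c k * cis (of_int k * \<theta>))))"

text \<open>
  Frequencies may be repeated in the family; this is what makes products of trigonometric polynomials
  immediate.
\<close>

lemma trig_polyI:
  fixes f :: "'i \<Rightarrow> int"
  assumes "finite I" "\<And>\<theta>. q \<theta> = (\<Sum>i\<in>I. c i * cis (of_int (f i) * \<theta>))"
  shows "trig_poly q"
  unfolding trig_poly_def
proof (intro exI conjI allI)
  show "finite (f ` I)" using assms by simp
  fix \<theta>
  have "q \<theta> = (\<Sum>k\<in>f ` I. \<Sum>i\<in>{i\<in>I. f i = k}. c i * cis (of_int (f i) * \<theta>))"
    unfolding assms(2) by (rule sum.image_gen[OF assms(1)])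
  also have "\<dots> = (\<Sum>k\<in>f ` I. (\<Sum>i\<in>{i\<in>I. f i = k}. c i) * cis (of_int k * \<theta>))"
    by (intro sum.cong refl) (simp add: sum_distrib_right)
  finally show "q \<theta> = (\<Sum>k\<in>f ` I. (\<Sum>i\<in>{i\<in>I. f i = k}. c i) * cis (of_int k * \<theta>))" .
qed

lemma trig_poly_const: "trig_poly (\<lambda>_. c)"
  by (rule trig_polyI[of "{0::int}" _ "\<lambda>_. c" id]) auto

lemma trig_poly_cis: "trig_poly (\<lambda>\<theta>. cis (of_int n * \<theta>))"
  by (rule trig_polyI[of "{n}" _ "\<lambda>_. 1" id]) auto

lemma trig_poly_add:
  assumes "trig_poly q" "trig_poly r"
  shows "trig_poly (\<lambda>\<theta>. q \<theta> + r \<theta>)"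
proof -
  obtain K c where q: "finite (K::int set)" "\<And>\<theta>. q \<theta> = (\<Sum>k\<in>K. c k * cis (of_int k * \<theta>))"
    using assms(1) unfolding trig_poly_def by auto
  obtain L d where r: "finite (L::int set)" "\<And>\<theta>. r \<theta> = (\<Sum>k\<in>L. d k * cis (of_int k * \<theta>))"
    using assms(2) unfolding trig_poly_def by auto
  show ?thesis
    by (rule trig_polyI[of "K <+> L" _ "case_sum c d" "case_sum id id"])
       (use q r in \<open>auto simp: sum.Plus\<close>)
qed

lemma trig_poly_mult:
  assumes "trig_poly q" "trig_poly r"
  shows "trig_poly (\<lambda>\<theta>. q \<theta> * r \<theta>)"
proof -
  obtain K c where q: "finite (K::int set)" "\<And>\<theta>. q \<theta> = (\<Sum>k\<in>K. c k * cis (of_int k * \<theta>))"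
    using assms(1) unfolding trig_poly_def by auto
  obtain L d where r: "finite (L::int set)" "\<And>\<theta>. r \<theta> = (\<Sum>k\<in>L. d k * cis (of_int k * \<theta>))"
    using assms(2) unfolding trig_poly_def by auto
  show ?thesis
    by (rule trig_polyI[of "K \<times> L" _ "\<lambda>(k, l). c k * d l" "\<lambda>(k, l). k + l"])
       (use q r in \<open>auto simp: sum_product sum.cartesian_product cis_mult[symmetric] algebra_simps intro!: sum.cong\<close>)
qed

text \<open>
  Polynomials in the two coordinates, restricted to the unit circle. This is the class provided by the
  Weierstrass approximation theorem.
\<close>

lemma trig_poly_polynomial_function:
  assumes "real_polynomial_function q"
  shows "trig_poly (\<lambda>\<theta>. complex_of_real (q (cis \<theta>)))"
  using assms
proof induction
  case (linear f)
  have "complex_of_real (f (cis \<theta>)) =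
     ((f 1 - \<i> * f \<i>) / 2) * cis (of_int 1 * \<theta>) + ((f 1 + \<i> * f \<i>) / 2) * cis (of_int (-1) * \<theta>)" for \<theta>
  proof -
    interpret bounded_linear f by fact
    have "f (cis \<theta>) = f (cos \<theta> *\<^sub>R 1 + sin \<theta> *\<^sub>R \<i>)"
      by (rule arg_cong[of _ _ f]) (simp add: complex_eq_iff)
    also have "\<dots> = cos \<theta> * f 1 + sin \<theta> * f \<i>" by (simp add: add scaleR)
    finally show ?thesis by (simp add: complex_eq_iff field_simps)
  qed
  then show ?case
    by (simp only:) (intro trig_poly_add trig_poly_mult trig_poly_const trig_poly_cis)
qed (auto intro: trig_poly_const trig_poly_add trig_poly_mult)

lemma continuous_trig_poly: "trig_poly q \<Longrightarrow> continuous_on UNIV q"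
proof -
  assume "trig_poly q"
  then obtain K c where q: "q = (\<lambda>\<theta>. \<Sum>k\<in>K. c k * cis (of_int k * \<theta>))"
    unfolding trig_poly_def by blast
  show ?thesis unfolding q by (intro continuous_intros)
qed

definition fourier_sum_le :: "(real \<Rightarrow> complex) \<Rightarrow> real \<Rightarrow> bool" where
  "fourier_sum_le f B \<longleftrightarrow> integrable period f \<and>
     (\<forall>F. finite F \<longrightarrow> (\<Sum>n\<in>F. cmod (LINT \<theta>|period. f \<theta> * cis (- of_int n * \<theta>))) \<le> B)"

text \<open>
  The coefficients of \<open>q\<close> are at most \<open>1/(2\<pi>)\<close> times its \<open>L\<^sup>1\<close> norm, and \<open>\<integral> f q\<close> is the sum of the products of
  the coefficients of \<open>f\<close> and \<open>q\<close>. Estimating against test functions avoids summing the Fourier series of \<open>f\<close>.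
\<close>

lemma trig_poly_duality:
  assumes fB: "fourier_sum_le f B"
    and q: "trig_poly q" "\<And>\<theta>. cmod (q \<theta>) \<le> b"
  shows "cmod (LINT \<theta>|period. f \<theta> * q \<theta>) \<le> B / (2 * pi) * (LINT \<theta>|period. cmod (q \<theta>))"
proof -
  have f: "integrable period f"
    and B: "\<And>F. finite F \<Longrightarrow> (\<Sum>n\<in>F. cmod (LINT \<theta>|period. f \<theta> * cis (- of_int n * \<theta>))) \<le> B"
    using fB by (auto simp: fourier_sum_le_def)
  obtain K c where K: "finite (K::int set)" and qeq: "\<And>\<theta>. q \<theta> = (\<Sum>k\<in>K. c k * cis (of_int k * \<theta>))"
    using q(1) unfolding trig_poly_def by auto
  have qm: "q \<in> borel_measurable period"
    using continuous_trig_poly[OF q(1)] by (simp add: borel_measurable_continuous_onI measurable_restrict_space1)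
  have ci: "integrable period (\<lambda>\<theta>. cis (of_int k * \<theta>))" for k
    by (rule integrable_period_bounded[of _ 1]) auto
  have fci: "integrable period (\<lambda>\<theta>. f \<theta> * cis (of_int k * \<theta>))" for k
    by (rule integrable_period_mult_bounded[OF f, of _ 1]) auto
  let ?Q = "LINT \<theta>|period. cmod (q \<theta>)"
  have ck: "cmod (c k) \<le> ?Q / (2 * pi)" if k: "k \<in> K" for k
  proof -
    have "(LINT \<theta>|period. q \<theta> * cis (- of_int k * \<theta>)) = (LINT \<theta>|period. (\<Sum>l\<in>K. c l * cis (of_int (l - k) * \<theta>)))"
      by (intro Bochner_Integration.integral_cong refl)
         (simp add: qeq sum_distrib_right mult.assoc cis_mult left_diff_distrib)
    also have "\<dots> = (\<Sum>l\<in>K. c l * (LINT \<theta>|period. cis (of_int (l - k) * \<theta>)))"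
      by (subst Bochner_Integration.integral_sum) (use ci in \<open>auto simp del: of_int_diff\<close>)
    also have "\<dots> = (\<Sum>l\<in>K. if l = k then c l * complex_of_real (2 * pi) else 0)"
      unfolding integral_cis_period by (intro sum.cong) auto
    also have "\<dots> = c k * complex_of_real (2 * pi)" using k K by (simp add: sum.delta)
    finally have "cmod (c k) * (2 * pi) = cmod (LINT \<theta>|period. q \<theta> * cis (- of_int k * \<theta>))"
      by (simp add: norm_mult)
    also have "\<dots> \<le> (LINT \<theta>|period. cmod (q \<theta> * cis (- of_int k * \<theta>)))"
      by (rule integral_norm_bound)
    finally show ?thesis by (simp add: norm_mult field_simps)
  qed
  have "(LINT \<theta>|period. f \<theta> * q \<theta>) = (LINT \<theta>|period. (\<Sum>k\<in>K. c k * (f \<theta> * cis (of_int k * \<theta>))))"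
    by (intro Bochner_Integration.integral_cong refl) (auto simp: qeq sum_distrib_left mult_ac)
  also have "\<dots> = (\<Sum>k\<in>K. c k * (LINT \<theta>|period. f \<theta> * cis (of_int k * \<theta>)))"
    by (subst Bochner_Integration.integral_sum) (use fci in auto)
  finally have "cmod (LINT \<theta>|period. f \<theta> * q \<theta>) \<le> (\<Sum>k\<in>K. cmod (c k) * cmod (LINT \<theta>|period. f \<theta> * cis (of_int k * \<theta>)))"
    by (simp add: sum_norm_le norm_mult)
  also have "\<dots> \<le> (\<Sum>k\<in>K. ?Q / (2 * pi) * cmod (LINT \<theta>|period. f \<theta> * cis (of_int k * \<theta>)))"
    by (intro sum_mono mult_right_mono ck) auto
  also have "\<dots> = ?Q / (2 * pi) * (\<Sum>n\<in>uminus ` K. cmod (LINT \<theta>|period. f \<theta> * cis (- of_int n * \<theta>)))"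
    by (simp add: sum_distrib_left sum.reindex)
  also have "\<dots> \<le> ?Q / (2 * pi) * B"
    by (intro mult_left_mono B) (use K in auto)
  finally show ?thesis by (simp add: mult_ac)
qed

text \<open>
  Uniform approximation by trigonometric polynomials.
\<close>

lemma continuous_circle_duality:
  fixes F :: "complex \<Rightarrow> real"
  assumes fB: "fourier_sum_le f B"
    and F: "continuous_on (sphere 0 1) F"
  shows "cmod (LINT \<theta>|period. f \<theta> * complex_of_real (F (cis \<theta>))) \<le> B / (2 * pi) * (LINT \<theta>|period. \<bar>F (cis \<theta>)\<bar>)"
proof (rule field_le_epsilon)
  fix e :: real assume "e > 0"
  have f: "integrable period f" using fB by (simp add: fourier_sum_le_def)
  have B0: "B \<ge> 0" using fB unfolding fourier_sum_le_def by (metis finite.emptyI sum.empty)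
  define h where "h \<theta> = complex_of_real (F (cis \<theta>))" for \<theta>
  define N where "N = (LINT \<theta>|period. cmod (f \<theta>))"
  have N0: "N \<ge> 0" by (simp add: N_def)
  \<comment> \<open>Replacing \<open>F\<close> by \<open>q\<close> costs at most \<open>\<eta>N\<close> on the left and \<open>\<eta>B\<close> on the right.\<close>
  define \<eta> where "\<eta> = e / (B + N + 1)"
  have \<eta>: "\<eta> > 0" "\<eta> * (B + N) \<le> e" using \<open>e > 0\<close> B0 N0 by (auto simp: \<eta>_def field_simps)
  have "compact (sphere (0::complex) 1)" by simp
  then obtain g where g: "real_polynomial_function g" "\<And>x. x \<in> sphere 0 1 \<Longrightarrow> \<bar>F x - g x\<bar> < \<eta>"
    using Stone_Weierstrass_real_polynomial_function[OF _ F \<eta>(1)] by blast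
  obtain b where b: "\<forall>x\<in>sphere 0 1. norm (F x) \<le> b"
    using compact_imp_bounded[OF compact_continuous_image[OF F]] unfolding bounded_iff by auto
  define q where "q \<theta> = complex_of_real (g (cis \<theta>))" for \<theta>
  have q: "trig_poly q" unfolding q_def by (rule trig_poly_polynomial_function[OF g(1)])
  have hm: "h \<in> borel_measurable period"
  proof -
    have "continuous_on UNIV (\<lambda>\<theta>. F (cis \<theta>))"
      by (rule continuous_on_compose2[OF F]) (auto intro: continuous_intros)
    then have "(\<lambda>\<theta>. F (cis \<theta>)) \<in> borel_measurable period"
      by (simp add: borel_measurable_continuous_onI measurable_restrict_space1)
    then show ?thesis unfolding h_def by measurable
  qed
  have hb: "cmod (h \<theta>) \<le> b" for \<theta> using b[rule_format, of "cis \<theta>"] by (simp add: h_def)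
  have hq: "cmod (h \<theta> - q \<theta>) \<le> \<eta>" for \<theta>
    using g(2)[of "cis \<theta>"] by (simp add: h_def q_def flip: of_real_diff)
  have qb: "cmod (q \<theta>) \<le> cmod (h \<theta>) + \<eta>" for \<theta>
    using hq[of \<theta>] norm_triangle_ineq2[of "q \<theta>" "h \<theta>"] by (simp add: norm_minus_commute)
  then have qb': "cmod (q \<theta>) \<le> b + \<eta>" for \<theta> using hb[of \<theta>] qb[of \<theta>] by linarith
  have qm: "q \<in> borel_measurable period"
    using continuous_trig_poly[OF q(1)] by (simp add: borel_measurable_continuous_onI measurable_restrict_space1)
  have hi: "integrable period h" and qi: "integrable period q"
    using integrable_period_bounded[OF hm hb] integrable_period_bounded[OF qm qb'] by auto
  have fh: "integrable period (\<lambda>\<theta>. f \<theta> * h \<theta>)" and fq: "integrable period (\<lambda>\<theta>. f \<theta> * q \<theta>)"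
    using integrable_period_mult_bounded[OF f hm hb] integrable_period_mult_bounded[OF f qm qb'] by auto
  have "(LINT \<theta>|period. f \<theta> * h \<theta>) = (LINT \<theta>|period. f \<theta> * q \<theta>) + (LINT \<theta>|period. f \<theta> * h \<theta> - f \<theta> * q \<theta>)"
    using fh fq by simp
  then have "cmod (LINT \<theta>|period. f \<theta> * h \<theta>) \<le> cmod (LINT \<theta>|period. f \<theta> * q \<theta>) + cmod (LINT \<theta>|period. f \<theta> * h \<theta> - f \<theta> * q \<theta>)"
    using norm_triangle_ineq by metis
  also have "cmod (LINT \<theta>|period. f \<theta> * h \<theta> - f \<theta> * q \<theta>) \<le> (LINT \<theta>|period. \<eta> * cmod (f \<theta>))"
  proof (rule Bochner_Integration.integral_norm_bound_integral)
    show "cmod (f \<theta> * h \<theta> - f \<theta> * q \<theta>) \<le> \<eta> * cmod (f \<theta>)" for \<theta>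
      using mult_left_mono[OF hq, of "cmod (f \<theta>)" \<theta>]
      by (simp add: mult.commute norm_mult flip: right_diff_distrib)
  qed (use f fh fq in auto)
  also have "(LINT \<theta>|period. \<eta> * cmod (f \<theta>)) = \<eta> * N" by (simp add: N_def)
  also have "cmod (LINT \<theta>|period. f \<theta> * q \<theta>) \<le> B / (2 * pi) * (LINT \<theta>|period. cmod (q \<theta>))"
    by (rule trig_poly_duality[OF fB q qb'])
  also have "(LINT \<theta>|period. cmod (q \<theta>)) \<le> (LINT \<theta>|period. cmod (h \<theta>) + \<eta>)"
    by (intro integral_mono Bochner_Integration.integrable_add integrable_norm hi qi qb
        finite_measure.integrable_const[OF finite_measure_period])
  also have "(LINT \<theta>|period. cmod (h \<theta>) + \<eta>) = (LINT \<theta>|period. cmod (h \<theta>)) + 2 * pi * \<eta>"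
    by (subst Bochner_Integration.integral_add)
       (use hi in \<open>auto simp: measure_restrict_space intro!: finite_measure.integrable_const finite_measure_period\<close>)
  finally have "cmod (LINT \<theta>|period. f \<theta> * h \<theta>) \<le> B / (2 * pi) * ((LINT \<theta>|period. cmod (h \<theta>)) + 2 * pi * \<eta>) + \<eta> * N"
    using B0 by (simp add: mult_left_mono divide_right_mono)
  also have "\<dots> = B / (2 * pi) * (LINT \<theta>|period. cmod (h \<theta>)) + \<eta> * (B + N)"
    by (simp add: field_simps)
  also have "\<dots> \<le> B / (2 * pi) * (LINT \<theta>|period. cmod (h \<theta>)) + e" using \<eta> by simp
  finally show "cmod (LINT \<theta>|period. f \<theta> * complex_of_real (F (cis \<theta>))) \<le> B / (2 * pi) * (LINT \<theta>|period. \<bar>F (cis \<theta>)\<bar>) + e"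
    by (simp add: h_def)
qed

text \<open>
  The jump of the argument at \<open>-1\<close> does no harm if \<open>q\<close> vanishes at both ends of \<open>[-\<pi>, \<pi>]\<close> at a linear rate.
\<close>

lemma continuous_on_circle_Arg:
  fixes q :: "real \<Rightarrow> real"
  assumes q: "continuous_on UNIV q" and qb: "\<And>x. \<bar>x\<bar> \<le> pi \<Longrightarrow> \<bar>q x\<bar> \<le> c * (pi - \<bar>x\<bar>)"
  shows "continuous_on (sphere 0 1) (\<lambda>z. q (Arg z))"
proof (rule continuous_on_eq_continuous_within[THEN iffD2, rule_format])
  fix z :: complex assume z: "z \<in> sphere 0 1"
  show "continuous (at z within sphere 0 1) (\<lambda>z. q (Arg z))"
  proof (cases "z \<in> \<real>\<^sub>\<le>\<^sub>0")
    case False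
    then have "isCont (\<lambda>z. q (Arg z)) z"
      using q by (intro isCont_o2[OF continuous_at_Arg]) (auto simp: continuous_on_eq_continuous_at)
    then show ?thesis by (rule continuous_at_imp_continuous_within)
  next
    case True
    then have z1: "z = -1" using z by (auto elim!: nonpos_Reals_cases)
    have Arg: "\<bar>Arg w\<bar> = arccos (Re w)" if "w \<in> sphere 0 1" for w
    proof -
      have "cos (Arg w) = Re w" using that by (subst cos_Arg) auto
      then have "cos \<bar>Arg w\<bar> = Re w" by (simp add: abs_if)
      moreover have "\<bar>Arg w\<bar> \<le> pi" using Arg_bounded[of w] by auto
      ultimately show ?thesis using arccos_cos[of "\<bar>Arg w\<bar>"] by auto
    qed
    have bound: "\<bar>q (Arg w)\<bar> \<le> c * (pi - arccos (Re w))" if "w \<in> sphere 0 1" for w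
      using qb[of "Arg w"] Arg_bounded[of w] Arg[OF that] by auto
    have "continuous_on (sphere 0 1) (\<lambda>w::complex. c * (pi - arccos (Re w)))"
    proof (intro continuous_intros ballI)
      fix w :: complex assume "w \<in> sphere 0 1"
      then show "-1 \<le> Re w \<and> Re w \<le> 1" using abs_Re_le_cmod[of w] by auto
    qed
    then have "((\<lambda>w. c * (pi - arccos (Re w))) \<longlongrightarrow> c * (pi - arccos (Re z))) (at z within sphere 0 1)"
      using z by (simp add: continuous_on_def)
    then have lim: "((\<lambda>w. c * (pi - arccos (Re w))) \<longlongrightarrow> 0) (at z within sphere 0 1)"
      by (simp add: z1)
    have "((\<lambda>w. q (Arg w)) \<longlongrightarrow> 0) (at z within sphere 0 1)"
      by (rule Lim_null_comparison[OF _ lim]) (auto simp: eventually_at_filter intro!: always_eventually bound)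
    moreover have "q (Arg z) = 0" using bound[OF z] by (simp add: z1)
    ultimately show ?thesis by (simp add: continuous_within)
  qed
qed

text \<open>
  The indicator of an open set is the limit of the continuous functions \<open>min(1, n dist(x, - U))\<close>, where \<open>- U\<close> is
  the complement; they vanish at the ends of the period.
\<close>

lemma open_set_duality:
  assumes fB: "fourier_sum_le f B"
    and U: "open U" "U \<subseteq> {-pi<..<pi}"
  shows "cmod (LINT \<theta>|period. f \<theta> * indicator U \<theta>) \<le> B / (2 * pi) * (LINT \<theta>|period. indicator U \<theta>)"
proof -
  have f: "integrable period f" using fB by (simp add: fourier_sum_le_def)
  define q where "q n x = min 1 (real n * infdist x (- U))" for n x
  have ne: "- U \<noteq> {}" using U(2) by (metis Compl_UNIV_eq UNIV_I compl_le_compl_iff double_complement greaterThanLessThan_iff less_irrefl subsetD)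
  have pm: "pi \<in> - U" "-pi \<in> - U" using U(2) by auto
  have qc: "continuous_on UNIV (q n)" for n unfolding q_def by (intro continuous_intros)
  have q0: "0 \<le> q n x" "q n x \<le> 1" for n x by (auto simp: q_def infdist_nonneg)
  have qb: "\<bar>q n x\<bar> \<le> real n * (pi - \<bar>x\<bar>)" if "\<bar>x\<bar> \<le> pi" for n x
  proof -
    have "infdist x (- U) \<le> pi - \<bar>x\<bar>"
      using infdist_le[OF pm(1), of x] infdist_le[OF pm(2), of x] that by (auto simp: dist_real_def abs_if split: if_splits)
    then have "real n * infdist x (- U) \<le> real n * (pi - \<bar>x\<bar>)" by (intro mult_left_mono) auto
    then show ?thesis using q0(1)[of n x] by (simp add: q_def)
  qed
  have qm: "q n \<in> borel_measurable period" for n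
    using qc by (simp add: borel_measurable_continuous_onI measurable_restrict_space1)
  have lim: "(\<lambda>n. q n x) \<longlonglongrightarrow> indicator U x" for x
  proof (cases "x \<in> U")
    case False
    then show ?thesis by (simp add: q_def)
  next
    case True
    have "closed (- U)" using U(1) by (simp add: closed_Compl)
    then have pos: "infdist x (- U) > 0" using infdist_pos_not_in_closed[OF _ ne, of x] True by simp
    obtain n0 where n0: "1 / infdist x (- U) < real n0" using reals_Archimedean2 by blast
    have "q n x = 1" if "n \<ge> n0" for n
    proof -
      have "1 < real n0 * infdist x (- U)" using n0 pos by (simp add: field_simps)
      also have "\<dots> \<le> real n * infdist x (- U)" using that pos by (intro mult_right_mono) auto
      finally show ?thesis by (simp add: q_def)
    qed
    then show ?thesis using True by (auto intro!: tendsto_eventually eventually_sequentiallyI[of n0])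
  qed
  have step: "cmod (LINT \<theta>|period. f \<theta> * complex_of_real (q n \<theta>)) \<le> B / (2 * pi) * (LINT \<theta>|period. q n \<theta>)" for n
  proof -
    \<comment> \<open>At the left end point \<open>-\<pi>\<close> the argument is \<open>\<pi>\<close>, and \<open>q\<close> vanishes at both.\<close>
    have Ac: "q n (Arg (cis \<theta>)) = q n \<theta>" if "\<theta> \<in> space period" for \<theta>
    proof (cases "\<theta> = - pi")
      case True
      have "cis (- pi) = cis pi" by (simp add: complex_eq_iff)
      then have "Arg (cis (- pi)) = pi" using Arg_cis[of pi] by simp
      then show ?thesis using True qb[of pi n] qb[of "-pi" n] by simp
    next
      case False
      then show ?thesis using that by (subst Arg_cis) (auto simp: space_restrict_space)
    qed
    have eq1: "(LINT \<theta>|period. f \<theta> * complex_of_real (q n (Arg (cis \<theta>)))) = (LINT \<theta>|period. f \<theta> * complex_of_real (q n \<theta>))"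
      by (intro Bochner_Integration.integral_cong refl) (simp only: Ac)
    have eq2: "(LINT \<theta>|period. \<bar>q n (Arg (cis \<theta>))\<bar>) = (LINT \<theta>|period. q n \<theta>)"
      using q0 by (intro Bochner_Integration.integral_cong refl) (simp only: Ac abs_of_nonneg)
    have "cmod (LINT \<theta>|period. f \<theta> * complex_of_real (q n (Arg (cis \<theta>))))
        \<le> B / (2 * pi) * (LINT \<theta>|period. \<bar>q n (Arg (cis \<theta>))\<bar>)"
      by (rule continuous_circle_duality[OF fB continuous_on_circle_Arg[OF qc qb]])
    then show ?thesis unfolding eq1 eq2 .
  qed
  have Um[measurable]: "U \<in> sets borel" using U(1) by simp
  have "(\<lambda>n. LINT \<theta>|period. f \<theta> * complex_of_real (q n \<theta>)) \<longlonglongrightarrow> (LINT \<theta>|period. f \<theta> * indicator U \<theta>)"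
  proof (rule integral_dominated_convergence[where w = "\<lambda>\<theta>. cmod (f \<theta>)"])
    show "AE x in period. (\<lambda>n. f x * complex_of_real (q n x)) \<longlonglongrightarrow> f x * indicator U x"
    proof (intro always_eventually allI tendsto_mult_left)
      fix x
      have "(indicator U x :: complex) = of_real (indicator U x)" by (simp split: split_indicator)
      then show "(\<lambda>n. complex_of_real (q n x)) \<longlonglongrightarrow> indicator U x"
        using tendsto_of_real[OF lim[of x]] by simp
    qed
    show "AE x in period. cmod (f x * complex_of_real (q n x)) \<le> cmod (f x)" for n
      using q0 by (auto simp: norm_mult intro!: mult_left_le)
  qed (use f qm in \<open>auto intro!: borel_measurable_times borel_measurable_of_real simp: measurable_restrict_space1\<close>)
  moreover have "(\<lambda>n. LINT \<theta>|period. q n \<theta>) \<longlonglongrightarrow> (LINT \<theta>|period. indicator U \<theta>)"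
  proof (rule integral_dominated_convergence[where w = "\<lambda>\<theta>. 1"])
    show "integrable period (\<lambda>\<theta>. 1::real)" by (rule finite_measure.integrable_const[OF finite_measure_period])
  qed (use q0 lim qm in \<open>auto simp: measurable_restrict_space1\<close>)
  ultimately show ?thesis
    by (intro LIMSEQ_le[OF tendsto_norm tendsto_mult_left]) (use step in auto)
qed

text \<open>
  By outer regularity of the measure with density \<open>\<bar>k\<bar>\<close>, the set \<open>{k > 0}\<close> is approximated by open sets.
\<close>

lemma AE_nonpos_of_open_sets:
  fixes k :: "real \<Rightarrow> real"
  assumes k: "integrable lborel k"
    and U: "\<And>U. open U \<Longrightarrow> (LINT x|lborel. k x * indicator U x) \<le> 0"
  shows "AE x in lborel. k x \<le> 0"
proof -
  have km[measurable]: "k \<in> borel_measurable borel" using k by auto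
  define E where "E = {x. k x > 0}"
  have Em[measurable]: "E \<in> sets borel" unfolding E_def by measurable
  define \<mu> where "\<mu> = density lborel (\<lambda>x. ennreal \<bar>k x\<bar>)"
  have ki: "integrable lborel (\<lambda>x. \<bar>k x\<bar> * indicator A x)" "integrable lborel (\<lambda>x. k x * indicator A x)" if "A \<in> sets borel" for A
    using that k by (auto intro!: integrable_real_mult_indicator)
  have \<mu>: "emeasure \<mu> A = ennreal (LINT x|lborel. \<bar>k x\<bar> * indicator A x)" if A[measurable]: "A \<in> sets borel" for A
  proof -
    have "emeasure \<mu> A = (\<integral>\<^sup>+x. ennreal (\<bar>k x\<bar> * indicator A x) \<partial>lborel)"
      unfolding \<mu>_def by (subst emeasure_density) (auto intro!: nn_integral_cong split: split_indicator)
    also have "\<dots> = ennreal (LINT x|lborel. \<bar>k x\<bar> * indicator A x)"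
      by (rule nn_integral_eq_integral[OF ki(1)[OF A]]) auto
    finally show ?thesis .
  qed
  have "(LINT x|lborel. k x * indicator E x) \<le> 0"
  proof (rule field_le_epsilon)
    fix e :: real assume e: "e > 0"
    have "emeasure \<mu> E < emeasure \<mu> E + ennreal e"
      unfolding \<mu>[OF Em] using e
      by (subst ennreal_plus[symmetric]) (auto intro!: ennreal_lessI add_nonneg_pos)
    moreover have "emeasure \<mu> E = (INF U \<in> {U. E \<subseteq> U \<and> open U}. emeasure \<mu> U)"
      by (rule outer_regular) (auto simp: \<mu>[of UNIV] \<mu>_def[THEN arg_cong[of _ _ sets]] \<mu>_def[THEN arg_cong[of _ _ space]])
    ultimately have "\<exists>V\<in>{U. E \<subseteq> U \<and> open U}. emeasure \<mu> V < emeasure \<mu> E + ennreal e"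
      by (simp add: INF_less_iff)
    then obtain V where V: "E \<subseteq> V" "open V" "emeasure \<mu> V < emeasure \<mu> E + ennreal e" by blast
    have Vm[measurable]: "V \<in> sets borel" using V by simp
    have "(LINT x|lborel. \<bar>k x\<bar> * indicator V x) < (LINT x|lborel. \<bar>k x\<bar> * indicator E x) + e"
      using V(3) e by (simp add: \<mu> ennreal_less_iff flip: ennreal_plus)
    moreover have "(LINT x|lborel. k x * indicator E x) - (LINT x|lborel. k x * indicator V x)
        \<le> (LINT x|lborel. \<bar>k x\<bar> * indicator V x) - (LINT x|lborel. \<bar>k x\<bar> * indicator E x)"
    proof -
      have "(LINT x|lborel. k x * indicator E x - k x * indicator V x) \<le>
         (LINT x|lborel. \<bar>k x\<bar> * indicator V x - \<bar>k x\<bar> * indicator E x)"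
        using V(1) by (intro integral_mono Bochner_Integration.integrable_diff ki Em Vm) (auto split: split_indicator)
      then show ?thesis
        by (simp add: Bochner_Integration.integral_diff ki)
    qed
    ultimately show "(LINT x|lborel. k x * indicator E x) \<le> 0 + e"
      using U[OF V(2)] by linarith
  qed
  moreover have "0 \<le> (LINT x|lborel. k x * indicator E x)"
    by (intro Bochner_Integration.integral_nonneg) (auto simp: E_def split: split_indicator)
  ultimately have "(LINT x|lborel. k x * indicator E x) = 0" by simp
  then have "AE x in lborel. k x * indicator E x = 0"
    by (subst (asm) integral_nonneg_eq_0_iff_AE) (auto simp: ki E_def split: split_indicator)
  then show ?thesis
    by eventually_elim (auto simp: E_def split: split_indicator_asm)
qed

lemma AE_le_period:
  fixes r :: "real \<Rightarrow> real"
  assumes r: "integrable period r"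
    and U: "\<And>U. open U \<Longrightarrow> U \<subseteq> {-pi<..<pi} \<Longrightarrow> (LINT x|period. r x * indicator U x) \<le> b * (LINT x|period. indicator U x)"
  shows "AE x in period. r x \<le> b"
proof -
  let ?W = "{-pi<..<pi}"
  define k where "k x = indicator ?W x * (r x - b)" for x
  have rb: "integrable period (\<lambda>x. r x - b)"
    using r by (auto intro!: finite_measure.integrable_const finite_measure_period)
  have ind: "integrable period (\<lambda>x. indicator A x :: real)" if "A \<in> sets borel" for A
    by (rule integrable_period_bounded[of _ 1]) (use that in \<open>auto intro!: measurable_restrict_space1 split: split_indicator\<close>)
  have rind: "integrable period (\<lambda>x. r x * indicator A x :: real)" if "A \<in> sets borel" for A
    by (rule integrable_period_mult_bounded[OF r, of _ 1]) (use that in \<open>auto intro!: measurable_restrict_space1 split: split_indicator\<close>)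
  have "integrable lborel (\<lambda>x. indicator {-pi..<pi} x *\<^sub>R (r x - b))"
    using rb by (simp add: integrable_restrict_space)
  then have "integrable lborel (\<lambda>x. (indicator {-pi..<pi} x *\<^sub>R (r x - b)) * indicator ?W x)"
    by (intro integrable_real_mult_indicator) auto
  also have "(\<lambda>x. (indicator {-pi..<pi} x *\<^sub>R (r x - b)) * indicator ?W x) = k"
    by (auto simp: k_def fun_eq_iff split: split_indicator)
  finally have ki: "integrable lborel k" .
  have "AE x in lborel. k x \<le> 0"
  proof (rule AE_nonpos_of_open_sets[OF ki])
    fix U :: "real set" assume "open U"
    then have oUW: "open (U \<inter> ?W)" by auto
    then have m: "U \<inter> ?W \<in> sets borel" by simp
    have "(LINT x|lborel. k x * indicator U x) = (LINT x|lborel. indicator {-pi..<pi} x *\<^sub>R (r x * indicator (U \<inter> ?W) x - b * indicator (U \<inter> ?W) x))"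
      by (intro Bochner_Integration.integral_cong) (auto simp: k_def split: split_indicator)
    also have "\<dots> = (LINT x|period. r x * indicator (U \<inter> ?W) x - b * indicator (U \<inter> ?W) x)"
      by (simp add: integral_restrict_space)
    also have "\<dots> = (LINT x|period. r x * indicator (U \<inter> ?W) x) - b * (LINT x|period. indicator (U \<inter> ?W) x)"
      using rind[OF m] ind[OF m] by simp
    also have "\<dots> \<le> 0" using U[OF oUW] by simp
    finally show "(LINT x|lborel. k x * indicator U x) \<le> 0" .
  qed
  then have "AE x in lborel. x \<in> {-pi..<pi} \<longrightarrow> r x \<le> b"
    using AE_lborel_singleton[of "-pi"] by eventually_elim (auto simp: k_def)
  then show ?thesis by (subst AE_restrict_space_iff) auto
qed

text \<open>
  The duality bounds the mean of \<open>f\<close> over every open set, hence \<open>f\<close> almost everywhere. It is applied to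
  \<open>\<plusminus>Re f\<close> and \<open>\<plusminus>Im f\<close> separately, which doubles the constant \<open>B/(2\<pi>)\<close>.
\<close>

lemma fourier_sup_bound:
  assumes fB: "fourier_sum_le f B"
  shows "AE \<theta> in period. cmod (f \<theta>) \<le> B / pi"
proof -
  have f: "integrable period f" using fB by (simp add: fourier_sum_le_def)
  have part: "AE \<theta> in period. T (f \<theta>) \<le> B / (2 * pi)"
    if T: "bounded_linear T" "\<And>z. T z \<le> cmod z" for T :: "complex \<Rightarrow> real"
  proof (rule AE_le_period)
    interpret bounded_linear T by (rule T)
    show "integrable period (\<lambda>\<theta>. T (f \<theta>))" by (rule integrable_bounded_linear[OF T(1) f])
    fix U :: "real set" assume U: "open U" "U \<subseteq> {-pi<..<pi}"
    have Ti: "integrable period (\<lambda>\<theta>. f \<theta> * indicator U \<theta>)"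
      by (rule integrable_period_mult_bounded[OF f, of _ 1])
         (use U in \<open>auto intro!: measurable_restrict_space1 split: split_indicator\<close>)
    have "(LINT \<theta>|period. T (f \<theta>) * indicator U \<theta>) = (LINT \<theta>|period. T (f \<theta> * indicator U \<theta>))"
      by (intro Bochner_Integration.integral_cong refl) (simp add: zero split: split_indicator)
    also have "\<dots> = T (LINT \<theta>|period. f \<theta> * indicator U \<theta>)"
      by (rule integral_bounded_linear[OF T(1) Ti])
    also have "\<dots> \<le> B / (2 * pi) * (LINT \<theta>|period. indicator U \<theta>)"
      using T(2) open_set_duality[OF fB U] order.trans by blast
    finally show "(LINT \<theta>|period. T (f \<theta>) * indicator U \<theta>) \<le> B / (2 * pi) * (LINT \<theta>|period. indicator U \<theta>)" .
  qed
  have 1: "AE \<theta> in period. Re (f \<theta>) \<le> B / (2 * pi)"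
    by (rule part) (auto intro: bounded_linear_Re complex_Re_le_cmod)
  have 2: "AE \<theta> in period. - Re (f \<theta>) \<le> B / (2 * pi)"
    using abs_Re_le_cmod by (intro part) (auto intro: bounded_linear_minus bounded_linear_Re simp: abs_le_iff)
  have 3: "AE \<theta> in period. Im (f \<theta>) \<le> B / (2 * pi)"
    using abs_Im_le_cmod by (intro part) (auto intro: bounded_linear_Im simp: abs_le_iff)
  have 4: "AE \<theta> in period. - Im (f \<theta>) \<le> B / (2 * pi)"
    using abs_Im_le_cmod by (intro part) (auto intro: bounded_linear_minus bounded_linear_Im simp: abs_le_iff)
  show ?thesis
    using 1 2 3 4
  proof eventually_elim
    case (elim \<theta>)
    have "cmod (f \<theta>) \<le> \<bar>Re (f \<theta>)\<bar> + \<bar>Im (f \<theta>)\<bar>" by (rule cmod_le)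
    also have "\<dots> \<le> B / (2 * pi) + B / (2 * pi)" using elim by (intro add_mono) (auto simp: abs_le_iff)
    finally show ?case by simp
  qed
qed

section \<open>Periodization\<close>

lemma cis_int_2pi: "cis (2 * pi * of_int n) = 1"
  by (rule cis_multiple_2pi) auto

text \<open>
  For \<open>s\<close> within distance \<open>1/2\<close> of \<open>m\<close> the sum over \<open>{-K..K}\<close> contains all nonzero terms \<open>g(s - t)\<close>. Shifting
  every term back, the windows tile the line and the integral unfolds to the Fourier transform of \<open>g\<close>.
\<close>

lemma periodization_fourier:
  fixes g :: "real \<Rightarrow> complex" and m K :: int
  assumes g: "integrable lborel g" and supp: "\<And>s. \<bar>s\<bar> > R \<Longrightarrow> g s = 0" and K: "real_of_int K \<ge> \<bar>of_int m\<bar> + R + 1" 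
  defines "f \<equiv> \<lambda>\<theta>. \<Sum>t\<in>{-K..K}. g (\<theta> / (2 * pi) + of_int m - of_int t)"
  shows "integrable period f"
    and "(LINT \<theta>|period. f \<theta> * cis (- of_int n * \<theta>)) = 2 * pi * (LINT s|lborel. g s * cis (- 2 * pi * of_int n * s))"
proof -
  have gm[measurable]: "g \<in> borel_measurable borel" using g by auto
  let ?I = "\<lambda>x. indicator {-pi..<pi} x :: real"
  have gt: "integrable lborel (\<lambda>\<theta>. g (\<theta> / (2 * pi) + of_int m - of_int t))" for t
    using lborel_integrable_real_affine[OF g, of "1 / (2 * pi)" "of_int m - of_int t"] by (simp add: algebra_simps)
  have fl: "integrable lborel f" unfolding f_def by (intro Bochner_Integration.integrable_sum gt)
  then show "integrable period f"
    by (subst integrable_restrict_space) (auto intro: integrable_mult_indicator)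
  have gi: "integrable lborel (\<lambda>\<theta>. ?I \<theta> *\<^sub>R (g (\<theta> / (2 * pi) + of_int m - of_int t) * cis (- of_int n * \<theta>)))" for t
  proof (rule Bochner_Integration.integrable_bound[OF gt[of t]])
    show "AE \<theta> in lborel. norm (?I \<theta> *\<^sub>R (g (\<theta> / (2 * pi) + of_int m - of_int t) * cis (- of_int n * \<theta>)))
       \<le> norm (g (\<theta> / (2 * pi) + of_int m - of_int t))"
      by (auto simp: norm_mult split: split_indicator)
  qed measurable
  have gs: "(LINT \<theta>|lborel. ?I \<theta> *\<^sub>R (g (\<theta> / (2 * pi) + of_int m - of_int t) * cis (- of_int n * \<theta>)))
     = (LINT x|lborel. (2 * pi * ?I (2 * pi * (x - of_int m + of_int t))) *\<^sub>R (g x * cis (- 2 * pi * of_int n * x)))" for t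
  proof -
    have c: "cis (- of_int n * (2 * pi * (x - of_int m + of_int t))) = cis (- 2 * pi * of_int n * x)" for x
    proof -
      have "cis (- of_int n * (2 * pi * (x - of_int m + of_int t))) = cis (- 2 * pi * of_int n * x) * cis (2 * pi * of_int (n * (m - t)))"
        by (simp add: cis_mult algebra_simps)
      then show ?thesis by (simp only: cis_int_2pi mult_1_right)
    qed
    have "(LINT \<theta>|lborel. ?I \<theta> *\<^sub>R (g (\<theta> / (2 * pi) + of_int m - of_int t) * cis (- of_int n * \<theta>)))
      = \<bar>2 * pi\<bar> *\<^sub>R (LINT x|lborel. ?I (2 * pi * (x - of_int m + of_int t)) *\<^sub>R (g x * cis (- of_int n * (2 * pi * (x - of_int m + of_int t)))))"
      by (subst lborel_integral_real_affine[of "2 * pi" _ "2 * pi * (of_int t - of_int m)"])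
         (auto simp: field_simps intro!: Bochner_Integration.integral_cong)
    also have "\<dots> = (LINT x|lborel. (2 * pi * ?I (2 * pi * (x - of_int m + of_int t))) *\<^sub>R (g x * cis (- 2 * pi * of_int n * x)))"
      unfolding c Bochner_Integration.integral_scaleR_right[symmetric] by simp
    finally show ?thesis .
  qed
  have gsi: "integrable lborel (\<lambda>x. (2 * pi * ?I (2 * pi * (x - of_int m + of_int t))) *\<^sub>R (g x * cis (- 2 * pi * of_int n * x)))" for t
  proof (rule Bochner_Integration.integrable_bound)
    show "integrable lborel (\<lambda>x. (2 * pi) *\<^sub>R g x)" using g by simp
    show "AE x in lborel. norm ((2 * pi * ?I (2 * pi * (x - of_int m + of_int t))) *\<^sub>R (g x * cis (- 2 * pi * of_int n * x))) \<le> norm ((2 * pi) *\<^sub>R g x)"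
      by (auto simp: norm_mult split: split_indicator)
  qed measurable
  have one: "(\<Sum>t\<in>{-K..K}. ?I (2 * pi * (x - of_int m + of_int t))) = 1" if "\<bar>x\<bar> \<le> R" for x
  proof -
    define j where "j = \<lfloor>x + 1/2\<rfloor>"
    have j: "of_int j \<le> x + 1/2" "x + 1/2 < of_int j + 1" unfolding j_def by linarith+
    have "\<bar>real_of_int (m - j)\<bar> \<le> of_int K" using K j that by (simp add: abs_le_iff) linarith
    then have mem: "m - j \<in> {-K..K}" by (auto simp flip: of_int_abs)
    have "?I (2 * pi * (x - of_int m + of_int t)) = (if t = m - j then 1 else 0)" for t
    proof -
      have "2 * pi * (x - of_int m + of_int t) \<in> {-pi..<pi} \<longleftrightarrow> x - of_int m + of_int t \<in> {-1/2..<1/2}"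
      proof -
        have "- pi \<le> 2 * pi * y \<longleftrightarrow> -1/2 \<le> y" "2 * pi * y < pi \<longleftrightarrow> y < 1/2" for y
          using mult_le_cancel_left_pos[of "2 * pi" "-1/2" y] mult_less_cancel_left_pos[of "2 * pi" y "1/2"] by simp_all
        then show ?thesis by auto
      qed
      also have "\<dots> \<longleftrightarrow> \<lfloor>x + 1/2\<rfloor> = m - t" unfolding floor_eq_iff by auto
      also have "\<dots> \<longleftrightarrow> t = m - j" by (auto simp: j_def)
      finally show ?thesis by (simp add: indicator_def)
    qed
    then show ?thesis using mem by (simp add: sum.delta)
  qed
  have "(LINT \<theta>|period. f \<theta> * cis (- of_int n * \<theta>))
     = (LINT \<theta>|lborel. (\<Sum>t\<in>{-K..K}. ?I \<theta> *\<^sub>R (g (\<theta> / (2 * pi) + of_int m - of_int t) * cis (- of_int n * \<theta>))))"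
    by (simp add: integral_restrict_space f_def sum_distrib_right scaleR_sum_right)
  also have "\<dots> = (\<Sum>t\<in>{-K..K}. LINT x|lborel. (2 * pi * ?I (2 * pi * (x - of_int m + of_int t))) *\<^sub>R (g x * cis (- 2 * pi * of_int n * x)))"
    by (subst Bochner_Integration.integral_sum) (simp_all only: gi gs)
  also have "\<dots> = (LINT x|lborel. (\<Sum>t\<in>{-K..K}. (2 * pi * ?I (2 * pi * (x - of_int m + of_int t))) *\<^sub>R (g x * cis (- 2 * pi * of_int n * x))))"
    by (rule Bochner_Integration.integral_sum[symmetric]) (rule gsi)
  also have "\<dots> = (LINT x|lborel. (2 * pi) *\<^sub>R (g x * cis (- 2 * pi * of_int n * x)))"
  proof (intro Bochner_Integration.integral_cong refl)
    fix x
    show "(\<Sum>t\<in>{-K..K}. (2 * pi * ?I (2 * pi * (x - of_int m + of_int t))) *\<^sub>R (g x * cis (- 2 * pi * of_int n * x)))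
      = (2 * pi) *\<^sub>R (g x * cis (- 2 * pi * of_int n * x))"
    proof (cases "\<bar>x\<bar> \<le> R")
      case True
      then show ?thesis
        unfolding scaleR_sum_left[symmetric] sum_distrib_left[symmetric] one[OF True] by simp
    next
      case False
      then show ?thesis using supp[of x] by simp
    qed
  qed
  also have "\<dots> = 2 * pi * (LINT s|lborel. g s * cis (- 2 * pi * of_int n * s))"
    by (simp add: scaleR_conv_of_real)
  finally show "(LINT \<theta>|period. f \<theta> * cis (- of_int n * \<theta>)) = 2 * pi * (LINT s|lborel. g s * cis (- 2 * pi * of_int n * s))" .
qed

text \<open>
  Each window of length one is treated separately, so that only finite sums of translates occur.
\<close>

lemma periodization_sup_bound:
  fixes g :: "real \<Rightarrow> complex" and K :: int
  assumes g: "integrable lborel g" and supp: "\<And>s. \<bar>s\<bar> > R \<Longrightarrow> g s = 0" and K: "real_of_int K \<ge> L + R + 2"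
    and B: "\<And>F. finite F \<Longrightarrow> (\<Sum>n\<in>F. cmod (LINT s|lborel. g s * cis (- 2 * pi * of_int n * s))) \<le> B"
  shows "AE s in lborel. \<bar>s\<bar> \<le> L \<longrightarrow> cmod (\<Sum>t\<in>{-K..K}. g (s - of_int t)) \<le> 2 * B"
proof -
  have gm[measurable]: "g \<in> borel_measurable borel" using g by auto
  have win: "AE s in lborel. \<bar>of_int m\<bar> \<le> L + 1 \<longrightarrow> s \<in> {of_int m - 1/2..<of_int m + 1/2} \<longrightarrow> cmod (\<Sum>t\<in>{-K..K}. g (s - of_int t)) \<le> 2 * B" for m :: int
  proof (cases "\<bar>of_int m\<bar> \<le> L + 1")
    case True
    define f where "f \<theta> = (\<Sum>t\<in>{-K..K}. g (\<theta> / (2 * pi) + of_int m - of_int t))" for \<theta>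
    have fm[measurable]: "f \<in> borel_measurable borel" unfolding f_def by measurable
    have K': "real_of_int K \<ge> \<bar>of_int m\<bar> + R + 1" using True K by linarith
    note pf = periodization_fourier[OF g supp K', folded f_def]
    have "AE \<theta> in period. cmod (f \<theta>) \<le> (2 * pi * B) / pi"
    proof (rule fourier_sup_bound)
      have "(\<Sum>n\<in>F. cmod (LINT \<theta>|period. f \<theta> * cis (- of_int n * \<theta>))) \<le> 2 * pi * B" if F: "finite F" for F :: "int set"
        using mult_left_mono[OF B[OF F], of "2 * pi"] pf(2) unfolding f_def by (simp add: norm_mult sum_distrib_left)
      then show "fourier_sum_le f (2 * pi * B)" using pf(1) unfolding f_def fourier_sum_le_def by simp
    qed
    then have "AE \<theta> in lborel. \<theta> \<in> {-pi..<pi} \<longrightarrow> cmod (f \<theta>) \<le> 2 * B"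
      by (subst (asm) AE_restrict_space_iff) auto
    from AE_borel_affine[OF _ _ this, of "2 * pi" "- 2 * pi * of_int m"]
    have "AE s in lborel. (- 2 * pi * of_int m + 2 * pi * s) \<in> {-pi..<pi} \<longrightarrow> cmod (f (- 2 * pi * of_int m + 2 * pi * s)) \<le> 2 * B"
      by simp
    then show ?thesis
    proof eventually_elim
      case (elim s)
      show ?case
      proof (intro impI)
        assume s: "s \<in> {of_int m - 1/2..<of_int m + 1/2}"
        have "- pi \<le> 2 * pi * y \<longleftrightarrow> -1/2 \<le> y" "2 * pi * y < pi \<longleftrightarrow> y < 1/2" for y
          using mult_le_cancel_left_pos[of "2 * pi" "-1/2" y] mult_less_cancel_left_pos[of "2 * pi" y "1/2"] by simp_all
        from this[of "s - of_int m"] s have "(- 2 * pi * of_int m + 2 * pi * s) \<in> {-pi..<pi}"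
          by (auto simp: algebra_simps)
        moreover have "(- 2 * pi * of_int m + 2 * pi * s) / (2 * pi) + of_int m = s" by (simp add: field_simps)
        ultimately show "cmod (\<Sum>t\<in>{-K..K}. g (s - of_int t)) \<le> 2 * B" using elim by (simp add: f_def)
      qed
    qed
  qed simp
  have "AE s in lborel. \<forall>m::int. \<bar>of_int m\<bar> \<le> L + 1 \<longrightarrow> s \<in> {of_int m - 1/2..<of_int m + 1/2} \<longrightarrow> cmod (\<Sum>t\<in>{-K..K}. g (s - of_int t)) \<le> 2 * B"
    using win by (simp add: AE_all_countable)
  then show ?thesis
  proof eventually_elim
    case (elim s)
    show ?case
    proof
      assume s: "\<bar>s\<bar> \<le> L"
      define m where "m = \<lfloor>s + 1/2\<rfloor>"
      have m: "of_int m \<le> s + 1/2" "s + 1/2 < of_int m + 1" unfolding m_def by linarith+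
      then have "\<bar>of_int m\<bar> \<le> L + 1" using s by linarith
      moreover have "s \<in> {of_int m - 1/2..<of_int m + 1/2}" using m by auto
      ultimately show "cmod (\<Sum>t\<in>{-K..K}. g (s - of_int t)) \<le> 2 * B" using elim by blast
    qed
  qed
qed

section \<open>Wavelet filters and their transfer functions\<close>

lemma sum_int_powr_le:
  fixes \<alpha> :: real
  assumes "\<alpha> > 1" and F: "finite F" "0 \<notin> F"
  shows "(\<Sum>n\<in>F. \<bar>real_of_int n\<bar> powr - \<alpha>) \<le> 2 * (\<Sum>n. real n powr - \<alpha>)"
proof -
  have s: "summable (\<lambda>n. real n powr - \<alpha>)" using assms(1) summable_real_powr_iff[of "- \<alpha>"] by simp
  have part: "(\<Sum>n\<in>G. \<bar>real_of_int n\<bar> powr - \<alpha>) \<le> (\<Sum>n. real n powr - \<alpha>)"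
    if G: "finite G" "inj_on (\<lambda>n. nat \<bar>n\<bar>) G" for G
  proof -
    have "(\<Sum>n\<in>G. \<bar>real_of_int n\<bar> powr - \<alpha>) = (\<Sum>k\<in>(\<lambda>n. nat \<bar>n\<bar>) ` G. real k powr - \<alpha>)"
      by (subst sum.reindex[OF G(2)]) (auto intro!: sum.cong)
    also have "\<dots> \<le> (\<Sum>n. real n powr - \<alpha>)"
      by (rule sum_le_suminf[OF s]) (use G in auto)
    finally show ?thesis .
  qed
  have "(\<Sum>n\<in>F. \<bar>real_of_int n\<bar> powr - \<alpha>) = (\<Sum>n\<in>{n\<in>F. n > 0} \<union> {n\<in>F. n < 0}. \<bar>real_of_int n\<bar> powr - \<alpha>)"
    using F(2) by (intro sum.cong) (auto simp: neq_iff not_less order.order_iff_strict)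
  also have "\<dots> = (\<Sum>n\<in>{n\<in>F. n > 0}. \<bar>real_of_int n\<bar> powr - \<alpha>) + (\<Sum>n\<in>{n\<in>F. n < 0}. \<bar>real_of_int n\<bar> powr - \<alpha>)"
    using F(1) by (intro sum.union_disjoint) auto
  also have "\<dots> \<le> (\<Sum>n. real n powr - \<alpha>) + (\<Sum>n. real n powr - \<alpha>)"
    by (intro add_mono part) (use F in \<open>auto simp: inj_on_def\<close>)
  finally show ?thesis by simp
qed

text \<open>
  The Fourier coefficients of the periodization of \<open>\<psi>(s/a) e\<^bsup>ils\<^esup>\<close> are \<open>a\<close> times the values of \<open>fourier \<psi>\<close> at
  the points \<open>a(2\<pi>n - l)\<close>. For \<open>n \<noteq> 0\<close> these points have modulus at least \<open>a\<bar>n\<bar>\<close>, as \<open>\<bar>l\<bar> \<le> \<pi>\<close>; the term \<open>n = 0\<close> carries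
  the dependence on \<open>l\<close>.
\<close>

lemma wavelet_periodization_bound:
  fixes \<psi> :: "real \<Rightarrow> real" and K :: int
  assumes \<psi>: "integrable lborel \<psi>" and supp: "\<And>t. \<bar>t\<bar> > R \<Longrightarrow> \<psi> t = 0"
    and decay: "\<And>\<xi>. cmod (fourier \<psi> \<xi>) \<le> C * (1 + \<bar>\<xi>\<bar>) powr - \<alpha>" and "\<alpha> > 1" "C \<ge> 0"
    and a: "a > 0" and l: "\<bar>l\<bar> \<le> pi" and K: "real_of_int K \<ge> L + a * R + 2"
  shows "AE s in lborel. \<bar>s\<bar> \<le> L \<longrightarrow>
    cmod (\<Sum>t\<in>{-K..K}. complex_of_real (\<psi> ((s - of_int t) / a)) * cis (l * (s - of_int t)))
      \<le> 2 * (a * C * ((1 + a * \<bar>l\<bar>) powr - \<alpha> + a powr - \<alpha> * (2 * (\<Sum>n. real n powr - \<alpha>))))"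
proof (rule periodization_sup_bound)
  define g where "g s = complex_of_real (\<psi> (s / a)) * cis (l * s)" for s
  have \<psi>a: "integrable lborel (\<lambda>s. \<psi> (s / a))"
    using lborel_integrable_real_affine[OF \<psi>, of "1 / a" 0] a by simp
  have \<psi>m[measurable]: "\<psi> \<in> borel_measurable borel" using \<psi> by auto
  show "integrable lborel (\<lambda>s. complex_of_real (\<psi> (s / a)) * cis (l * s))"
    by (rule Bochner_Integration.integrable_bound[OF \<psi>a]) (auto simp: norm_mult)
  show "complex_of_real (\<psi> (s / a)) * cis (l * s) = 0" if "\<bar>s\<bar> > a * R" for s
    using supp[of "s / a"] that a by (simp add: field_simps)
  show "real_of_int K \<ge> L + a * R + 2" by (rule K)
  fix F :: "int set" assume F: "finite F"
  have int: "cmod (LINT s|lborel. complex_of_real (\<psi> (s / a)) * cis (l * s) * cis (- 2 * pi * of_int n * s))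
     \<le> a * C * (1 + a * \<bar>2 * pi * of_int n - l\<bar>) powr - \<alpha>" for n
  proof -
    have "(LINT s|lborel. complex_of_real (\<psi> (s / a)) * cis (l * s) * cis (- 2 * pi * of_int n * s))
       = \<bar>a\<bar> *\<^sub>R (LINT s|lborel. complex_of_real (\<psi> s) * cis (- (a * (2 * pi * of_int n - l)) * s))"
      by (subst lborel_integral_real_affine[of a _ 0])
         (use a in \<open>auto simp: cis_mult mult.assoc algebra_simps\<close>)
    also have "\<dots> = a *\<^sub>R fourier \<psi> (a * (2 * pi * of_int n - l))"
      using a by (simp add: fourier_def)
    finally show ?thesis
      using decay[of "a * (2 * pi * of_int n - l)"] a by (simp add: abs_mult mult.assoc)
  qed
  have nz: "(1 + a * \<bar>2 * pi * of_int n - l\<bar>) powr - \<alpha> \<le> a powr - \<alpha> * \<bar>real_of_int n\<bar> powr - \<alpha>" if "n \<noteq> 0" for n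
  proof -
    have n1: "\<bar>real_of_int n\<bar> \<ge> 1" using that by linarith
    have "2 * pi * \<bar>real_of_int n\<bar> - pi \<le> \<bar>2 * pi * of_int n - l\<bar>"
      using l abs_triangle_ineq2[of "2 * pi * of_int n" l] by (simp add: abs_mult)
    moreover have "\<bar>real_of_int n\<bar> * 1 + pi * 1 \<le> \<bar>real_of_int n\<bar> * pi + pi * \<bar>real_of_int n\<bar>"
      using n1 pi_gt3 by (intro add_mono mult_left_mono) auto
    ultimately have "\<bar>real_of_int n\<bar> \<le> \<bar>2 * pi * of_int n - l\<bar>" by (simp add: algebra_simps)
    then have "a * \<bar>real_of_int n\<bar> \<le> 1 + a * \<bar>2 * pi * of_int n - l\<bar>"
      using mult_left_mono[of "\<bar>real_of_int n\<bar>" "\<bar>2 * pi * of_int n - l\<bar>" a] a by linarith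
    then have "(1 + a * \<bar>2 * pi * of_int n - l\<bar>) powr - \<alpha> \<le> (a * \<bar>real_of_int n\<bar>) powr - \<alpha>"
      using \<open>\<alpha> > 1\<close> a n1 by (intro powr_mono2') auto
    then show ?thesis using a by (simp add: powr_mult)
  qed
  have "(\<Sum>n\<in>F. cmod (LINT s|lborel. complex_of_real (\<psi> (s / a)) * cis (l * s) * cis (- 2 * pi * of_int n * s)))
    \<le> (\<Sum>n\<in>F. a * C * (1 + a * \<bar>2 * pi * of_int n - l\<bar>) powr - \<alpha>)"
    by (rule sum_mono) (rule int)
  also have "\<dots> \<le> (\<Sum>n\<in>insert 0 F. a * C * (1 + a * \<bar>2 * pi * of_int n - l\<bar>) powr - \<alpha>)"
    using F a \<open>C \<ge> 0\<close> by (intro sum_mono2) auto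
  also have "\<dots> = a * C * ((1 + a * \<bar>l\<bar>) powr - \<alpha> + (\<Sum>n\<in>F - {0}. (1 + a * \<bar>2 * pi * of_int n - l\<bar>) powr - \<alpha>))"
    using F by (simp add: sum.insert_remove sum_distrib_left distrib_left)
  also have "\<dots> \<le> a * C * ((1 + a * \<bar>l\<bar>) powr - \<alpha> + (\<Sum>n\<in>F - {0}. a powr - \<alpha> * \<bar>real_of_int n\<bar> powr - \<alpha>))"
    using a \<open>C \<ge> 0\<close> by (intro mult_left_mono add_left_mono sum_mono nz) auto
  also have "\<dots> \<le> a * C * ((1 + a * \<bar>l\<bar>) powr - \<alpha> + a powr - \<alpha> * (2 * (\<Sum>n. real n powr - \<alpha>)))"
    unfolding sum_distrib_left[symmetric]
    using a \<open>C \<ge> 0\<close> F by (intro mult_left_mono add_left_mono sum_int_powr_le \<open>\<alpha> > 1\<close>) auto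
  finally show "(\<Sum>n\<in>F. cmod (LINT s|lborel. complex_of_real (\<psi> (s / a)) * cis (l * s) * cis (- 2 * pi * of_int n * s)))
    \<le> a * C * ((1 + a * \<bar>l\<bar>) powr - \<alpha> + a powr - \<alpha> * (2 * (\<Sum>n. real n powr - \<alpha>)))" .
qed

text \<open>
  At the scale \<open>a = 1/(4R)\<close> the integer translates of \<open>\<psi>(s/a)\<close> do not overlap near the origin, so
  the bound for the periodization is a bound for \<open>\<psi>\<close>.
\<close>

lemma AE_bounded_of_fourier_decay:
  fixes \<psi> :: "real \<Rightarrow> real"
  assumes \<psi>: "integrable lborel \<psi>" and supp: "\<And>t. \<bar>t\<bar> > R \<Longrightarrow> \<psi> t = 0" and R: "R > 0"
    and decay: "\<And>\<xi>. cmod (fourier \<psi> \<xi>) \<le> C * (1 + \<bar>\<xi>\<bar>) powr - \<alpha>" and \<alpha>: "\<alpha> > 1" "C \<ge> 0"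
  obtains b where "b > 0" "AE x in lborel. \<bar>\<psi> x\<bar> \<le> b"
proof -
  have \<psi>m[measurable]: "\<psi> \<in> borel_measurable borel" using \<psi> by auto
  define a where "a = 1 / (4 * R)"
  have a: "a > 0" "a * R = 1/4" using R by (auto simp: a_def)
  define b0 where "b0 = 2 * (a * C * ((1 + a * \<bar>0\<bar>) powr - \<alpha> + a powr - \<alpha> * (2 * (\<Sum>n. real n powr - \<alpha>))))"
  have b0: "AE s in lborel. \<bar>s\<bar> \<le> 1/4 \<longrightarrow>
    cmod (\<Sum>t\<in>{-3..3::int}. complex_of_real (\<psi> ((s - of_int t) / a)) * cis (0 * (s - of_int t))) \<le> b0"
    unfolding b0_def by (rule wavelet_periodization_bound[OF \<psi> supp decay \<alpha> a(1)]) (use a(2) in auto)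
  \<comment> \<open>The window \<open>{-3..3}\<close> is large enough since \<open>L + aR + 2 = 5/2\<close> for \<open>L = 1/4\<close>.\<close>
  have single: "(\<Sum>t\<in>{-3..3::int}. complex_of_real (\<psi> ((s - of_int t) / a)) * cis (0 * (s - of_int t))) = \<psi> (s / a)"
    if s: "\<bar>s\<bar> \<le> 1/4" for s
  proof -
    have "\<psi> ((s - of_int t) / a) = 0" if "t \<noteq> 0" for t :: int
    proof (rule supp)
      have "\<bar>real_of_int t\<bar> \<ge> 1" using that by linarith
      then have "\<bar>s - of_int t\<bar> > a * R" using s a(2) by linarith
      then show "R < \<bar>(s - of_int t) / a\<bar>" using a(1) by (simp add: field_simps)
    qed
    then have "(\<Sum>t\<in>{-3..3::int}. complex_of_real (\<psi> ((s - of_int t) / a)) * cis (0 * (s - of_int t)))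
      = (\<Sum>t\<in>{-3..3::int}. if t = 0 then complex_of_real (\<psi> (s / a)) else 0)"
      by (intro sum.cong) auto
    then show ?thesis by simp
  qed
  have "AE s in lborel. \<bar>s\<bar> \<le> 1/4 \<longrightarrow> \<bar>\<psi> (s / a)\<bar> \<le> b0"
    using b0 by eventually_elim (auto simp only: single norm_of_real)
  from AE_borel_affine[OF _ _ this, of a 0] a
  have "AE x in lborel. \<bar>a * x\<bar> \<le> 1/4 \<longrightarrow> \<bar>\<psi> x\<bar> \<le> b0" by simp
  then have "AE x in lborel. \<bar>\<psi> x\<bar> \<le> max b0 1"
  proof eventually_elim
    case (elim x)
    show ?case
    proof (cases "\<bar>x\<bar> \<le> R")
      case True
      have "a * \<bar>x\<bar> \<le> a * R" using a True by (intro mult_left_mono) auto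
      then have "\<bar>a * x\<bar> \<le> 1/4" using a by (simp add: abs_mult)
      then show ?thesis using elim by auto
    next
      case False
      then show ?thesis using supp[of x] by simp
    qed
  qed
  then show ?thesis using that[of "max b0 1"] by auto
qed

context
  fixes \<phi> \<psi> :: "real \<Rightarrow> real" and M :: nat and \<alpha> :: real
  assumes wc: "wavelet_conditions \<phi> \<psi> M \<alpha>"
begin

lemma wavelet_alpha: "\<alpha> > 1" and phi_integrable: "integrable lborel \<phi>" and psi_integrable: "integrable lborel \<psi>"
  using wc by (auto simp: wavelet_conditions_def)

lemma wavelet_support:
  obtains R where "R \<ge> 1" "\<And>t. \<bar>t\<bar> > R \<Longrightarrow> \<phi> t = 0" "\<And>t. \<bar>t\<bar> > R \<Longrightarrow> \<psi> t = 0"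
proof -
  obtain a b where "\<forall>t\<in>{t. \<phi> t \<noteq> 0}. norm t \<le> a" "\<forall>t\<in>{t. \<psi> t \<noteq> 0}. norm t \<le> b"
    using wc unfolding wavelet_conditions_def bounded_iff by blast
  then show ?thesis by (intro that[of "max 1 (max a b)"]) force+
qed

lemma wavelet_decay:
  obtains C where "C \<ge> 0" "\<And>\<xi>. cmod (fourier \<psi> \<xi>) \<le> C * (1 + \<bar>\<xi>\<bar>) powr - \<alpha>"
proof -
  obtain C where C: "\<And>\<xi>. cmod (fourier \<psi> \<xi>) * (1 + \<bar>\<xi>\<bar>) powr \<alpha> \<le> C"
    using wc unfolding wavelet_conditions_def bdd_above_def by auto
  have "C \<ge> 0" using C[of 0] order.trans[OF norm_ge_zero, of "fourier \<psi> 0" C] by simp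
  moreover have "cmod (fourier \<psi> \<xi>) \<le> C * (1 + \<bar>\<xi>\<bar>) powr - \<alpha>" for \<xi>
    using C[of \<xi>] by (simp add: powr_minus field_simps)
  ultimately show ?thesis using that by blast
qed

lemma psi_AE_bounded: obtains b where "b > 0" "AE x in lborel. \<bar>\<psi> x\<bar> \<le> b"
proof -
  obtain R where R: "R \<ge> 1" "\<And>t. \<bar>t\<bar> > R \<Longrightarrow> \<psi> t = 0" using wavelet_support by metis
  obtain C where C: "C \<ge> 0" "\<And>\<xi>. cmod (fourier \<psi> \<xi>) \<le> C * (1 + \<bar>\<xi>\<bar>) powr - \<alpha>" using wavelet_decay by metis
  show ?thesis
    by (rule AE_bounded_of_fourier_decay[OF psi_integrable R(2) _ C(2) wavelet_alpha C(1)]) (use R(1) that in auto)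
qed

lemma psi_scaled_AE_bounded:
  assumes "AE x in lborel. \<bar>\<psi> x\<bar> \<le> b"
  shows "AE s in lborel. \<bar>\<psi> (s / 2 ^ j)\<bar> \<le> b"
proof -
  have [measurable]: "\<psi> \<in> borel_measurable borel" using psi_integrable by auto
  show ?thesis using AE_borel_affine[OF _ _ assms, of "1 / 2 ^ j" 0] by simp
qed

lemma phi_shift_integrable: "integrable lborel (\<lambda>s. \<phi> (s + of_int t))"
  using lborel_integrable_real_affine[OF phi_integrable, of 1 "of_int t"] by (simp add: add.commute)

lemma phi_psi_integrable: "integrable lborel (\<lambda>s. \<phi> (s + of_int t) * \<psi> (s / 2 ^ j))"
proof -
  obtain b where b: "b > 0" "AE x in lborel. \<bar>\<psi> x\<bar> \<le> b" using psi_AE_bounded by metis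
  have [measurable]: "\<psi> \<in> borel_measurable borel" "\<phi> \<in> borel_measurable borel"
    using psi_integrable phi_integrable by auto
  show ?thesis
  proof (rule Bochner_Integration.integrable_bound)
    show "integrable lborel (\<lambda>s. b * \<phi> (s + of_int t))" using phi_shift_integrable by simp
    show "AE s in lborel. norm (\<phi> (s + of_int t) * \<psi> (s / 2 ^ j)) \<le> norm (b * \<phi> (s + of_int t))"
      using psi_scaled_AE_bounded[OF b(2), of j]
    proof eventually_elim
      case (elim s)
      then show ?case using mult_left_mono[OF elim, of "\<bar>\<phi> (s + of_int t)\<bar>"] b(1)
        by (simp add: abs_mult mult.commute)
    qed
  qed measurable
qed

lemma filt_bound:
  obtains B where "B > 0" "\<And>j t. \<bar>filt \<phi> \<psi> j t\<bar> \<le> B * 2 powr (- real j / 2)"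
proof -
  obtain b where b: "b > 0" "AE x in lborel. \<bar>\<psi> x\<bar> \<le> b" using psi_AE_bounded by metis
  have N: "(LINT s|lborel. \<bar>\<phi> (s + of_int t)\<bar>) = (LINT s|lborel. \<bar>\<phi> s\<bar>)" for t
    using lborel_integral_real_affine[of 1 "\<lambda>s. \<bar>\<phi> s\<bar>" "of_int t"] by (simp add: add.commute)
  have "\<bar>filt \<phi> \<psi> j t\<bar> \<le> (b * (LINT s|lborel. \<bar>\<phi> s\<bar>) + 1) * 2 powr (- real j / 2)" for j t
  proof -
    have "\<bar>LINT s|lborel. \<phi> (s + of_int t) * \<psi> (s / 2 ^ j)\<bar> \<le> (LINT s|lborel. \<bar>\<phi> (s + of_int t) * \<psi> (s / 2 ^ j)\<bar>)"
      by (rule integral_abs_bound)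
    also have "\<dots> \<le> (LINT s|lborel. b * \<bar>\<phi> (s + of_int t)\<bar>)"
    proof (rule integral_mono_AE)
      show "AE s in lborel. \<bar>\<phi> (s + of_int t) * \<psi> (s / 2 ^ j)\<bar> \<le> b * \<bar>\<phi> (s + of_int t)\<bar>"
        using psi_scaled_AE_bounded[OF b(2), of j]
      proof eventually_elim
        case (elim s)
        then show ?case using mult_left_mono[OF elim, of "\<bar>\<phi> (s + of_int t)\<bar>"]
          by (simp add: abs_mult mult.commute)
      qed
    qed (use phi_psi_integrable phi_shift_integrable in auto)
    also have "\<dots> = b * (LINT s|lborel. \<bar>\<phi> s\<bar>)" by (simp add: N)
    finally have "\<bar>LINT s|lborel. \<phi> (s + of_int t) * \<psi> (s / 2 ^ j)\<bar> \<le> b * (LINT s|lborel. \<bar>\<phi> s\<bar>) + 1" by simp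
    then show ?thesis unfolding filt_def abs_mult by (subst mult.commute) (auto intro!: mult_right_mono)
  qed
  moreover have "b * (LINT s|lborel. \<bar>\<phi> s\<bar>) + 1 > 0" using b(1) by (intro add_nonneg_pos mult_nonneg_nonneg) auto
  ultimately show ?thesis using that by blast
qed

lemma filt_support:
  assumes R: "\<And>t. \<bar>t\<bar> > R \<Longrightarrow> \<phi> t = 0" "\<And>t. \<bar>t\<bar> > R \<Longrightarrow> \<psi> t = 0" and "filt \<phi> \<psi> j t \<noteq> 0"
  shows "\<bar>real_of_int t\<bar> \<le> R + R * 2 ^ j"
proof (rule ccontr)
  assume t: "\<not> ?thesis"
  have "\<phi> (s + of_int t) * \<psi> (s / 2 ^ j) = 0" for s
  proof (cases "\<bar>s\<bar> \<le> R * 2 ^ j")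
    case True
    then have "\<bar>s + of_int t\<bar> > R" using t by linarith
    then show ?thesis using R by simp
  next
    case False
    then have "\<bar>s / 2 ^ j\<bar> > R" by (simp add: field_simps)
    then show ?thesis using R by simp
  qed
  then have "(\<lambda>s. \<phi> (s + of_int t) * \<psi> (s / 2 ^ j)) = (\<lambda>s. 0)" by (intro ext)
  then have "filt \<phi> \<psi> j t = 0" by (simp only: filt_def) simp
  then show False using assms by simp
qed

lemma psi_moment_zero:
  assumes "i < M" shows "integrable lborel (\<lambda>s. s ^ i * \<psi> (s / 2 ^ j))" "(LINT s|lborel. s ^ i * \<psi> (s / 2 ^ j)) = 0"
proof -
  obtain R where R: "R \<ge> 1" "\<And>t. \<bar>t\<bar> > R \<Longrightarrow> \<psi> t = 0" using wavelet_support by metis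
  have [measurable]: "\<psi> \<in> borel_measurable borel" using psi_integrable by auto
  have i: "integrable lborel (\<lambda>s. s ^ i * \<psi> s)"
  proof (rule Bochner_Integration.integrable_bound)
    show "integrable lborel (\<lambda>s. R ^ i * \<psi> s)" using psi_integrable by simp
    show "AE s in lborel. norm (s ^ i * \<psi> s) \<le> norm (R ^ i * \<psi> s)"
    proof (intro always_eventually allI)
      fix s show "norm (s ^ i * \<psi> s) \<le> norm (R ^ i * \<psi> s)"
      proof (cases "\<bar>s\<bar> \<le> R")
        case True
        then show ?thesis using power_mono[OF True, of i] R(1) by (auto simp: abs_mult power_abs intro!: mult_right_mono)
      qed (use R in auto)
    qed
  qed measurable
  have "integrable lborel (\<lambda>s. (2 ^ j) ^ i * ((s / 2 ^ j) ^ i * \<psi> (s / 2 ^ j)))"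
    using lborel_integrable_real_affine[OF i, of "1 / 2 ^ j" 0] by simp
  then show "integrable lborel (\<lambda>s. s ^ i * \<psi> (s / 2 ^ j))" by (simp add: power_divide)
  have "(LINT s|lborel. s ^ i * \<psi> (s / 2 ^ j)) = \<bar>2 ^ j\<bar> *\<^sub>R (LINT x|lborel. (2 ^ j * x) ^ i * \<psi> x)"
    by (subst lborel_integral_real_affine[of "2 ^ j" _ 0]) auto
  also have "\<dots> = 0" using wc assms by (simp add: power_mult_distrib mult.assoc wavelet_conditions_def)
  finally show "(LINT s|lborel. s ^ i * \<psi> (s / 2 ^ j)) = 0" .
qed

text \<open>
  Summing over \<open>t\<close> first, \<open>\<phi>\<close> reproduces a polynomial of degree \<open>m\<close> in \<open>s\<close>, which is orthogonal to \<open>\<psi>(2\<^bsup>-j\<^esup>s)\<close>.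
\<close>

lemma filt_moment_zero:
  assumes "m < M" and R: "\<And>t. \<bar>t\<bar> > R \<Longrightarrow> \<phi> t = 0" "\<And>t. \<bar>t\<bar> > R \<Longrightarrow> \<psi> t = 0"
    and K: "real_of_int K \<ge> R + R * 2 ^ j"
  shows "(\<Sum>t\<in>{-K..K}. of_int t ^ m * filt \<phi> \<psi> j t) = 0"
proof -
  obtain q :: "real poly" where q: "degree q = m" "\<And>t. (\<Sum>\<^sub>\<infinity>k::int. of_int k ^ m * \<phi> (t - of_int k)) = poly q t"
    using wc assms(1) unfolding wavelet_conditions_def by blast
  have pw: "(\<Sum>t\<in>{-K..K}. of_int t ^ m * \<phi> (s + of_int t)) * \<psi> (s / 2 ^ j) = (-1) ^ m * (poly q s * \<psi> (s / 2 ^ j))" for s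
  proof (cases "\<bar>s\<bar> \<le> R * 2 ^ j")
    case True
    have "(\<Sum>t\<in>{-K..K}. of_int t ^ m * \<phi> (s + of_int t)) = (\<Sum>k\<in>{-K..K}. (-1) ^ m * (of_int k ^ m * \<phi> (s - of_int k)))"
      by (rule sum.reindex_bij_witness[of _ uminus uminus]) (auto simp: power_minus[of "real_of_int _"])
    also have "\<dots> = (-1) ^ m * (\<Sum>k\<in>{-K..K}. of_int k ^ m * \<phi> (s - of_int k))" by (simp add: sum_distrib_left)
    also have "(\<Sum>k\<in>{-K..K}. of_int k ^ m * \<phi> (s - of_int k)) = (\<Sum>\<^sub>\<infinity>k\<in>{-K..K}. of_int k ^ m * \<phi> (s - of_int k))"
      by simp
    also have "\<dots> = (\<Sum>\<^sub>\<infinity>k::int. of_int k ^ m * \<phi> (s - of_int k))"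
    proof (rule infsum_cong_neutral)
      fix k :: int assume "k \<in> UNIV - {-K..K}"
      then have "\<bar>real_of_int k\<bar> > of_int K" by (auto simp flip: of_int_abs)
      then have "\<bar>s - of_int k\<bar> > R" using True K by linarith
      then show "of_int k ^ m * \<phi> (s - of_int k) = 0" using R by simp
    qed auto
    finally show ?thesis by (simp add: q(2))
  next
    case False
    then have "\<bar>s / 2 ^ j\<bar> > R" by (simp add: field_simps)
    then show ?thesis using R by simp
  qed
  have "(\<Sum>t\<in>{-K..K}. of_int t ^ m * filt \<phi> \<psi> j t)
    = 2 powr (- real j / 2) * (\<Sum>t\<in>{-K..K}. LINT s|lborel. of_int t ^ m * (\<phi> (s + of_int t) * \<psi> (s / 2 ^ j)))"
    by (simp add: filt_def sum_distrib_left mult_ac)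
  also have "(\<Sum>t\<in>{-K..K}. LINT s|lborel. of_int t ^ m * (\<phi> (s + of_int t) * \<psi> (s / 2 ^ j)))
    = (LINT s|lborel. (\<Sum>t\<in>{-K..K}. of_int t ^ m * (\<phi> (s + of_int t) * \<psi> (s / 2 ^ j))))"
    by (rule Bochner_Integration.integral_sum[symmetric]) (use phi_psi_integrable in auto)
  also have "\<dots> = (LINT s|lborel. (-1) ^ m * (\<Sum>i\<le>m. coeff q i * (s ^ i * \<psi> (s / 2 ^ j))))"
  proof (intro Bochner_Integration.integral_cong refl)
    fix s
    have "(\<Sum>t\<in>{-K..K}. of_int t ^ m * (\<phi> (s + of_int t) * \<psi> (s / 2 ^ j)))
      = (\<Sum>t\<in>{-K..K}. of_int t ^ m * \<phi> (s + of_int t)) * \<psi> (s / 2 ^ j)"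
      by (simp add: sum_distrib_right mult.assoc)
    also have "\<dots> = (-1) ^ m * (poly q s * \<psi> (s / 2 ^ j))" by (rule pw)
    also have "poly q s * \<psi> (s / 2 ^ j) = (\<Sum>i\<le>m. coeff q i * (s ^ i * \<psi> (s / 2 ^ j)))"
      by (simp add: poly_altdef q(1) sum_distrib_right mult.assoc)
    finally show "(\<Sum>t\<in>{-K..K}. of_int t ^ m * (\<phi> (s + of_int t) * \<psi> (s / 2 ^ j)))
      = (-1) ^ m * (\<Sum>i\<le>m. coeff q i * (s ^ i * \<psi> (s / 2 ^ j)))" .
  qed
  also have "\<dots> = (-1) ^ m * (\<Sum>i\<le>m. coeff q i * (LINT s|lborel. s ^ i * \<psi> (s / 2 ^ j)))"
    using psi_moment_zero(1)[of _ j] assms(1) by (subst integral_mult_right_zero, subst Bochner_Integration.integral_sum) auto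
  also have "\<dots> = 0" using psi_moment_zero(2)[of _ j] assms(1) by simp
  finally show ?thesis by simp
qed

lemma gchoose_poly: "\<exists>q :: real poly. degree q \<le> m \<and> (\<forall>x. poly q x = x gchoose m)"
proof (induction m)
  case 0
  show ?case by (rule exI[of _ 1]) simp
next
  case (Suc m)
  then obtain q :: "real poly" where q: "degree q \<le> m" "\<And>x. poly q x = x gchoose m" by blast
  have "degree (q * [:- of_nat m, 1:] ) \<le> Suc m" using degree_mult_le[of q "[:- of_nat m, 1:]"] q(1) by simp
  moreover have "poly (smult (1 / of_nat (Suc m)) (q * [:- of_nat m, 1:])) x = x gchoose Suc m" for x
  proof -
    have "of_nat (Suc m) * (x gchoose Suc m) = (x gchoose m) * (x - of_nat m)"
      using gbinomial_absorb_comp[of x m] gbinomial_absorption[of m x] gbinomial_mult_1[of x m] by (simp add: algebra_simps)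
    then show ?thesis using q(2)[of x] by (simp add: field_simps)
  qed
  ultimately show ?case
    by (intro exI[of _ "smult (1 / of_nat (Suc m)) (q * [:- of_nat m, 1:])"]) (auto intro: order.trans[OF degree_smult_le])
qed

lemma filt_binomial_moment_zero:
  assumes "m < M" shows "binomial_moment m (filt \<phi> \<psi> j) = 0"
proof -
  obtain R where R: "\<And>t. \<bar>t\<bar> > R \<Longrightarrow> \<phi> t = 0" "\<And>t. \<bar>t\<bar> > R \<Longrightarrow> \<psi> t = 0" using wavelet_support by metis
  define K where "K = \<lceil>R + R * 2 ^ j\<rceil>"
  have K: "real_of_int K \<ge> R + R * 2 ^ j" unfolding K_def by linarith
  obtain q :: "real poly" where q: "degree q \<le> m" "\<And>x. poly q x = x gchoose m" using gchoose_poly by metis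
  have "binomial_moment m (filt \<phi> \<psi> j) = (\<Sum>t\<in>{-K..K}. filt \<phi> \<psi> j t * (of_int t gchoose m))"
    unfolding binomial_moment_def
  proof (rule sum.mono_neutral_left)
    show "{t. filt \<phi> \<psi> j t \<noteq> 0} \<subseteq> {-K..K}"
    proof
      fix t assume "t \<in> {t. filt \<phi> \<psi> j t \<noteq> 0}"
      then have "\<bar>real_of_int t\<bar> \<le> of_int K" using filt_support[where j = j and t = t and R = R] R K by fastforce
      then show "t \<in> {-K..K}" by (auto simp flip: of_int_abs)
    qed
  qed auto
  also have "\<dots> = (\<Sum>t\<in>{-K..K}. \<Sum>i\<le>degree q. coeff q i * (of_int t ^ i * filt \<phi> \<psi> j t))"
    by (simp add: q(2)[symmetric] poly_altdef sum_distrib_left mult_ac)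
  also have "\<dots> = (\<Sum>i\<le>degree q. coeff q i * (\<Sum>t\<in>{-K..K}. of_int t ^ i * filt \<phi> \<psi> j t))"
    by (subst sum.swap) (simp add: sum_distrib_left)
  also have "\<dots> = 0" using filt_moment_zero[OF _ R K] q(1) assms by simp
  finally show ?thesis .
qed

text \<open>
  Translating \<open>s\<close> by \<open>t\<close> in each term turns the transfer function into the integral of \<open>\<phi>(s) e\<^bsup>-ils\<^esup>\<close> against the
  modulated periodization \<open>\<Psi>\<close> of \<open>\<psi>(2\<^bsup>-j\<^esup>s)\<close>, which is bounded by a multiple of \<open>2\<^bsup>j\<^esup> (2\<^bsup>j\<^esup>\<bar>l\<bar>)\<^bsup>-\<alpha>\<^esup>\<close>. The sums over \<open>{-K..K}\<close>
  are all the same once \<open>K\<close> exceeds the support of the filter.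
\<close>

lemma filt_transfer_decay:
  obtains C where "C > 0"
    "\<And>j l. 0 < \<bar>l\<bar> \<Longrightarrow> \<bar>l\<bar> \<le> pi \<Longrightarrow> \<exists>K0::int. \<forall>K\<ge>K0. cmod (\<Sum>t\<in>{-K..K}. filt \<phi> \<psi> j t *\<^sub>R cis (- l * of_int t)) \<le> C * 2 powr (real j / 2) * (2 ^ j * \<bar>l\<bar>) powr - \<alpha>"
proof -
  obtain R where R: "R \<ge> 1" "\<And>t. \<bar>t\<bar> > R \<Longrightarrow> \<phi> t = 0" "\<And>t. \<bar>t\<bar> > R \<Longrightarrow> \<psi> t = 0" using wavelet_support by metis
  obtain c where c: "c \<ge> 0" "\<And>\<xi>. cmod (fourier \<psi> \<xi>) \<le> c * (1 + \<bar>\<xi>\<bar>) powr - \<alpha>" using wavelet_decay by metis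
  define S where "S = (\<Sum>n. real n powr - \<alpha>)"
  have S: "S \<ge> 0" unfolding S_def using wavelet_alpha summable_real_powr_iff[of "- \<alpha>"] by (intro suminf_nonneg) auto
  define N where "N = (LINT s|lborel. \<bar>\<phi> s\<bar>)"
  have N: "N \<ge> 0" by (simp add: N_def)
  define C where "C = N * (2 * c * (1 + pi powr \<alpha> * (2 * S))) + 1"
  have [measurable]: "\<psi> \<in> borel_measurable borel" "\<phi> \<in> borel_measurable borel"
    using psi_integrable phi_integrable by auto
  have "\<exists>K0::int. \<forall>K\<ge>K0. cmod (\<Sum>t\<in>{-K..K}. filt \<phi> \<psi> j t *\<^sub>R cis (- l * of_int t)) \<le> C * 2 powr (real j / 2) * (2 ^ j * \<bar>l\<bar>) powr - \<alpha>"
    if l: "0 < \<bar>l\<bar>" "\<bar>l\<bar> \<le> pi" for j l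
  proof (intro exI[of _ "\<lceil>R + 2 ^ j * R + 2\<rceil>"] allI impI)
    fix K :: int assume "K \<ge> \<lceil>R + 2 ^ j * R + 2\<rceil>"
    then have K: "real_of_int K \<ge> R + 2 ^ j * R + 2" by linarith
    \<comment> \<open>The factor \<open>\<pi>\<^bsup>\<alpha>\<^esup>\<close> below compares \<open>a\<^bsup>-\<alpha>\<^esup>\<close> with \<open>(a\<bar>l\<bar>)\<^bsup>-\<alpha>\<^esup>\<close>, as \<open>\<bar>l\<bar> \<le> \<pi>\<close>.\<close>
    define a :: real where "a = 2 ^ j"
    have a: "a > 0" by (simp add: a_def)
    define \<Psi> where "\<Psi> s = (\<Sum>t\<in>{-K..K}. complex_of_real (\<psi> ((s - of_int t) / a)) * cis (l * (s - of_int t)))" for s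
    define b where "b = 2 * a * c * (1 + pi powr \<alpha> * (2 * S)) * (a * \<bar>l\<bar>) powr - \<alpha>"
    have b0: "b \<ge> 0" unfolding b_def using a c(1) S by simp
    have al: "(1 + a * \<bar>l\<bar>) powr - \<alpha> \<le> (a * \<bar>l\<bar>) powr - \<alpha>"
      using wavelet_alpha a l by (intro powr_mono2') auto
    have "a powr - \<alpha> = (a * \<bar>l\<bar>) powr - \<alpha> * \<bar>l\<bar> powr \<alpha>"
      using a l by (simp add: powr_mult powr_minus)
    also have "\<dots> \<le> (a * \<bar>l\<bar>) powr - \<alpha> * pi powr \<alpha>"
      using l wavelet_alpha by (intro mult_left_mono powr_mono2) auto
    finally have al2: "a powr - \<alpha> \<le> (a * \<bar>l\<bar>) powr - \<alpha> * pi powr \<alpha>" .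
    have "AE s in lborel. \<bar>s\<bar> \<le> R \<longrightarrow> cmod (\<Psi> s) \<le> 2 * (a * c * ((1 + a * \<bar>l\<bar>) powr - \<alpha> + a powr - \<alpha> * (2 * S)))"
      unfolding \<Psi>_def S_def
      by (rule wavelet_periodization_bound[OF psi_integrable R(3) c(2) wavelet_alpha c(1) a l(2)])
         (use K in \<open>simp_all add: a_def\<close>)
    moreover have "2 * (a * c * ((1 + a * \<bar>l\<bar>) powr - \<alpha> + a powr - \<alpha> * (2 * S))) \<le> 2 * (a * c * ((a * \<bar>l\<bar>) powr - \<alpha> + (a * \<bar>l\<bar>) powr - \<alpha> * pi powr \<alpha> * (2 * S)))"
      using a c(1) S by (intro mult_left_mono add_mono mult_right_mono al al2) auto
    moreover have "2 * (a * c * ((a * \<bar>l\<bar>) powr - \<alpha> + (a * \<bar>l\<bar>) powr - \<alpha> * pi powr \<alpha> * (2 * S))) = b"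
      by (simp add: b_def algebra_simps)
    ultimately have \<Psi>b: "AE s in lborel. \<bar>s\<bar> \<le> R \<longrightarrow> cmod (\<Psi> s) \<le> b"
      by (auto elim!: eventually_mono)
    have term_int: "integrable lborel (\<lambda>s. complex_of_real (\<phi> s * \<psi> ((s - of_int t) / a)) * cis (- l * of_int t))" for t
    proof -
      have "integrable lborel (\<lambda>s. \<phi> s * \<psi> ((s - of_int t) / a))"
        using lborel_integrable_real_affine[OF phi_psi_integrable[of t j], of 1 "- of_int t"] by (simp add: a_def)
      then show ?thesis by (intro integrable_mult_left integrable_of_real)
    qed
    have shift: "complex_of_real (LINT s|lborel. \<phi> (s + of_int t) * \<psi> (s / 2 ^ j)) * cis (- l * of_int t) = (LINT s|lborel. complex_of_real (\<phi> s * \<psi> ((s - of_int t) / a)) * cis (- l * of_int t))" for t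
    proof -
      have "(LINT s|lborel. \<phi> (s + of_int t) * \<psi> (s / 2 ^ j)) = (LINT s|lborel. \<phi> s * \<psi> ((s - of_int t) / a))"
        by (subst lborel_integral_real_affine[of 1 _ "- of_int t"]) (auto simp: a_def)
      then show ?thesis by (simp only: integral_mult_left_zero integral_complex_of_real)
    qed
    have "(\<Sum>t\<in>{-K..K}. filt \<phi> \<psi> j t *\<^sub>R cis (- l * of_int t))
      = 2 powr (- real j / 2) * (\<Sum>t\<in>{-K..K}. complex_of_real (LINT s|lborel. \<phi> (s + of_int t) * \<psi> (s / 2 ^ j)) * cis (- l * of_int t))"
      by (simp add: filt_def scaleR_conv_of_real sum_distrib_left mult.assoc)
    also have "(\<Sum>t\<in>{-K..K}. complex_of_real (LINT s|lborel. \<phi> (s + of_int t) * \<psi> (s / 2 ^ j)) * cis (- l * of_int t))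
      = (LINT s|lborel. (\<Sum>t\<in>{-K..K}. complex_of_real (\<phi> s * \<psi> ((s - of_int t) / a)) * cis (- l * of_int t)))"
      unfolding shift by (rule Bochner_Integration.integral_sum[symmetric]) (rule term_int)
    also have "\<dots> = (LINT s|lborel. complex_of_real (\<phi> s) * cis (- l * s) * \<Psi> s)"
    proof (intro Bochner_Integration.integral_cong refl)
      fix s
      have "cis (- l * of_int t) = cis (- l * s) * cis (l * (s - of_int t))" for t
        by (simp add: cis_mult algebra_simps)
      then show "(\<Sum>t\<in>{-K..K}. complex_of_real (\<phi> s * \<psi> ((s - of_int t) / a)) * cis (- l * of_int t)) = complex_of_real (\<phi> s) * cis (- l * s) * \<Psi> s"
        unfolding \<Psi>_def by (simp add: sum_distrib_left mult_ac)
    qed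
    finally have eq: "(\<Sum>t\<in>{-K..K}. filt \<phi> \<psi> j t *\<^sub>R cis (- l * of_int t))
      = 2 powr (- real j / 2) * (LINT s|lborel. complex_of_real (\<phi> s) * cis (- l * s) * \<Psi> s)" .
    have bd: "AE s in lborel. norm (complex_of_real (\<phi> s) * cis (- l * s) * \<Psi> s) \<le> b * \<bar>\<phi> s\<bar>"
      using \<Psi>b
    proof eventually_elim
      case (elim s)
      show ?case
      proof (cases "\<bar>s\<bar> \<le> R")
        case True
        then show ?thesis using elim mult_left_mono[of "cmod (\<Psi> s)" b "\<bar>\<phi> s\<bar>"] by (simp add: norm_mult mult.commute)
      qed (use R in simp)
    qed
    have \<Psi>m[measurable]: "\<Psi> \<in> borel_measurable borel" unfolding \<Psi>_def by measurable
    have ip: "integrable lborel (\<lambda>s. complex_of_real (\<phi> s) * cis (- l * s) * \<Psi> s)"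
      by (rule Bochner_Integration.integrable_bound[of _ "\<lambda>s. b * \<bar>\<phi> s\<bar>"])
         (use phi_integrable bd b0 in \<open>auto elim!: eventually_mono\<close>)
    have "cmod (LINT s|lborel. complex_of_real (\<phi> s) * cis (- l * s) * \<Psi> s) \<le> (LINT s|lborel. cmod (complex_of_real (\<phi> s) * cis (- l * s) * \<Psi> s))"
      by (rule integral_norm_bound)
    also have "\<dots> \<le> (LINT s|lborel. b * \<bar>\<phi> s\<bar>)"
      by (rule integral_mono_AE) (use ip phi_integrable bd in auto)
    also have "\<dots> = b * N" by (simp add: N_def)
    finally have "cmod (\<Sum>t\<in>{-K..K}. filt \<phi> \<psi> j t *\<^sub>R cis (- l * of_int t)) \<le> 2 powr (- real j / 2) * (b * N)"
      unfolding eq norm_mult by (intro mult_mono) auto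
    also have "\<dots> = (2 powr (- real j / 2) * a) * (C - 1) * (a * \<bar>l\<bar>) powr - \<alpha>"
      by (simp add: b_def C_def algebra_simps)
    also have "2 powr (- real j / 2) * a = 2 powr (real j / 2)"
      by (simp add: a_def powr_realpow[symmetric] powr_add[symmetric])
    also have "2 powr (real j / 2) * (C - 1) * (a * \<bar>l\<bar>) powr - \<alpha> \<le> 2 powr (real j / 2) * C * (a * \<bar>l\<bar>) powr - \<alpha>"
      by (intro mult_right_mono mult_left_mono) auto
    finally show "cmod (\<Sum>t\<in>{-K..K}. filt \<phi> \<psi> j t *\<^sub>R cis (- l * of_int t)) \<le> C * 2 powr (real j / 2) * (2 ^ j * \<bar>l\<bar>) powr - \<alpha>"
      by (simp add: a_def mult_ac)
  qed
  moreover have "C > 0" unfolding C_def using N c(1) S by (intro add_nonneg_pos) auto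
  ultimately show ?thesis using that by blast
qed

end

section \<open>The filter acting on the differenced process\<close>

lemma bdiff_funpow_cis:
  "(bdiff ^^ p) (\<lambda>t. cis (l * of_int t)) t = (1 - cis (- l)) ^ p * cis (l * of_int t)"
proof (induction p arbitrary: t)
  case (Suc p)
  have "cis (l * of_int (t - 1)) = cis (- l) * cis (l * of_int t)"
    by (simp add: cis_mult algebra_simps)
  then show ?case
    by (simp add: bdiff_def[of "(bdiff ^^ p) x" for x :: "int \<Rightarrow> complex"] Suc algebra_simps)
qed simp

definition transfer :: "(int \<Rightarrow> real) \<Rightarrow> real \<Rightarrow> complex" where
  "transfer g l = (\<Sum>t | g t \<noteq> 0. complex_of_real (g t) * cis (- l * of_int t))"

lemma transfer_window:
  assumes "\<And>t. g t \<noteq> 0 \<Longrightarrow> t \<in> {-K..K}"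
  shows "transfer g l = (\<Sum>t\<in>{-K..K}. g t *\<^sub>R cis (- l * of_int t))"
  unfolding transfer_def scaleR_conv_of_real
  by (rule sum.mono_neutral_left) (use assms in auto)

text \<open>
  Exponentials are eigenfunctions of the difference operator; summation by parts moves it off \<open>g\<close>.
\<close>

lemma transfer_bdiff_funpow:
  assumes "finite {t. g t \<noteq> 0}"
  shows "transfer ((bdiff ^^ p) g) l = (1 - cis (- l)) ^ p * transfer g l"
proof -
  obtain a where a: "\<And>t. \<bar>t\<bar> > a \<Longrightarrow> g t = 0" using finite_supp_bound[OF assms] by metis
  obtain b where b: "\<And>t. \<bar>t\<bar> > b \<Longrightarrow> (bdiff ^^ p) g t = 0"
    using finite_supp_bound[OF finite_supp_bdiff_funpow[OF assms, of p]] by metis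
  define K where "K = max a b"
  have gK: "t \<in> {-K..K}" if "g t \<noteq> 0" for t
  proof -
    have "\<not> \<bar>t\<bar> > a" using a that by blast
    then show ?thesis by (auto simp: K_def)
  qed
  have dK: "t \<in> {-K..K}" if "(bdiff ^^ p) g t \<noteq> 0" for t
  proof -
    have "\<not> \<bar>t\<bar> > b" using b that by blast
    then show ?thesis by (auto simp: K_def)
  qed
  have refl: "(\<Sum>t\<in>{-K..K}. h t) = (\<Sum>t\<in>{-K..K}. h (0 - t))" for h :: "int \<Rightarrow> complex"
    by (rule sum.reindex_bij_witness[of _ uminus uminus]) auto
  have "transfer ((bdiff ^^ p) g) l = (\<Sum>t\<in>{-K..K}. (bdiff ^^ p) g (0 - t) *\<^sub>R cis (l * of_int t))"
    by (subst transfer_window[where K = K], erule dK, subst refl) simp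
  also have "\<dots> = (\<Sum>t\<in>{-K..K}. g (0 - t) *\<^sub>R (bdiff ^^ p) (\<lambda>t. cis (l * of_int t)) t)"
  proof (rule sum_bdiff_funpow[OF assms])
    show "t \<in> {-K..K}" if "(bdiff ^^ p) g (0 - t) \<noteq> 0" for t using dK[OF that] by auto
    show "t \<in> {-K..K}" if "g (0 - t) \<noteq> 0" for t using gK[OF that] by auto
  qed auto
  also have "\<dots> = (1 - cis (- l)) ^ p * (\<Sum>t\<in>{-K..K}. g (0 - t) *\<^sub>R cis (l * of_int t))"
    by (simp add: bdiff_funpow_cis sum_distrib_left mult_ac)
  also have "(\<Sum>t\<in>{-K..K}. g (0 - t) *\<^sub>R cis (l * of_int t)) = transfer g l"
    by (subst transfer_window[where K = K], erule gK, subst (2) refl) simp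
  finally show ?thesis .
qed

lemma transfer_le_sum: "cmod (transfer g l) \<le> (\<Sum>t | g t \<noteq> 0. \<bar>g t\<bar>)"
  unfolding transfer_def by (rule order.trans[OF norm_sum]) (simp add: norm_mult)

context
  fixes \<phi> \<psi> :: "real \<Rightarrow> real" and M :: nat and \<alpha> :: real and p :: nat
  assumes wc: "wavelet_conditions \<phi> \<psi> M \<alpha>" and pM: "p \<le> M"
begin

lemma filt_tilde_unique:
  assumes "finite {t. g t \<noteq> 0}" "(bdiff ^^ p) g = filt \<phi> \<psi> j"
  shows "filt_tilde p \<phi> \<psi> j = g"
  unfolding filt_tilde_def
proof (rule the_equality)
  fix g' assume "finite {t. g' t \<noteq> 0} \<and> (bdiff ^^ p) g' = filt \<phi> \<psi> j"
  then show "g' = g" using assms by (intro bdiff_funpow_inj[of g' g p]) auto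
qed (use assms in auto)

lemma filt_tilde_window:
  assumes supp: "\<And>t. filt \<phi> \<psi> j t \<noteq> 0 \<Longrightarrow> t \<in> {a..b}" and ab: "a \<le> b"
    and B: "\<And>t. \<bar>filt \<phi> \<psi> j t\<bar> \<le> B"
  shows "(bdiff ^^ p) (filt_tilde p \<phi> \<psi> j) = filt \<phi> \<psi> j"
    and "filt_tilde p \<phi> \<psi> j t \<noteq> 0 \<Longrightarrow> t \<in> {a..b}"
    and "\<bar>filt_tilde p \<phi> \<psi> j t\<bar> \<le> of_int (b - a + 1) ^ p * B"
proof -
  obtain g where g: "(bdiff ^^ p) g = filt \<phi> \<psi> j" "\<And>t. t \<notin> {a..b} \<Longrightarrow> g t = 0" "\<And>t. \<bar>g t\<bar> \<le> of_int (b - a + 1) ^ p * B"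
    using exists_bdiff_funpow_primitive[of a b "filt \<phi> \<psi> j" B p] supp B ab
      filt_binomial_moment_zero[OF wc] pM by (metis order.strict_trans2)
  have "finite {t. g t \<noteq> 0}" by (rule finite_subset[of _ "{a..b}"]) (use g(2) in blast, simp)
  then have eq: "filt_tilde p \<phi> \<psi> j = g" using g(1) by (rule filt_tilde_unique)
  show "(bdiff ^^ p) (filt_tilde p \<phi> \<psi> j) = filt \<phi> \<psi> j"
    "filt_tilde p \<phi> \<psi> j t \<noteq> 0 \<Longrightarrow> t \<in> {a..b}"
    "\<bar>filt_tilde p \<phi> \<psi> j t\<bar> \<le> of_int (b - a + 1) ^ p * B"
    unfolding eq using g by auto
qed

text \<open>
  This is why the coefficients only involve differences of the process at the times \<open>1, \<dots>, T\<close>. An empty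
  interval forces the filter to vanish and is treated separately.
\<close>

lemma filt_tilde_subset:
  assumes supp: "\<And>t. filt \<phi> \<psi> j t \<noteq> 0 \<Longrightarrow> t \<in> {a..b}" and "filt_tilde p \<phi> \<psi> j t \<noteq> 0"
  shows "t \<in> {a..b}"
proof (cases "a \<le> b")
  case True
  obtain B where "\<And>j t. \<bar>filt \<phi> \<psi> j t\<bar> \<le> B * 2 powr (- real j / 2)" using filt_bound[OF wc] by metis
  then show ?thesis using filt_tilde_window(2)[OF supp True] assms(2) by blast
next
  case False
  then have z: "filt \<phi> \<psi> j = (\<lambda>t. 0)" using supp by fastforce
  have "(bdiff ^^ p) (\<lambda>t. 0 :: real) = (\<lambda>t. 0)" by (induction p) (auto simp: bdiff_def fun_eq_iff)
  then have "filt_tilde p \<phi> \<psi> j = (\<lambda>t. 0)" using z by (intro filt_tilde_unique) auto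
  then show ?thesis using assms(2) by simp
qed

text \<open>
  The support of \<open>filt\<close> has length \<open>O(2\<^bsup>j\<^esup>)\<close> and its values are \<open>O(2\<^bsup>-j/2\<^esup>)\<close>. Each of the \<open>p\<close> summations costs a factor
  \<open>O(2\<^bsup>j\<^esup>)\<close>, and so does the final sum over the support.
\<close>

lemma filt_tilde_bounds:
  obtains C where "C > 0"
    "\<And>j. finite {t. filt_tilde p \<phi> \<psi> j t \<noteq> 0}"
    "\<And>j. (bdiff ^^ p) (filt_tilde p \<phi> \<psi> j) = filt \<phi> \<psi> j"
    "\<And>j t. filt_tilde p \<phi> \<psi> j t \<noteq> 0 \<Longrightarrow> \<bar>real_of_int t\<bar> \<le> C * 2 ^ j"
    "\<And>j. (\<Sum>t | filt_tilde p \<phi> \<psi> j t \<noteq> 0. \<bar>filt_tilde p \<phi> \<psi> j t\<bar>) \<le> C * 2 powr ((real p + 1/2) * real j)"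
proof -
  obtain R where R: "R \<ge> 1" "\<And>t. \<bar>t\<bar> > R \<Longrightarrow> \<phi> t = 0" "\<And>t. \<bar>t\<bar> > R \<Longrightarrow> \<psi> t = 0" using wavelet_support[OF wc] by metis
  obtain B where B: "B > 0" "\<And>j t. \<bar>filt \<phi> \<psi> j t\<bar> \<le> B * 2 powr (- real j / 2)" using filt_bound[OF wc] by metis
  define K where "K j = \<lceil>R + R * 2 ^ j\<rceil>" for j :: nat
  have K: "R + R * 2 ^ j \<le> real_of_int (K j)" "real_of_int (K j) < R + R * 2 ^ j + 1" for j unfolding K_def by linarith+
  have Rj: "0 \<le> R + R * 2 ^ j" for j using R(1) by (intro add_nonneg_nonneg mult_nonneg_nonneg) auto
  have K0: "0 \<le> K j" for j using K(1)[of j] Rj[of j] by linarith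
  have supp: "t \<in> {- K j..K j}" if "filt \<phi> \<psi> j t \<noteq> 0" for j t
  proof -
    have "\<bar>real_of_int t\<bar> \<le> of_int (K j)" using filt_support[OF wc, where R = R] R(2,3) that K(1)[of j] by (meson order.trans)
    then show ?thesis by (auto simp flip: of_int_abs)
  qed
  have win: "(bdiff ^^ p) (filt_tilde p \<phi> \<psi> j) = filt \<phi> \<psi> j"
    "\<And>t. filt_tilde p \<phi> \<psi> j t \<noteq> 0 \<Longrightarrow> t \<in> {- K j..K j}"
    "\<And>t. \<bar>filt_tilde p \<phi> \<psi> j t\<bar> \<le> of_int (K j - - K j + 1) ^ p * (B * 2 powr (- real j / 2))" for j
  proof -
    have "- K j \<le> K j" using K0[of j] by simp
    note w = filt_tilde_window[where a = "- K j" and b = "K j" and j = j, OF _ this B(2)[of j]]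
    show "(bdiff ^^ p) (filt_tilde p \<phi> \<psi> j) = filt \<phi> \<psi> j" by (rule w(1)) (rule supp)
    show "t \<in> {- K j..K j}" if "filt_tilde p \<phi> \<psi> j t \<noteq> 0" for t by (rule w(2)[OF _ that]) (rule supp)
    show "\<bar>filt_tilde p \<phi> \<psi> j t\<bar> \<le> of_int (K j - - K j + 1) ^ p * (B * 2 powr (- real j / 2))" for t
      by (rule w(3)) (rule supp)
  qed
  note mem = win(2)
  \<comment> \<open>The window \<open>{-K..K}\<close> has at most \<open>2R + 2R2\<^bsup>j\<^esup> + 3\<close> points.\<close>
  define c where "c = 4 * R + 3"
  have j1: "1 \<le> (2::real) ^ j" for j by simp
  have len: "real_of_int (K j - - K j + 1) \<le> c * 2 ^ j" for j
  proof -
    have "2 * R * 1 \<le> 2 * R * 2 ^ j" using R(1) by (intro mult_left_mono j1) auto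
    then have "2 * real_of_int (K j) + 1 \<le> 4 * R * 2 ^ j + 3 * 2 ^ j" using K(2)[of j] j1[of j] by linarith
    then show ?thesis by (simp add: c_def algebra_simps)
  qed
  have len0: "0 \<le> real_of_int (K j - - K j + 1)" for j using K0[of j] by simp
  define C where "C = max c (c ^ Suc p * B)"
  have sum: "(\<Sum>t | filt_tilde p \<phi> \<psi> j t \<noteq> 0. \<bar>filt_tilde p \<phi> \<psi> j t\<bar>) \<le> C * 2 powr ((real p + 1/2) * real j)" for j
  proof -
    let ?n = "real_of_int (K j - - K j + 1)"
    have "(\<Sum>t | filt_tilde p \<phi> \<psi> j t \<noteq> 0. \<bar>filt_tilde p \<phi> \<psi> j t\<bar>) \<le> (\<Sum>t\<in>{- K j..K j}. \<bar>filt_tilde p \<phi> \<psi> j t\<bar>)"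
      by (rule sum_mono2) (use mem in auto)
    also have "\<dots> \<le> (\<Sum>t\<in>{- K j..K j}. ?n ^ p * (B * 2 powr (- real j / 2)))"
      by (intro sum_mono win(3))
    also have "\<dots> = ?n ^ Suc p * (B * 2 powr (- real j / 2))" using K0[of j] by simp
    also have "\<dots> \<le> (c * 2 ^ j) ^ Suc p * (B * 2 powr (- real j / 2))"
      using B(1) by (intro mult_right_mono power_mono len len0) auto
    also have "\<dots> = (c ^ Suc p * B) * ((2 ^ j) ^ Suc p * 2 powr (- real j / 2))"
      by (simp only: power_mult_distrib mult_ac)
    also have "((2::real) ^ j) ^ Suc p * 2 powr (- real j / 2) = 2 powr ((real p + 1/2) * real j)"
      unfolding power_mult[symmetric] by (simp add: powr_realpow[symmetric] powr_add[symmetric] algebra_simps)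
    also have "(c ^ Suc p * B) * 2 powr ((real p + 1/2) * real j) \<le> C * 2 powr ((real p + 1/2) * real j)"
      by (intro mult_right_mono) (auto simp: C_def)
    finally show ?thesis .
  qed
  show ?thesis
  proof (rule that[of C])
    show "C > 0" using R(1) by (auto simp: C_def c_def)
    fix j
    show "finite {t. filt_tilde p \<phi> \<psi> j t \<noteq> 0}" by (rule finite_subset[of _ "{- K j..K j}"]) (use mem in blast, simp)
    show "(bdiff ^^ p) (filt_tilde p \<phi> \<psi> j) = filt \<phi> \<psi> j"
      by (rule win(1))
    show "(\<Sum>t | filt_tilde p \<phi> \<psi> j t \<noteq> 0. \<bar>filt_tilde p \<phi> \<psi> j t\<bar>) \<le> C * 2 powr ((real p + 1/2) * real j)" by (rule sum)
    fix t assume "filt_tilde p \<phi> \<psi> j t \<noteq> 0"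
    from mem[OF this] have "\<bar>real_of_int t\<bar> \<le> of_int (K j)" by (auto simp flip: of_int_abs)
    also have "\<dots> \<le> c * 2 ^ j" using len[of j] K0[of j] by simp
    also have "\<dots> \<le> C * 2 ^ j" by (intro mult_right_mono) (auto simp: C_def)
    finally show "\<bar>real_of_int t\<bar> \<le> C * 2 ^ j" .
  qed
qed

lemma filt_tilde_transfer_decay:
  obtains C where "C > 0"
    "\<And>j l. 0 < \<bar>l\<bar> \<Longrightarrow> \<bar>l\<bar> \<le> pi \<Longrightarrow>
       cmod (1 - cis (- l)) ^ p * cmod (transfer (filt_tilde p \<phi> \<psi> j) l) \<le> C * 2 powr (real j / 2) * (2 ^ j * \<bar>l\<bar>) powr - \<alpha>"
proof -
  obtain C where C: "C > 0"
    "\<And>j l. 0 < \<bar>l\<bar> \<Longrightarrow> \<bar>l\<bar> \<le> pi \<Longrightarrow> \<exists>K0::int. \<forall>K\<ge>K0. cmod (\<Sum>t\<in>{-K..K}. filt \<phi> \<psi> j t *\<^sub>R cis (- l * of_int t)) \<le> C * 2 powr (real j / 2) * (2 ^ j * \<bar>l\<bar>) powr - \<alpha>"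
    using filt_transfer_decay[OF wc] by blast
  have "cmod (1 - cis (- l)) ^ p * cmod (transfer (filt_tilde p \<phi> \<psi> j) l) \<le> C * 2 powr (real j / 2) * (2 ^ j * \<bar>l\<bar>) powr - \<alpha>"
    if l: "0 < \<bar>l\<bar>" "\<bar>l\<bar> \<le> pi" for j l
  proof -
    obtain C' where "finite {t. filt_tilde p \<phi> \<psi> j t \<noteq> 0}" "(bdiff ^^ p) (filt_tilde p \<phi> \<psi> j) = filt \<phi> \<psi> j"
      using filt_tilde_bounds by metis
    note g = this
    from finite_supp_bdiff_funpow[OF g(1), of p] have "finite {t. filt \<phi> \<psi> j t \<noteq> 0}" by (simp only: g(2))
    then obtain a where a: "\<And>t. \<bar>t\<bar> > a \<Longrightarrow> filt \<phi> \<psi> j t = 0" using finite_supp_bound by metis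
    from C(2)[OF l, of j] obtain K0 :: int where
      K0: "\<forall>K\<ge>K0. cmod (\<Sum>t\<in>{-K..K}. filt \<phi> \<psi> j t *\<^sub>R cis (- l * of_int t)) \<le> C * 2 powr (real j / 2) * (2 ^ j * \<bar>l\<bar>) powr - \<alpha>" ..
    define K where "K = max a K0"
    have memK: "t \<in> {-K..K}" if "filt \<phi> \<psi> j t \<noteq> 0" for t
    proof -
      have "\<not> \<bar>t\<bar> > a" using a that by blast
      then show ?thesis by (auto simp: K_def)
    qed
    have "cmod (1 - cis (- l)) ^ p * cmod (transfer (filt_tilde p \<phi> \<psi> j) l) = cmod (transfer (filt \<phi> \<psi> j) l)"
      using transfer_bdiff_funpow[OF g(1), of p l] g(2) by (simp add: norm_mult norm_power)
    also have "\<dots> \<le> C * 2 powr (real j / 2) * (2 ^ j * \<bar>l\<bar>) powr - \<alpha>"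
      by (subst transfer_window[where K = K], erule memK) (use K0 in \<open>simp add: K_def\<close>)
    finally show ?thesis .
  qed
  then show ?thesis using that C(1) by blast
qed

end

section \<open>The variance integral of the tangent coefficients\<close>

text \<open>
  A weak form of Jordan's inequality, from the cubic Taylor bound.
\<close>

lemma sin_ge_half: "0 \<le> x \<Longrightarrow> x \<le> pi / 2 \<Longrightarrow> x / 2 \<le> sin x"
proof -
  assume x: "0 \<le> x" "x \<le> pi / 2"
  have mac: "\<bar>sin x - (\<Sum>m<3. sin_coeff m * x ^ m)\<bar> \<le> inverse (fact 3) * \<bar>x\<bar> ^ 3"
    by (rule Maclaurin_sin_bound)
  have s: "sin x \<ge> x - x ^ 3 / 6"
  proof -
    have "\<bar>sin x - x\<bar> \<le> x ^ 3 / 6"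
      using mac x by (simp add: sin_coeff_def numeral_3_eq_3 fact_numeral field_simps)
    then show ?thesis by linarith
  qed
  have "pi \<le> 3.2" using pi_approx by simp
  then have "x \<le> 1.6" using x by linarith
  then have "x\<^sup>2 \<le> 1.6\<^sup>2" using x by (intro power_mono) auto
  then have "x * x\<^sup>2 \<le> x * 3" using x by (intro mult_left_mono) (auto simp: power2_eq_square)
  then show ?thesis using s by (simp add: power3_eq_cube power2_eq_square)
qed

lemma cmod_one_minus_cis_le: "cmod (1 - cis (- l)) \<le> \<bar>l\<bar>"
  and cmod_one_minus_cis_ge: "\<bar>l\<bar> \<le> pi \<Longrightarrow> \<bar>l\<bar> / 2 \<le> cmod (1 - cis (- l))"
proof -
  have eq: "cmod (1 - cis (- l)) = 2 * \<bar>sin (l / 2)\<bar>"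
  proof -
    have "(cmod (1 - cis (- l)))\<^sup>2 = (1 - cos l)\<^sup>2 + (sin l)\<^sup>2" by (simp add: cmod_power2)
    also have "\<dots> = 2 - 2 * cos l" using sin_cos_squared_add[of l] by (simp add: power2_diff)
    also have "\<dots> = (2 * \<bar>sin (l / 2)\<bar>)\<^sup>2" using cos_double_sin[of "l / 2"] by (simp add: power_mult_distrib)
    finally show ?thesis by (rule power2_eq_imp_eq) auto
  qed
  show "cmod (1 - cis (- l)) \<le> \<bar>l\<bar>"
    using abs_sin_x_le_abs_x[of "l / 2"] by (simp add: eq)
  have "\<bar>sin (l / 2)\<bar> \<ge> \<bar>l\<bar> / 4" if "\<bar>l\<bar> \<le> pi"
    using sin_ge_half[of "l / 2"] sin_ge_half[of "- l / 2"] that by (cases "l \<ge> 0") auto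
  then show "\<bar>l\<bar> / 2 \<le> cmod (1 - cis (- l))" if "\<bar>l\<bar> \<le> pi"
    using that by (simp add: eq)
qed

text \<open>
  The powers of \<open>\<bar>1 - e\<^bsup>-il\<^esup>\<bar>\<close> in the spectral density may be of either sign, which requires both comparisons
  with \<open>\<bar>l\<bar>\<close>.
\<close>

lemma cmod_one_minus_cis_powr_le:
  assumes "0 < \<bar>l\<bar>" "\<bar>l\<bar> \<le> pi"
  shows "cmod (1 - cis (- l)) powr r \<le> 2 powr \<bar>r\<bar> * \<bar>l\<bar> powr r"
proof (cases "r \<ge> 0")
  case True
  have "cmod (1 - cis (- l)) powr r \<le> 1 * \<bar>l\<bar> powr r" using True cmod_one_minus_cis_le by (simp add: powr_mono2)
  also have "\<dots> \<le> 2 powr \<bar>r\<bar> * \<bar>l\<bar> powr r" by (intro mult_right_mono) (auto intro: ge_one_powr_ge_zero)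
  finally show ?thesis .
next
  case False
  have "cmod (1 - cis (- l)) powr r \<le> (\<bar>l\<bar> / 2) powr r"
    using False assms cmod_one_minus_cis_ge[OF assms(2)] by (intro powr_mono2') auto
  also have "\<dots> = 2 powr \<bar>r\<bar> * \<bar>l\<bar> powr r" using False assms by (simp add: powr_divide powr_minus_divide)
  finally show ?thesis .
qed

lemma nn_integral_abs_le:
  fixes h :: "real \<Rightarrow> ennreal"
  assumes [measurable]: "h \<in> borel_measurable borel"
  shows "(\<integral>\<^sup>+x. h \<bar>x\<bar> \<partial>lborel) \<le> 2 * (\<integral>\<^sup>+x. indicator {0..} x * h x \<partial>lborel)"
proof -
  have "(\<integral>\<^sup>+x. h \<bar>x\<bar> \<partial>lborel) \<le> (\<integral>\<^sup>+x. indicator {0..} x * h x + indicator {0..} (- x) * h (- x) \<partial>lborel)"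
    by (intro nn_integral_mono) (auto split: split_indicator simp: abs_if)
  also have "\<dots> = (\<integral>\<^sup>+x. indicator {0..} x * h x \<partial>lborel) + (\<integral>\<^sup>+x. indicator {0..} (- x) * h (- x) \<partial>lborel)"
    by (rule nn_integral_add) auto
  also have "(\<integral>\<^sup>+x. indicator {0..} (- x) * h (- x) \<partial>lborel) = (\<integral>\<^sup>+x. indicator {0..} x * h x \<partial>lborel)"
    by (subst (2) nn_integral_real_affine[of _ "-1" 0]) auto
  finally show ?thesis by (simp add: mult_2)
qed

lemma nn_integral_powr_near_zero:
  assumes "r > -1" "e \<ge> 0"
  shows "(\<integral>\<^sup>+x. indicator {..e} \<bar>x\<bar> * ennreal (\<bar>x\<bar> powr r) \<partial>lborel) \<le> ennreal (2 * (e powr (r + 1) / (r + 1)))"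
proof -
  have "(\<integral>\<^sup>+x. indicator {..e} \<bar>x\<bar> * ennreal (\<bar>x\<bar> powr r) \<partial>lborel) \<le> 2 * (\<integral>\<^sup>+x. indicator {0..} x * (indicator {..e} x * ennreal (x powr r)) \<partial>lborel)"
    by (rule nn_integral_abs_le) auto
  also have "(\<integral>\<^sup>+x. indicator {0..} x * (indicator {..e} x * ennreal (x powr r)) \<partial>lborel) = (\<integral>\<^sup>+x. ennreal (indicator {0..e} x * x powr r) \<partial>lborel)"
    by (intro nn_integral_cong) (auto split: split_indicator)
  also have "\<dots> = ennreal (e powr (r + 1) / (r + 1))"
    using nn_integral_has_integral_lebesgue[OF _ has_integral_powr_from_0[OF assms]] by simp
  also have "2 * ennreal (e powr (r + 1) / (r + 1)) = ennreal (2 * (e powr (r + 1) / (r + 1)))"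
    using assms by (subst ennreal_mult) auto
  finally show ?thesis .
qed

lemma nn_integral_powr_tail:
  assumes "r < -1" "e > 0"
  shows "(\<integral>\<^sup>+x. indicator {e..} \<bar>x\<bar> * ennreal (\<bar>x\<bar> powr r) \<partial>lborel) \<le> ennreal (2 * (- (e powr (r + 1)) / (r + 1)))"
proof -
  have "(\<integral>\<^sup>+x. indicator {e..} \<bar>x\<bar> * ennreal (\<bar>x\<bar> powr r) \<partial>lborel) \<le> 2 * (\<integral>\<^sup>+x. indicator {0..} x * (indicator {e..} x * ennreal (x powr r)) \<partial>lborel)"
    by (rule nn_integral_abs_le) auto
  also have "(\<integral>\<^sup>+x. indicator {0..} x * (indicator {e..} x * ennreal (x powr r)) \<partial>lborel) = (\<integral>\<^sup>+x. ennreal (indicator {e..} x * x powr r) \<partial>lborel)"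
    using assms by (intro nn_integral_cong) (auto split: split_indicator)
  also have "\<dots> = ennreal (- (e powr (r + 1)) / (r + 1))"
    using nn_integral_has_integral_lebesgue[OF _ has_integral_powr_to_inf[OF assms]] by simp
  also have "2 * ennreal (- (e powr (r + 1)) / (r + 1)) = ennreal (2 * (- (e powr (r + 1)) / (r + 1)))"
    using assms by (subst ennreal_mult) (auto intro: divide_nonneg_neg)
  finally show ?thesis .
qed

lemma integrable_freq_powr:
  assumes "r > -1"
  shows "integrable freq (\<lambda>l. \<bar>l\<bar> powr r)"
proof -
  have "integrable lborel (\<lambda>l. indicator {-pi..pi} l *\<^sub>R (\<bar>l\<bar> powr r))"
  proof (rule integrableI_bounded)
    have "(\<integral>\<^sup>+l. ennreal (norm (indicator {-pi..pi} l *\<^sub>R (\<bar>l\<bar> powr r))) \<partial>lborel)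
       = (\<integral>\<^sup>+x. indicator {..pi} \<bar>x\<bar> * ennreal (\<bar>x\<bar> powr r) \<partial>lborel)"
      by (intro nn_integral_cong) (auto split: split_indicator)
    also have "\<dots> < \<infinity>"
      by (rule order.strict_trans1[OF nn_integral_powr_near_zero[OF assms]]) auto
    finally show "(\<integral>\<^sup>+l. ennreal (norm (indicator {-pi..pi} l *\<^sub>R (\<bar>l\<bar> powr r))) \<partial>lborel) < \<infinity>" .
  qed measurable
  then show ?thesis by (simp add: integrable_restrict_space)
qed

text \<open>
  Here \<open>a\<close> is the squared amplitude and \<open>h\<close> the modulus of the transfer function. The integral is split at
  \<open>\<bar>l\<bar> = 2\<^bsup>-j\<^esup>\<close>. Below, \<open>h\<close> is bounded by the total mass and \<open>\<bar>l\<bar>\<^bsup>2p-2d\<^esup>\<close> is integrable at zero. Above, the factor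
  \<open>\<bar>1 - e\<^bsup>-il\<^esup>\<bar>\<^bsup>p\<^esup>\<close> taken from the amplitude turns \<open>h\<close> into the modulus of the transfer function of \<open>filt\<close>,
  which decays, and \<open>\<bar>l\<bar>\<^bsup>-2\<alpha>-2d\<^esup>\<close> is integrable at infinity. Both parts are of order \<open>2\<^bsup>2dj\<^esup>\<close>.
\<close>

lemma weighted_transfer_integral:
  fixes h a :: "real \<Rightarrow> real"
  assumes d: "d < real p + 1/2" "\<alpha> > 1/2 - d"
    and a: "\<And>l. 0 < \<bar>l\<bar> \<Longrightarrow> \<bar>l\<bar> \<le> pi \<Longrightarrow> 0 \<le> a l \<and> a l \<le> F * cmod (1 - cis (- l)) powr (2 * real p - 2 * d)"
    and h: "\<And>l. 0 \<le> h l"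
    and h1: "\<And>l. h l \<le> C * 2 powr ((real p + 1/2) * real j)"
    and h2: "\<And>l. 0 < \<bar>l\<bar> \<Longrightarrow> \<bar>l\<bar> \<le> pi \<Longrightarrow> cmod (1 - cis (- l)) ^ p * h l \<le> C * 2 powr (real j / 2) * (2 ^ j * \<bar>l\<bar>) powr - \<alpha>"
    and F: "F \<ge> 0"
  shows "(\<integral>\<^sup>+l. ennreal (a l * (h l)\<^sup>2) \<partial>freq) \<le>
    ennreal ((2 * C\<^sup>2 * F * (2 powr \<bar>2 * real p - 2 * d\<bar> / (2 * real p - 2 * d + 1) + 2 powr \<bar>- 2 * d\<bar> / (2 * \<alpha> + 2 * d - 1))) * 2 powr (2 * d * real j))"
proof -
  define r where "r = 2 * real p - 2 * d"
  define s where "s = - 2 * \<alpha> - 2 * d"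
  have rs: "r > -1" "s < -1" using d by (auto simp: r_def s_def)
  define e where "e = 2 powr - real j"
  have e: "e > 0" by (simp add: e_def)
  have near: "a l * (h l)\<^sup>2 \<le> (C\<^sup>2 * F * 2 powr \<bar>r\<bar> * 2 powr ((2 * real p + 1) * real j)) * \<bar>l\<bar> powr r"
    if l: "0 < \<bar>l\<bar>" "\<bar>l\<bar> \<le> pi" for l
  proof -
    have "a l \<le> F * (2 powr \<bar>r\<bar> * \<bar>l\<bar> powr r)"
      using a[OF l] mult_left_mono[OF cmod_one_minus_cis_powr_le[OF l, of r] F] unfolding r_def[symmetric] by linarith
    moreover have "(h l)\<^sup>2 \<le> (C * 2 powr ((real p + 1/2) * real j))\<^sup>2"
      using h h1 by (intro power_mono) auto
    moreover have "(2 powr ((real p + 1/2) * real j))\<^sup>2 = 2 powr ((2 * real p + 1) * real j)"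
      by (simp add: power2_eq_square powr_add[symmetric] algebra_simps)
    ultimately have "a l * (h l)\<^sup>2 \<le> (F * (2 powr \<bar>r\<bar> * \<bar>l\<bar> powr r)) * (C\<^sup>2 * 2 powr ((2 * real p + 1) * real j))"
      using F a[OF l] by (intro mult_mono) (auto simp: power_mult_distrib)
    then show ?thesis by (simp add: mult_ac)
  qed
  have far: "a l * (h l)\<^sup>2 \<le> (C\<^sup>2 * F * 2 powr \<bar>- 2 * d\<bar> * 2 powr ((1 - 2 * \<alpha>) * real j)) * \<bar>l\<bar> powr s"
    if l: "0 < \<bar>l\<bar>" "\<bar>l\<bar> \<le> pi" for l
  proof -
    let ?w = "cmod (1 - cis (- l))"
    have w: "?w > 0" using cmod_one_minus_cis_ge[OF l(2)] l(1) by linarith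
    have wr: "?w powr r = ?w powr (- 2 * d) * (?w ^ p)\<^sup>2"
    proof -
      have "(?w ^ p)\<^sup>2 = ?w powr (2 * real p)" using w by (simp add: powr_realpow[symmetric] powr_powr mult.commute power2_eq_square powr_add[symmetric])
      then show ?thesis using w by (simp add: r_def powr_add[symmetric])
    qed
    have "a l * (h l)\<^sup>2 \<le> F * ?w powr r * (h l)\<^sup>2"
      using a[OF l] by (intro mult_right_mono) (auto simp: r_def)
    also have "\<dots> = F * ?w powr (- 2 * d) * (?w ^ p * h l)\<^sup>2" by (simp add: wr power_mult_distrib)
    also have "\<dots> \<le> F * (2 powr \<bar>- 2 * d\<bar> * \<bar>l\<bar> powr (- 2 * d)) * (C * 2 powr (real j / 2) * (2 ^ j * \<bar>l\<bar>) powr - \<alpha>)\<^sup>2"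
      using F h w by (intro mult_mono mult_left_mono power_mono h2[OF l] cmod_one_minus_cis_powr_le[OF l]) auto
    also have "(C * 2 powr (real j / 2) * (2 ^ j * \<bar>l\<bar>) powr - \<alpha>)\<^sup>2 = C\<^sup>2 * (2 powr ((1 - 2 * \<alpha>) * real j) * \<bar>l\<bar> powr (- 2 * \<alpha>))"
      using l by (simp add: power_mult_distrib powr_mult powr_realpow[symmetric] powr_powr power2_eq_square powr_add[symmetric] algebra_simps)
    also have "F * (2 powr \<bar>- 2 * d\<bar> * \<bar>l\<bar> powr (- 2 * d)) * (C\<^sup>2 * (2 powr ((1 - 2 * \<alpha>) * real j) * \<bar>l\<bar> powr (- 2 * \<alpha>)))
      = (C\<^sup>2 * F * 2 powr \<bar>- 2 * d\<bar> * 2 powr ((1 - 2 * \<alpha>) * real j)) * (\<bar>l\<bar> powr (- 2 * d) * \<bar>l\<bar> powr (- 2 * \<alpha>))"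
      by (simp only: mult_ac)
    also have "\<bar>l\<bar> powr (- 2 * d) * \<bar>l\<bar> powr (- 2 * \<alpha>) = \<bar>l\<bar> powr s"
      unfolding powr_add[symmetric] by (rule arg_cong[of _ _ "(powr) \<bar>l\<bar>"]) (simp add: s_def)
    finally show ?thesis .
  qed
  define c1 where "c1 = C\<^sup>2 * F * 2 powr \<bar>r\<bar> * 2 powr ((2 * real p + 1) * real j)"
  define c2 where "c2 = C\<^sup>2 * F * 2 powr \<bar>- 2 * d\<bar> * 2 powr ((1 - 2 * \<alpha>) * real j)"
  have c: "c1 \<ge> 0" "c2 \<ge> 0" using F by (auto simp: c1_def c2_def)
  have "(\<integral>\<^sup>+l. ennreal (a l * (h l)\<^sup>2) \<partial>freq) = (\<integral>\<^sup>+l. ennreal (a l * (h l)\<^sup>2) * indicator {-pi..pi} l \<partial>lborel)"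
    by (simp add: nn_integral_restrict_space)
  also have "\<dots> \<le> (\<integral>\<^sup>+l. ennreal c1 * (indicator {..e} \<bar>l\<bar> * ennreal (\<bar>l\<bar> powr r)) + ennreal c2 * (indicator {e..} \<bar>l\<bar> * ennreal (\<bar>l\<bar> powr s)) \<partial>lborel)"
  proof (rule nn_integral_mono_AE)
    show "AE l in lborel. ennreal (a l * (h l)\<^sup>2) * indicator {-pi..pi} l \<le>
      ennreal c1 * (indicator {..e} \<bar>l\<bar> * ennreal (\<bar>l\<bar> powr r)) + ennreal c2 * (indicator {e..} \<bar>l\<bar> * ennreal (\<bar>l\<bar> powr s))"
      using AE_lborel_singleton[of 0]
    proof eventually_elim
      case (elim l)
      show ?case
      proof (cases "l \<in> {-pi..pi}")
        case True
        then have l: "0 < \<bar>l\<bar>" "\<bar>l\<bar> \<le> pi" using elim by auto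
        show ?thesis
        proof (cases "\<bar>l\<bar> \<le> e")
          case True
          have "ennreal (a l * (h l)\<^sup>2) * indicator {-pi..pi} l \<le> ennreal (c1 * \<bar>l\<bar> powr r)"
            using near[OF l] \<open>l \<in> _\<close> by (simp add: c1_def ennreal_leI)
          also have "\<dots> = ennreal c1 * (indicator {..e} \<bar>l\<bar> * ennreal (\<bar>l\<bar> powr r))"
            using True c by (simp add: ennreal_mult)
          finally show ?thesis by (simp add: add_increasing2)
        next
          case False
          have "ennreal (a l * (h l)\<^sup>2) * indicator {-pi..pi} l \<le> ennreal (c2 * \<bar>l\<bar> powr s)"
            using far[OF l] \<open>l \<in> _\<close> by (simp add: c2_def ennreal_leI)
          also have "\<dots> = ennreal c2 * (indicator {e..} \<bar>l\<bar> * ennreal (\<bar>l\<bar> powr s))"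
            using False c by (simp add: ennreal_mult)
          finally show ?thesis by (simp add: add_increasing)
        qed
      qed simp
    qed
  qed
  also have "\<dots> = ennreal c1 * (\<integral>\<^sup>+l. indicator {..e} \<bar>l\<bar> * ennreal (\<bar>l\<bar> powr r) \<partial>lborel) + ennreal c2 * (\<integral>\<^sup>+l. indicator {e..} \<bar>l\<bar> * ennreal (\<bar>l\<bar> powr s) \<partial>lborel)"
    by (simp add: nn_integral_add nn_integral_cmult)
  also have "\<dots> \<le> ennreal c1 * ennreal (2 * (e powr (r + 1) / (r + 1))) + ennreal c2 * ennreal (2 * (- (e powr (s + 1)) / (s + 1)))"
    using e rs by (intro add_mono mult_left_mono nn_integral_powr_near_zero nn_integral_powr_tail) auto
  also have "\<dots> = ennreal (c1 * (2 * (e powr (r + 1) / (r + 1))) + c2 * (2 * (- (e powr (s + 1)) / (s + 1))))"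
  proof -
    have "ennreal c1 * ennreal x + ennreal c2 * ennreal y = ennreal (c1 * x + c2 * y)" if "x \<ge> 0" "y \<ge> 0" for x y
      using c that by (simp add: ennreal_mult)
    moreover have "0 \<le> 2 * (e powr (r + 1) / (r + 1))" "0 \<le> 2 * (- (e powr (s + 1)) / (s + 1))"
      using rs by (auto intro!: divide_nonneg_pos divide_nonneg_neg)
    ultimately show ?thesis by blast
  qed
  also have "c1 * (2 * (e powr (r + 1) / (r + 1))) + c2 * (2 * (- (e powr (s + 1)) / (s + 1)))
    = (2 * C\<^sup>2 * F * (2 powr \<bar>2 * real p - 2 * d\<bar> / (2 * real p - 2 * d + 1) + 2 powr \<bar>- 2 * d\<bar> / (2 * \<alpha> + 2 * d - 1))) * 2 powr (2 * d * real j)"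
  proof -
    have p1: "2 powr ((2 * real p + 1) * real j) * e powr (r + 1) = 2 powr (2 * d * real j)"
      by (simp add: e_def powr_powr powr_add[symmetric] r_def algebra_simps)
    have p2: "2 powr ((1 - 2 * \<alpha>) * real j) * e powr (s + 1) = 2 powr (2 * d * real j)"
      by (simp add: e_def powr_powr powr_add[symmetric] s_def algebra_simps)
    have "c1 * (2 * (e powr (r + 1) / (r + 1))) = 2 * C\<^sup>2 * F * (2 powr \<bar>r\<bar> / (r + 1)) * (2 powr ((2 * real p + 1) * real j) * e powr (r + 1))"
      by (simp add: c1_def)
    moreover have "c2 * (2 * (- (e powr (s + 1)) / (s + 1))) = 2 * C\<^sup>2 * F * (2 powr \<bar>- 2 * d\<bar> / (- s - 1)) * (2 powr ((1 - 2 * \<alpha>) * real j) * e powr (s + 1))"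
    proof -
      have "- x / (s + 1) = x / (- s - 1)" for x using rs by (simp add: divide_simps) (simp add: algebra_simps)
      then show ?thesis by (simp add: c2_def)
    qed
    ultimately show ?thesis unfolding p1 p2 by (simp add: r_def s_def algebra_simps)
  qed
  finally show ?thesis .
qed

section \<open>Second moment of a difference of scalograms\<close>

lemma integrable_between:
  fixes f g :: "'a \<Rightarrow> real"
  assumes "integrable P g" "f \<in> borel_measurable P" "\<And>x. 0 \<le> f x" "\<And>x. f x \<le> g x"
  shows "integrable P f"
proof (rule Bochner_Integration.integrable_bound[OF assms(1,2)])
  have "norm (f x) \<le> norm (g x)" for x
    unfolding real_norm_def using assms(3,4)[of x] by linarith
  then show "AE x in P. norm (f x) \<le> norm (g x)" by simp
qed

text \<open>
  The Cauchy-Schwarz inequality with weights \<open>\<gamma>(k) a(k)\<close>, applied to \<open>G\<^sub>k / a(k)\<close>. It takes the role of Minkowski's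
  inequality in \<open>L\<^sup>2\<close>.
\<close>

lemma weighted_sum_second_moment:
  fixes \<gamma> a :: "nat \<Rightarrow> real" and G :: "nat \<Rightarrow> 'a \<Rightarrow> real"
  assumes \<gamma>: "\<And>k. k < n \<Longrightarrow> \<gamma> k \<ge> 0" and a: "\<And>k. k < n \<Longrightarrow> a k > 0"
    and G[measurable]: "\<And>k. k < n \<Longrightarrow> G k \<in> borel_measurable P"
    and G2: "\<And>k. k < n \<Longrightarrow> integrable P (\<lambda>\<omega>. (G k \<omega>)\<^sup>2)" "\<And>k. k < n \<Longrightarrow> (LINT \<omega>|P. (G k \<omega>)\<^sup>2) \<le> (a k)\<^sup>2"
  shows "integrable P (\<lambda>\<omega>. (\<Sum>k<n. \<gamma> k * G k \<omega>)\<^sup>2)"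
    and "(LINT \<omega>|P. (\<Sum>k<n. \<gamma> k * G k \<omega>)\<^sup>2) \<le> (\<Sum>k<n. \<gamma> k * a k)\<^sup>2"
proof -
  let ?R = "\<lambda>\<omega>. (\<Sum>k<n. \<gamma> k * a k) * (\<Sum>k<n. \<gamma> k / a k * (G k \<omega>)\<^sup>2)"
  have pw: "(\<Sum>k<n. \<gamma> k * G k \<omega>)\<^sup>2 \<le> ?R \<omega>" for \<omega>
  proof -
    have "(\<Sum>k<n. \<gamma> k * G k \<omega>) = (\<Sum>k<n. sqrt (\<gamma> k * a k) * (sqrt (\<gamma> k / a k) * G k \<omega>))"
    proof (intro sum.cong refl)
      fix k assume "k \<in> {..<n}"
      then have "sqrt (\<gamma> k * a k) * sqrt (\<gamma> k / a k) = \<gamma> k"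
        using \<gamma>[of k] a[of k] by (simp add: real_sqrt_mult[symmetric])
      then show "\<gamma> k * G k \<omega> = sqrt (\<gamma> k * a k) * (sqrt (\<gamma> k / a k) * G k \<omega>)"
        by (simp add: mult.assoc[symmetric])
    qed
    then have "(\<Sum>k<n. \<gamma> k * G k \<omega>)\<^sup>2 \<le> (\<Sum>k<n. (sqrt (\<gamma> k * a k))\<^sup>2) * (\<Sum>k<n. (sqrt (\<gamma> k / a k) * G k \<omega>)\<^sup>2)"
      by (simp only:) (rule Cauchy_Schwarz_ineq_sum)
    also have "\<dots> = ?R \<omega>"
    proof (rule arg_cong2[where f = "(*)"]; intro sum.cong refl)
      fix k assume k: "k \<in> {..<n}"
      then show "(sqrt (\<gamma> k * a k))\<^sup>2 = \<gamma> k * a k" using \<gamma>[of k] a[of k] by simp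
      show "(sqrt (\<gamma> k / a k) * G k \<omega>)\<^sup>2 = \<gamma> k / a k * (G k \<omega>)\<^sup>2"
        using \<gamma>[of k] a[of k] k by (simp add: power_mult_distrib)
    qed
    finally show ?thesis .
  qed
  have R: "integrable P ?R" using G2(1) by (intro integrable_mult_right Bochner_Integration.integrable_sum) auto
  show i: "integrable P (\<lambda>\<omega>. (\<Sum>k<n. \<gamma> k * G k \<omega>)\<^sup>2)"
    by (rule integrable_between[OF R _ _ pw]) auto
  have "(LINT \<omega>|P. (\<Sum>k<n. \<gamma> k * G k \<omega>)\<^sup>2) \<le> (LINT \<omega>|P. ?R \<omega>)"
    by (rule integral_mono[OF i R pw])
  also have "\<dots> = (\<Sum>k<n. \<gamma> k * a k) * (\<Sum>k<n. \<gamma> k / a k * (LINT \<omega>|P. (G k \<omega>)\<^sup>2))"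
    using G2(1) by (subst integral_mult_right_zero, subst Bochner_Integration.integral_sum) auto
  also have "\<dots> \<le> (\<Sum>k<n. \<gamma> k * a k) * (\<Sum>k<n. \<gamma> k / a k * (a k)\<^sup>2)"
    using \<gamma> a G2(2) by (intro mult_left_mono sum_mono sum_nonneg) (auto simp: less_imp_le intro!: divide_right_mono mult_left_mono)
  also have "(\<Sum>k<n. \<gamma> k / a k * (a k)\<^sup>2) = (\<Sum>k<n. \<gamma> k * a k)"
    using a by (intro sum.cong) (auto simp: power2_eq_square)
  finally show "(LINT \<omega>|P. (\<Sum>k<n. \<gamma> k * G k \<omega>)\<^sup>2) \<le> (\<Sum>k<n. \<gamma> k * a k)\<^sup>2"
    by (simp add: power2_eq_square)
qed

definition L4_norm_le :: "'a measure \<Rightarrow> ('a \<Rightarrow> real) \<Rightarrow> real \<Rightarrow> bool" where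
  "L4_norm_le P W s \<longleftrightarrow> W \<in> borel_measurable P \<and> integrable P (\<lambda>\<omega>. W \<omega> ^ 4) \<and> (LINT \<omega>|P. W \<omega> ^ 4) \<le> s ^ 4"

text \<open>
  The weights \<open>s/m\<close> and \<open>m/s\<close> balance the two terms in \<open>2xy \<le> x\<^sup>2 + y\<^sup>2\<close>, so that the result is as sharp as
  the Cauchy-Schwarz inequality.
\<close>

lemma product_second_moment:
  assumes "L4_norm_le P D m" "L4_norm_le P W s" and pos: "m > 0" "s > 0"
  shows "integrable P (\<lambda>\<omega>. (D \<omega> * W \<omega>)\<^sup>2)" "(LINT \<omega>|P. (D \<omega> * W \<omega>)\<^sup>2) \<le> (m * s)\<^sup>2"
proof -
  have [measurable]: "D \<in> borel_measurable P" "W \<in> borel_measurable P"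
    and D: "integrable P (\<lambda>\<omega>. D \<omega> ^ 4)" "(LINT \<omega>|P. D \<omega> ^ 4) \<le> m ^ 4"
    and W: "integrable P (\<lambda>\<omega>. W \<omega> ^ 4)" "(LINT \<omega>|P. W \<omega> ^ 4) \<le> s ^ 4"
    using assms(1,2) by (auto simp: L4_norm_le_def)
  let ?R = "\<lambda>\<omega>. (s\<^sup>2 / m\<^sup>2) / 2 * D \<omega> ^ 4 + (m\<^sup>2 / s\<^sup>2) / 2 * W \<omega> ^ 4"
  have pw: "(D \<omega> * W \<omega>)\<^sup>2 \<le> ?R \<omega>" for \<omega>
  proof -
    have "2 * (s / m * (D \<omega>)\<^sup>2) * (m / s * (W \<omega>)\<^sup>2) \<le> (s / m * (D \<omega>)\<^sup>2)\<^sup>2 + (m / s * (W \<omega>)\<^sup>2)\<^sup>2"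
      by (rule sum_squares_bound)
    moreover have "2 * (s / m * (D \<omega>)\<^sup>2) * (m / s * (W \<omega>)\<^sup>2) = 2 * (D \<omega> * W \<omega>)\<^sup>2"
      using pos by (simp add: field_simps power_mult_distrib)
    moreover have "(s / m * (D \<omega>)\<^sup>2)\<^sup>2 + (m / s * (W \<omega>)\<^sup>2)\<^sup>2 = 2 * ?R \<omega>"
      by (simp add: power_mult_distrib power_divide)
    ultimately show ?thesis by simp
  qed
  have R: "integrable P ?R" using D(1) W(1) by simp
  show i: "integrable P (\<lambda>\<omega>. (D \<omega> * W \<omega>)\<^sup>2)"
    by (rule integrable_between[OF R _ _ pw]) auto
  have "(LINT \<omega>|P. (D \<omega> * W \<omega>)\<^sup>2) \<le> (LINT \<omega>|P. ?R \<omega>)" by (rule integral_mono[OF i R pw])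
  also have "\<dots> = (s\<^sup>2 / m\<^sup>2) / 2 * (LINT \<omega>|P. D \<omega> ^ 4) + (m\<^sup>2 / s\<^sup>2) / 2 * (LINT \<omega>|P. W \<omega> ^ 4)"
    using D(1) W(1) by simp
  also have "\<dots> \<le> (s\<^sup>2 / m\<^sup>2) / 2 * m ^ 4 + (m\<^sup>2 / s\<^sup>2) / 2 * s ^ 4"
    by (intro add_mono mult_left_mono D W) auto
  also have "\<dots> = (m * s)\<^sup>2" using pos by (simp add: power2_eq_square power4_eq_xxxx field_simps)
  finally show "(LINT \<omega>|P. (D \<omega> * W \<omega>)\<^sup>2) \<le> (m * s)\<^sup>2" .
qed

text \<open>
  From \<open>V\<^sup>2 - W\<^sup>2 = (V - W)\<^sup>2 + 2(V - W)W\<close>.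
\<close>

lemma scalogram_difference_second_moment:
  fixes V W :: "nat \<Rightarrow> 'a \<Rightarrow> real"
  assumes \<gamma>: "\<And>k. k < n \<Longrightarrow> \<gamma> k \<ge> 0" and pos: "\<And>k. k < n \<Longrightarrow> m k > 0" "\<And>k. k < n \<Longrightarrow> s > 0"
    and D: "\<And>k. k < n \<Longrightarrow> L4_norm_le P (\<lambda>\<omega>. V k \<omega> - W k \<omega>) (m k)"
    and W: "\<And>k. k < n \<Longrightarrow> L4_norm_le P (W k) s"
  shows "integrable P (\<lambda>\<omega>. (scalogram n \<gamma> V \<omega> - scalogram n \<gamma> W \<omega>)\<^sup>2)"
    and "(LINT \<omega>|P. (scalogram n \<gamma> V \<omega> - scalogram n \<gamma> W \<omega>)\<^sup>2) \<le> 2 * (\<Sum>k<n. \<gamma> k * (m k)\<^sup>2)\<^sup>2 + 8 * s\<^sup>2 * (\<Sum>k<n. \<gamma> k * m k)\<^sup>2"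
proof -
  let ?A = "\<lambda>\<omega>. \<Sum>k<n. \<gamma> k * (V k \<omega> - W k \<omega>)\<^sup>2"
  let ?B = "\<lambda>\<omega>. \<Sum>k<n. \<gamma> k * ((V k \<omega> - W k \<omega>) * W k \<omega>)"
  have p4: "(x\<^sup>2)\<^sup>2 = x ^ 4" for x :: real by simp
  have meas: "(\<lambda>\<omega>. V k \<omega> - W k \<omega>) \<in> borel_measurable P" "W k \<in> borel_measurable P"
    and D4: "integrable P (\<lambda>\<omega>. (V k \<omega> - W k \<omega>) ^ 4)" "(LINT \<omega>|P. (V k \<omega> - W k \<omega>) ^ 4) \<le> m k ^ 4"
    if "k < n" for k
    using D[OF that] W[OF that] by (auto simp: L4_norm_le_def)
  have DW: "integrable P (\<lambda>\<omega>. ((V k \<omega> - W k \<omega>) * W k \<omega>)\<^sup>2)"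
    "(LINT \<omega>|P. ((V k \<omega> - W k \<omega>) * W k \<omega>)\<^sup>2) \<le> (m k * s)\<^sup>2" if "k < n" for k
    using product_second_moment[OF D W pos] that by auto
  note wA = weighted_sum_second_moment[where n = n and \<gamma> = \<gamma> and P = P and a = "\<lambda>k. (m k)\<^sup>2" and G = "\<lambda>k \<omega>. (V k \<omega> - W k \<omega>)\<^sup>2", unfolded p4]
  note wB = weighted_sum_second_moment[where n = n and \<gamma> = \<gamma> and P = P and a = "\<lambda>k. m k * s" and G = "\<lambda>k \<omega>. (V k \<omega> - W k \<omega>) * W k \<omega>"]
  have pA: "(m k)\<^sup>2 > 0" "(\<lambda>\<omega>. (V k \<omega> - W k \<omega>)\<^sup>2) \<in> borel_measurable P" if "k < n" for k
    using pos(1)[OF that] meas(1)[OF that] by (auto intro: borel_measurable_power)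
  have pB: "m k * s > 0" "(\<lambda>\<omega>. (V k \<omega> - W k \<omega>) * W k \<omega>) \<in> borel_measurable P" if "k < n" for k
    using pos[OF that] meas[OF that] by (auto intro: borel_measurable_times)
  have A: "integrable P (\<lambda>\<omega>. (?A \<omega>)\<^sup>2)" "(LINT \<omega>|P. (?A \<omega>)\<^sup>2) \<le> (\<Sum>k<n. \<gamma> k * (m k)\<^sup>2)\<^sup>2"
    by (rule wA; fact \<gamma> pA D4)+
  have B: "integrable P (\<lambda>\<omega>. (?B \<omega>)\<^sup>2)" "(LINT \<omega>|P. (?B \<omega>)\<^sup>2) \<le> (\<Sum>k<n. \<gamma> k * (m k * s))\<^sup>2"
    by (rule wB; fact \<gamma> pB DW)+
  have eq: "scalogram n \<gamma> V \<omega> - scalogram n \<gamma> W \<omega> = ?A \<omega> + 2 * ?B \<omega>" for \<omega>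
    unfolding scalogram_def sum_subtractf[symmetric] sum_distrib_left sum.distrib[symmetric]
    by (rule sum.cong) (auto simp: power2_eq_square algebra_simps)
  have pw: "(scalogram n \<gamma> V \<omega> - scalogram n \<gamma> W \<omega>)\<^sup>2 \<le> 2 * (?A \<omega>)\<^sup>2 + 8 * (?B \<omega>)\<^sup>2" for \<omega>
    unfolding eq using sum_squares_bound[of "?A \<omega>" "2 * ?B \<omega>"] by (simp add: power2_sum power_mult_distrib)
  have Ri: "integrable P (\<lambda>\<omega>. 2 * (?A \<omega>)\<^sup>2 + 8 * (?B \<omega>)\<^sup>2)" using A B by simp
  have m: "(\<lambda>\<omega>. (scalogram n \<gamma> V \<omega> - scalogram n \<gamma> W \<omega>)\<^sup>2) \<in> borel_measurable P"
    unfolding eq using meas by (intro borel_measurable_power borel_measurable_add borel_measurable_times borel_measurable_sum) auto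
  show i: "integrable P (\<lambda>\<omega>. (scalogram n \<gamma> V \<omega> - scalogram n \<gamma> W \<omega>)\<^sup>2)"
    by (rule integrable_between[OF Ri m _ pw]) auto
  have "(LINT \<omega>|P. (scalogram n \<gamma> V \<omega> - scalogram n \<gamma> W \<omega>)\<^sup>2) \<le> (LINT \<omega>|P. 2 * (?A \<omega>)\<^sup>2 + 8 * (?B \<omega>)\<^sup>2)"
    by (rule integral_mono[OF i Ri pw])
  also have "\<dots> = 2 * (LINT \<omega>|P. (?A \<omega>)\<^sup>2) + 8 * (LINT \<omega>|P. (?B \<omega>)\<^sup>2)" using A B by simp
  also have "\<dots> \<le> 2 * (\<Sum>k<n. \<gamma> k * (m k)\<^sup>2)\<^sup>2 + 8 * (\<Sum>k<n. \<gamma> k * (m k * s))\<^sup>2"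
    using A B by (intro add_mono mult_left_mono) auto
  also have "(\<Sum>k<n. \<gamma> k * (m k * s)) = s * (\<Sum>k<n. \<gamma> k * m k)" by (simp add: sum_distrib_left mult_ac)
  finally show "(LINT \<omega>|P. (scalogram n \<gamma> V \<omega> - scalogram n \<gamma> W \<omega>)\<^sup>2) \<le> 2 * (\<Sum>k<n. \<gamma> k * (m k)\<^sup>2)\<^sup>2 + 8 * s\<^sup>2 * (\<Sum>k<n. \<gamma> k * m k)\<^sup>2"
    by (simp add: power_mult_distrib)
qed

section \<open>Size of the wavelet coefficients\<close>

text \<open>
  The short memory factor is bounded on \<open>[-\<pi>, \<pi>]\<close> by its Hoelder condition at zero.
\<close>

lemma local_memory_amplitude_bound:
  assumes "local_memory p A u d"
  obtains F where "F \<ge> 0" "\<And>l. 0 < \<bar>l\<bar> \<Longrightarrow> \<bar>l\<bar> \<le> pi \<Longrightarrow> (cmod (A u l))\<^sup>2 \<le> F * cmod (1 - cis (- l)) powr (2 * real p - 2 * d)"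
proof -
  obtain fs C \<beta> where f: "C > 0" "0 < \<beta>" "fs 0 > 0"
    "\<And>l. l \<in> {-pi..pi} - {0} \<Longrightarrow> local_spectral_density p A u l = cmod (1 - cis (-l)) powr (- 2 * d) * fs l"
    "\<And>l. l \<in> {-pi..pi} \<Longrightarrow> \<bar>fs l - fs 0\<bar> \<le> C * fs 0 * \<bar>l\<bar> powr \<beta>"
    using assms unfolding local_memory_def by blast
  define F where "F = fs 0 + C * fs 0 * pi powr \<beta>"
  have "(cmod (A u l))\<^sup>2 \<le> F * cmod (1 - cis (- l)) powr (2 * real p - 2 * d)" if l: "0 < \<bar>l\<bar>" "\<bar>l\<bar> \<le> pi" for l
  proof -
    let ?w = "cmod (1 - cis (- l))"
    have mem: "l \<in> {-pi..pi} - {0}" using l by auto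
    have w: "?w > 0" using cmod_one_minus_cis_ge[OF l(2)] l(1) by linarith
    have "?w powr (- 2 * real p) * (cmod (A u l))\<^sup>2 = ?w powr (- 2 * d) * fs l"
      using f(4)[OF mem] by (simp add: local_spectral_density_def)
    then have "?w powr (2 * real p) * (?w powr (- 2 * real p) * (cmod (A u l))\<^sup>2) = ?w powr (2 * real p) * (?w powr (- 2 * d) * fs l)"
      by simp
    then have "(cmod (A u l))\<^sup>2 = ?w powr (2 * real p - 2 * d) * fs l"
      using w by (simp add: mult.assoc[symmetric] powr_add[symmetric])
    also have "\<dots> \<le> ?w powr (2 * real p - 2 * d) * F"
    proof (rule mult_left_mono)
      have "fs l \<le> fs 0 + C * fs 0 * \<bar>l\<bar> powr \<beta>" using f(5)[of l] mem by auto
      also have "\<dots> \<le> F" unfolding F_def using f l by (intro add_left_mono mult_left_mono powr_mono2) auto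
      finally show "fs l \<le> F" .
    qed simp
    finally show ?thesis by (simp add: mult.commute)
  qed
  moreover have "F \<ge> 0" unfolding F_def using f by simp
  ultimately show ?thesis using that by blast
qed

text \<open>
  The constant is at least 1 and hence bounded by its own fourth power, which allows it to be moved
  out of the norm unchanged.
\<close>

lemma spectral_integral_L4_norm:
  assumes "prob_space P" "model_assumption P Z \<epsilon> X p A0 A u d"
  obtains K where "K > 0"
    "\<And>f W B. has_spectral_integral P Z f (\<lambda>\<omega>. complex_of_real (W \<omega>)) \<Longrightarrow> B \<ge> 0 \<Longrightarrow> sqnorm freq f \<le> B\<^sup>2 \<Longrightarrow>
      L4_norm_le P W (K * B)"
proof -
  obtain \<kappa> where k: "orthogonal_increments P Z" "bounded (\<kappa> ` ({-pi..pi} \<times> {-pi..pi} \<times> {-pi..pi}))" "fourth_cumulant_density P Z \<kappa>"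
    using assms(2) unfolding model_assumption_def by blast
  then obtain b where b: "\<And>w. w \<in> {-pi..pi} \<times> {-pi..pi} \<times> {-pi..pi} \<Longrightarrow> cmod (\<kappa> w) \<le> b"
    unfolding bounded_iff by blast
  have "cmod (\<kappa> (0, 0, 0)) \<le> b" by (rule b) simp
  then have b0: "b \<ge> 0" using norm_ge_zero order.trans by blast
  define K where "K = 128 * pi * b + 512"
  have K1: "K \<ge> 1" using b0 by (simp add: K_def add_increasing)
  have "L4_norm_le P W (K * B)"
    if f: "has_spectral_integral P Z f (\<lambda>\<omega>. complex_of_real (W \<omega>))" and B: "B \<ge> 0" "sqnorm freq f \<le> B\<^sup>2" for f W B
  proof -
    note m = spectral_integral_fourth_moment[OF assms(1) k(1,3) b b0 f, folded K_def]
    have "(LINT \<omega>|P. W \<omega> ^ 4) \<le> K * (sqnorm freq f)\<^sup>2" by (rule m(3))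
    also have "\<dots> \<le> K ^ 4 * (B\<^sup>2)\<^sup>2"
      using K1 B(2) by (intro mult_mono power_mono self_le_power) auto
    finally show ?thesis using m(1,2) by (simp add: L4_norm_le_def power_mult_distrib)
  qed
  then show ?thesis using that[of K] K1 by simp
qed

text \<open>
  The spectral function of a tangent coefficient is \<open>A(u, l)\<close> times the transfer function, up to a
  unimodular factor that contains the position \<open>k\<close>. The bound therefore does not depend on \<open>k\<close>.
\<close>

lemma tangent_coeff_L4_norm:
  assumes P: "prob_space P" and mod: "model_assumption P Z \<epsilon> X p A0 A u d"
    and tan: "tangent_differences P Z A u Y" and wc: "wavelet_conditions \<phi> \<psi> M \<alpha>" and pM: "p \<le> M"
    and d: "d < real p + 1/2" "\<alpha> > 1/2 - d"
  obtains c where "c > 0"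
    "\<And>j k. L4_norm_le P (tangent_coeff p \<phi> \<psi> Y j k) (c * 2 powr (d * real j))"
proof -
  obtain K where K: "K > 0"
    "\<And>f W B. has_spectral_integral P Z f (\<lambda>\<omega>. complex_of_real (W \<omega>)) \<Longrightarrow> B \<ge> 0 \<Longrightarrow> sqnorm freq f \<le> B\<^sup>2 \<Longrightarrow>
      L4_norm_le P W (K * B)"
    using spectral_integral_L4_norm[OF P mod] by blast
  have Z: "orthogonal_increments P Z" and lm: "local_memory p A u d" using mod by (auto simp: model_assumption_def)
  obtain F where F: "F \<ge> 0" "\<And>l. 0 < \<bar>l\<bar> \<Longrightarrow> \<bar>l\<bar> \<le> pi \<Longrightarrow> (cmod (A u l))\<^sup>2 \<le> F * cmod (1 - cis (- l)) powr (2 * real p - 2 * d)"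
    using local_memory_amplitude_bound[OF lm] by blast
  obtain C1 where C1: "C1 > 0" "\<And>j. finite {t. filt_tilde p \<phi> \<psi> j t \<noteq> 0}"
    "\<And>j. (\<Sum>t | filt_tilde p \<phi> \<psi> j t \<noteq> 0. \<bar>filt_tilde p \<phi> \<psi> j t\<bar>) \<le> C1 * 2 powr ((real p + 1/2) * real j)"
    using filt_tilde_bounds[OF wc pM] by metis
  obtain C2 where C2: "C2 > 0" "\<And>j l. 0 < \<bar>l\<bar> \<Longrightarrow> \<bar>l\<bar> \<le> pi \<Longrightarrow>
       cmod (1 - cis (- l)) ^ p * cmod (transfer (filt_tilde p \<phi> \<psi> j) l) \<le> C2 * 2 powr (real j / 2) * (2 ^ j * \<bar>l\<bar>) powr - \<alpha>"
    using filt_tilde_transfer_decay[OF wc pM] by blast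
  define C where "C = max C1 C2"
  define Q where "Q = 2 * C\<^sup>2 * F * (2 powr \<bar>2 * real p - 2 * d\<bar> / (2 * real p - 2 * d + 1) + 2 powr \<bar>- 2 * d\<bar> / (2 * \<alpha> + 2 * d - 1))"
  have "0 \<le> 2 * real p - 2 * d + 1" "0 \<le> 2 * \<alpha> + 2 * d - 1" using d by auto
  then have Q0: "Q \<ge> 0" unfolding Q_def using F(1) by simp
  define c where "c = K * sqrt (Q + 1)"
  have "L4_norm_le P (tangent_coeff p \<phi> \<psi> Y j k) (c * 2 powr (d * real j))" for j k
  proof -
    define g where "g = filt_tilde p \<phi> \<psi> j"
    define m where "m = 2 ^ j * int k"
    define f where "f l = (\<Sum>t | g (m - t) \<noteq> 0. complex_of_real (g (m - t)) * (A u l * cis (l * of_int t)))" for l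
    have "has_spectral_integral P Z f (\<lambda>\<omega>. \<Sum>t | g (m - t) \<noteq> 0. complex_of_real (g (m - t)) * complex_of_real (Y t \<omega>))"
      unfolding f_def by (rule has_spectral_integral_sum[OF Z]) (use tan in \<open>simp add: tangent_differences_def\<close>)
    then have f: "has_spectral_integral P Z f (\<lambda>\<omega>. complex_of_real (tangent_coeff p \<phi> \<psi> Y j k \<omega>))"
      by (simp add: tangent_coeff_def g_def m_def)
    have fl: "f l = A u l * cis (l * of_int m) * transfer g l" for l
    proof -
      have "f l = (\<Sum>t | g t \<noteq> 0. complex_of_real (g t) * (A u l * cis (l * of_int (m - t))))"
        unfolding f_def by (rule sum.reindex_bij_witness[of _ "\<lambda>t. m - t" "\<lambda>t. m - t"]) auto
      also have "\<dots> = A u l * cis (l * of_int m) * transfer g l"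
        unfolding transfer_def sum_distrib_left
      proof (intro sum.cong refl)
        fix t
        have "cis (l * of_int (m - t)) = cis (l * of_int m) * cis (- l * of_int t)" by (simp add: cis_mult algebra_simps)
        then show "complex_of_real (g t) * (A u l * cis (l * of_int (m - t))) = A u l * cis (l * of_int m) * (complex_of_real (g t) * cis (- l * of_int t))"
          by (simp add: mult_ac)
      qed
      finally show ?thesis .
    qed
    have fsq: "(cmod (f l))\<^sup>2 = (cmod (A u l))\<^sup>2 * (cmod (transfer g l))\<^sup>2" for l
      by (simp add: fl norm_mult power_mult_distrib)
    have "ennreal (sqnorm freq f) = (\<integral>\<^sup>+l. ennreal ((cmod (f l))\<^sup>2) \<partial>freq)"
      using f by (subst nn_integral_eq_integral) (auto simp: has_spectral_integral_iff sq_integrable_def)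
    also have "\<dots> \<le> ennreal (Q * 2 powr (2 * d * real j))"
      unfolding fsq Q_def
    proof (rule weighted_transfer_integral[OF d])
      fix l
      show "cmod (transfer g l) \<le> C * 2 powr ((real p + 1/2) * real j)"
      proof -
        have "cmod (transfer g l) \<le> C1 * 2 powr ((real p + 1/2) * real j)"
          using order.trans[OF transfer_le_sum C1(3)] by (simp add: g_def)
        also have "\<dots> \<le> C * 2 powr ((real p + 1/2) * real j)" by (intro mult_right_mono) (auto simp: C_def)
        finally show ?thesis .
      qed
      assume l: "0 < \<bar>l\<bar>" "\<bar>l\<bar> \<le> pi"
      show "0 \<le> (cmod (A u l))\<^sup>2 \<and> (cmod (A u l))\<^sup>2 \<le> F * cmod (1 - cis (- l)) powr (2 * real p - 2 * d)"
        using F(2)[OF l] by simp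
      have "cmod (1 - cis (- l)) ^ p * cmod (transfer g l) \<le> C2 * 2 powr (real j / 2) * (2 ^ j * \<bar>l\<bar>) powr - \<alpha>"
        using C2(2)[OF l, of j] by (simp add: g_def)
      also have "\<dots> \<le> C * 2 powr (real j / 2) * (2 ^ j * \<bar>l\<bar>) powr - \<alpha>" by (intro mult_right_mono) (auto simp: C_def)
      finally show "cmod (1 - cis (- l)) ^ p * cmod (transfer g l) \<le> C * 2 powr (real j / 2) * (2 ^ j * \<bar>l\<bar>) powr - \<alpha>" .
    qed (use F(1) in auto)
    finally have "sqnorm freq f \<le> Q * 2 powr (2 * d * real j)"
      using Q0 by (simp add: ennreal_le_iff)
    also have "\<dots> \<le> (Q + 1) * 2 powr (2 * d * real j)" by (intro mult_right_mono) auto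
    also have "\<dots> = (sqrt (Q + 1) * 2 powr (d * real j))\<^sup>2"
    proof -
      have "(2 powr (d * real j))\<^sup>2 = 2 powr (2 * d * real j)" by (simp add: power2_eq_square powr_add[symmetric] mult.assoc)
      then show ?thesis using Q0 by (simp add: power_mult_distrib)
    qed
    finally have "L4_norm_le P (tangent_coeff p \<phi> \<psi> Y j k) (K * (sqrt (Q + 1) * 2 powr (d * real j)))"
      using Q0 by (intro K(2)[OF f]) auto
    then show ?thesis by (simp add: c_def mult.assoc)
  qed
  moreover have "c > 0" using K(1) Q0 by (simp add: c_def)
  ultimately show ?thesis using that by blast
qed

text \<open>
  Both coefficients are written with the filter \<open>filt_tilde\<close> acting on \<open>p\<close>-th differences. Their spectral
  functions then differ by a sum of amplitude differences at times \<open>t\<close> with \<open>\<bar>t - 2\<^bsup>j\<^esup>k\<bar> = O(2\<^bsup>j\<^esup>)\<close>. One power of \<open>2\<^bsup>j\<^esup>\<close>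
  comes from \<open>\<bar>t - Tu\<bar>\<close> and the rest from the mass of the filter.
\<close>

lemma coeff_difference_L4_norm:
  assumes P: "prob_space P" and mod: "model_assumption P Z \<epsilon> X p A0 A u d" and u: "u \<in> {0..1}"
    and tan: "tangent_differences P Z A u Y" and wc: "wavelet_conditions \<phi> \<psi> M \<alpha>" and pM: "p \<le> M"
    and av: "available_coeffs \<phi> \<psi> N"
  obtains c where "c > 0"
    "\<And>j T k. T \<ge> 1 \<Longrightarrow> k < N j T \<Longrightarrow>
      L4_norm_le P (\<lambda>\<omega>. wavelet_coeff \<phi> \<psi> X j T k \<omega> - tangent_coeff p \<phi> \<psi> Y j k \<omega>)
        (c * (2 powr ((real p + 3/2) * real j) / real T) * (1 + \<bar>real k - real T * u / 2 ^ j\<bar>))"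
proof -
  obtain K where K: "K > 0"
    "\<And>f W B. has_spectral_integral P Z f (\<lambda>\<omega>. complex_of_real (W \<omega>)) \<Longrightarrow> B \<ge> 0 \<Longrightarrow> sqnorm freq f \<le> B\<^sup>2 \<Longrightarrow>
      L4_norm_le P W (K * B)"
    using spectral_integral_L4_norm[OF P mod] by blast
  have Z: "orthogonal_increments P Z" and ls: "locally_stationary P Z X p A0 A" using mod by (auto simp: model_assumption_def)
  obtain b D where D: "b > 0" "D < 1/2"
    "\<And>T t l. T \<ge> 1 \<Longrightarrow> t \<in> {1..int T} \<Longrightarrow> l \<in> {-pi..pi} - {0} \<Longrightarrow> cmod (A0 t T l - A (of_int t / real T) l) \<le> b / real T * \<bar>l\<bar> powr (-D)"
    "\<And>v w l. v \<in> {0..1} \<Longrightarrow> w \<in> {0..1} \<Longrightarrow> l \<in> {-pi..pi} - {0} \<Longrightarrow> cmod (A v l - A w l) \<le> b * \<bar>v - w\<bar> * \<bar>l\<bar> powr (-D)"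
    using ls unfolding locally_stationary_def by blast
  obtain C where C: "C > 0" "\<And>j. finite {t. filt_tilde p \<phi> \<psi> j t \<noteq> 0}"
    "\<And>j. (bdiff ^^ p) (filt_tilde p \<phi> \<psi> j) = filt \<phi> \<psi> j"
    "\<And>j t. filt_tilde p \<phi> \<psi> j t \<noteq> 0 \<Longrightarrow> \<bar>real_of_int t\<bar> \<le> C * 2 ^ j"
    "\<And>j. (\<Sum>t | filt_tilde p \<phi> \<psi> j t \<noteq> 0. \<bar>filt_tilde p \<phi> \<psi> j t\<bar>) \<le> C * 2 powr ((real p + 1/2) * real j)"
    using filt_tilde_bounds[OF wc pM] by blast
  define Q where "Q = (LINT l|freq. \<bar>l\<bar> powr (- 2 * D))"
  have Q0: "Q \<ge> 0" by (simp add: Q_def)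
  \<comment> \<open>The factor \<open>C\<close> is the mass of the filter, and \<open>1 + C\<close> comes from the size of its support.\<close>
  define a where "a = b * (C * (1 + C))"
  have a0: "a > 0" using D(1) C(1) by (simp add: a_def)
  define c where "c = K * a * sqrt (Q + 1)"
  have "L4_norm_le P (\<lambda>\<omega>. wavelet_coeff \<phi> \<psi> X j T k \<omega> - tangent_coeff p \<phi> \<psi> Y j k \<omega>)
        (c * (2 powr ((real p + 3/2) * real j) / real T) * (1 + \<bar>real k - real T * u / 2 ^ j\<bar>))"
    if T: "T \<ge> 1" and k: "k < N j T" for j T k
  proof -
    define g where "g = filt_tilde p \<phi> \<psi> j"
    define m where "m = 2 ^ j * int k"
    define x where "x = \<bar>real k - real T * u / 2 ^ j\<bar>"
    define S where "S = {t. g (m - t) \<noteq> 0}"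
    have hsupp: "t \<in> {1..int T}" if "filt \<phi> \<psi> j (m - t) \<noteq> 0" for t
      using av T k that unfolding available_coeffs_def m_def by blast
    have S_sub: "S \<subseteq> {1..int T}"
    proof
      fix t assume "t \<in> S"
      then have "filt_tilde p \<phi> \<psi> j (m - t) \<noteq> 0" by (simp add: S_def g_def)
      moreover have "s \<in> {m - int T..m - 1}" if "filt \<phi> \<psi> j s \<noteq> 0" for s
        using hsupp[of "m - s"] that by auto
      ultimately have "m - t \<in> {m - int T..m - 1}" using filt_tilde_subset[OF wc pM, of j] by blast
      then show "t \<in> {1..int T}" by auto
    qed
    have finS: "finite S" by (rule finite_subset[OF S_sub]) simp
    define f where "f l = (\<Sum>t\<in>S. complex_of_real (g (m - t)) * (A0 t T l * cis (l * of_int t) + (-1) * (A u l * cis (l * of_int t))))" for l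
    have wX: "wavelet_coeff \<phi> \<psi> X j T k \<omega> = (\<Sum>t\<in>S. g (m - t) * (bdiff ^^ p) (\<lambda>s. X s T \<omega>) t)" for \<omega>
    proof -
      have "(\<Sum>t\<in>{1..int T}. (bdiff ^^ p) g (m - t) *\<^sub>R X t T \<omega>) = (\<Sum>t\<in>S. g (m - t) *\<^sub>R (bdiff ^^ p) (\<lambda>s. X s T \<omega>) t)"
        by (rule sum_bdiff_funpow) (use C(2,3) hsupp finS in \<open>auto simp: g_def S_def\<close>)
      then show ?thesis unfolding wavelet_coeff_def m_def[symmetric] by (simp add: g_def C(3))
    qed
    have "has_spectral_integral P Z f (\<lambda>\<omega>. \<Sum>t\<in>S. complex_of_real (g (m - t)) *
        (complex_of_real ((bdiff ^^ p) (\<lambda>s. X s T \<omega>) t) + (-1) * complex_of_real (Y t \<omega>)))"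
      unfolding f_def
    proof (rule has_spectral_integral_sum[OF Z])
      fix t assume "t \<in> S"
      then have "t \<in> {1..int T}" using S_sub by blast
      then have "has_spectral_integral P Z (\<lambda>l. A0 t T l * cis (l * of_int t)) (\<lambda>\<omega>. complex_of_real ((bdiff ^^ p) (\<lambda>s. X s T \<omega>) t))"
        using ls T unfolding locally_stationary_def by blast
      moreover have "has_spectral_integral P Z (\<lambda>l. A u l * cis (l * of_int t)) (\<lambda>\<omega>. complex_of_real (Y t \<omega>))"
        using tan unfolding tangent_differences_def by blast
      ultimately show "has_spectral_integral P Z (\<lambda>l. A0 t T l * cis (l * of_int t) + (-1) * (A u l * cis (l * of_int t)))
         (\<lambda>\<omega>. complex_of_real ((bdiff ^^ p) (\<lambda>s. X s T \<omega>) t) + (-1) * complex_of_real (Y t \<omega>))"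
        by (intro has_spectral_integral_add[OF Z] has_spectral_integral_scale)
    qed
    moreover have "(\<Sum>t\<in>S. complex_of_real (g (m - t)) * (complex_of_real ((bdiff ^^ p) (\<lambda>s. X s T \<omega>) t) + (-1) * complex_of_real (Y t \<omega>)))
       = complex_of_real (wavelet_coeff \<phi> \<psi> X j T k \<omega> - tangent_coeff p \<phi> \<psi> Y j k \<omega>)" for \<omega>
      unfolding wX tangent_coeff_def m_def[symmetric] g_def[symmetric] S_def[symmetric]
      by (simp add: right_diff_distrib sum_subtractf)
    ultimately have f: "has_spectral_integral P Z f (\<lambda>\<omega>. complex_of_real (wavelet_coeff \<phi> \<psi> X j T k \<omega> - tangent_coeff p \<phi> \<psi> Y j k \<omega>))"
      by simp
    define r where "r = 2 powr ((real p + 3/2) * real j) / real T"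
    have gsum: "(\<Sum>t\<in>S. \<bar>g (m - t)\<bar>) \<le> C * 2 powr ((real p + 1/2) * real j)"
    proof -
      have "(\<Sum>t\<in>S. \<bar>g (m - t)\<bar>) = (\<Sum>t | g t \<noteq> 0. \<bar>g t\<bar>)"
        unfolding S_def by (rule sum.reindex_bij_witness[of _ "\<lambda>t. m - t" "\<lambda>t. m - t"]) auto
      then show ?thesis using C(5)[of j] by (simp add: g_def)
    qed
    have fbound: "cmod (f l) \<le> a * r * (1 + x) * \<bar>l\<bar> powr (- D)" if l: "l \<in> {-pi..pi} - {0}" for l
    proof -
      define L where "L = \<bar>l\<bar> powr (- D)"
      have L0: "L \<ge> 0" by (simp add: L_def)
      have T0: "real T > 0" using T by simp
      have diff: "cmod (A0 t T l - A u l) \<le> b / real T * ((1 + C) * 2 ^ j * (1 + x)) * L" if t: "t \<in> S" for t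
      proof -
        have tT: "t \<in> {1..int T}" using S_sub t by blast
        have v: "of_int t / real T \<in> {0..1}" using tT T by (auto simp: field_simps)
        have "cmod (A0 t T l - A u l) \<le> cmod (A0 t T l - A (of_int t / real T) l) + cmod (A (of_int t / real T) l - A u l)"
          using norm_triangle_ineq[of "A0 t T l - A (of_int t / real T) l" "A (of_int t / real T) l - A u l"] by simp
        also have "\<dots> \<le> b / real T * L + b * \<bar>of_int t / real T - u\<bar> * L"
          unfolding L_def by (intro add_mono D(3)[OF T tT l] D(4)[OF v u l])
        also have "\<dots> = b / real T * (1 + \<bar>of_int t - real T * u\<bar>) * L"
        proof -
          have "\<bar>of_int t / real T - u\<bar> = \<bar>of_int t - real T * u\<bar> / real T"
          proof -
            have "of_int t / real T - u = (of_int t - real T * u) / real T" using T0 by (simp add: field_simps)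
            then show ?thesis using T0 by (simp add: abs_divide)
          qed
          then show ?thesis by (simp add: algebra_simps add_divide_distrib)
        qed
        also have "\<dots> \<le> b / real T * ((1 + C) * 2 ^ j * (1 + x)) * L"
        proof (intro mult_right_mono mult_left_mono L0)
          have "\<bar>real_of_int (m - t)\<bar> \<le> C * 2 ^ j" using C(4)[of j "m - t"] t by (simp add: S_def g_def)
          moreover have "\<bar>real_of_int m - real T * u\<bar> = 2 ^ j * x"
          proof -
            have "real_of_int m - real T * u = 2 ^ j * (real k - real T * u / 2 ^ j)" by (simp add: m_def field_simps)
            then show ?thesis by (simp add: x_def abs_mult)
          qed
          ultimately have "1 + \<bar>of_int t - real T * u\<bar> \<le> 1 + (2 ^ j * x + C * 2 ^ j)" by simp
          also have "\<dots> \<le> 2 ^ j + (2 ^ j * x + C * 2 ^ j) + C * 2 ^ j * x"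
            using C(1) by (auto simp: x_def intro: add_increasing2)
          also have "\<dots> = (1 + C) * 2 ^ j * (1 + x)" by (simp add: algebra_simps)
          finally show "1 + \<bar>of_int t - real T * u\<bar> \<le> (1 + C) * 2 ^ j * (1 + x)" .
        qed (use D(1) in auto)
        finally show ?thesis .
      qed
      have "cmod (f l) \<le> (\<Sum>t\<in>S. cmod (complex_of_real (g (m - t)) * (A0 t T l * cis (l * of_int t) + (-1) * (A u l * cis (l * of_int t)))))"
        unfolding f_def by (rule norm_sum)
      also have "\<dots> = (\<Sum>t\<in>S. \<bar>g (m - t)\<bar> * cmod (A0 t T l - A u l))"
      proof (intro sum.cong refl)
        fix t
        have "A0 t T l * cis (l * of_int t) + (-1) * (A u l * cis (l * of_int t)) = (A0 t T l - A u l) * cis (l * of_int t)"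
          by (simp add: algebra_simps)
        then show "cmod (complex_of_real (g (m - t)) * (A0 t T l * cis (l * of_int t) + (-1) * (A u l * cis (l * of_int t)))) = \<bar>g (m - t)\<bar> * cmod (A0 t T l - A u l)"
          by (simp only: norm_mult norm_cis norm_of_real mult_1_right)
      qed
      also have "\<dots> \<le> (\<Sum>t\<in>S. \<bar>g (m - t)\<bar> * (b / real T * ((1 + C) * 2 ^ j * (1 + x)) * L))"
        by (intro sum_mono mult_left_mono diff) auto
      also have "\<dots> = (\<Sum>t\<in>S. \<bar>g (m - t)\<bar>) * (b / real T * ((1 + C) * 2 ^ j * (1 + x)) * L)"
        by (rule sum_distrib_right[symmetric])
      also have "\<dots> \<le> (C * 2 powr ((real p + 1/2) * real j)) * (b / real T * ((1 + C) * 2 ^ j * (1 + x)) * L)"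
        using C(1) D(1) L0 by (intro mult_right_mono gsum) (auto simp: x_def)
      also have "\<dots> = a * (2 powr ((real p + 1/2) * real j) * 2 ^ j / real T) * (1 + x) * L"
        by (simp add: a_def)
      also have "2 powr ((real p + 1/2) * real j) * 2 ^ j / real T = r"
        unfolding r_def powr_realpow[of 2 j, symmetric, simplified] powr_add[symmetric] by (simp add: algebra_simps)
      finally show ?thesis by (simp add: L_def)
    qed
    have r0: "r \<ge> 0" and x0: "x \<ge> 0" by (auto simp: r_def x_def)
    have Di: "integrable freq (\<lambda>l. \<bar>l\<bar> powr (- 2 * D))" by (rule integrable_freq_powr) (use D(2) in simp)
    have "sqnorm freq f \<le> (LINT l|freq. (a * r * (1 + x))\<^sup>2 * \<bar>l\<bar> powr (- 2 * D))"
    proof (rule integral_mono_AE)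
      show "AE l in freq. (cmod (f l))\<^sup>2 \<le> (a * r * (1 + x))\<^sup>2 * \<bar>l\<bar> powr (- 2 * D)"
      proof (rule AE_freq[of 0])
        fix l assume "-pi \<le> l" "l \<le> pi" "l \<noteq> 0"
        then have "(cmod (f l))\<^sup>2 \<le> (a * r * (1 + x) * \<bar>l\<bar> powr (- D))\<^sup>2"
          by (intro power_mono fbound) auto
        also have "(a * r * (1 + x) * \<bar>l\<bar> powr (- D))\<^sup>2 = (a * r * (1 + x))\<^sup>2 * \<bar>l\<bar> powr (- 2 * D)"
          by (simp add: power_mult_distrib power2_eq_square powr_add[symmetric])
        finally show "(cmod (f l))\<^sup>2 \<le> (a * r * (1 + x))\<^sup>2 * \<bar>l\<bar> powr (- 2 * D)" .
      qed
    qed (use f Di in \<open>auto simp: has_spectral_integral_iff sq_integrable_def\<close>)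
    also have "\<dots> = (a * r * (1 + x))\<^sup>2 * Q" by (simp add: Q_def)
    also have "\<dots> \<le> (a * r * (1 + x))\<^sup>2 * (Q + 1)" by (intro mult_left_mono) auto
    also have "\<dots> = (a * r * (1 + x) * sqrt (Q + 1))\<^sup>2" using Q0 by (simp add: power_mult_distrib)
    finally have "L4_norm_le P (\<lambda>\<omega>. wavelet_coeff \<phi> \<psi> X j T k \<omega> - tangent_coeff p \<phi> \<psi> Y j k \<omega>)
        (K * (a * r * (1 + x) * sqrt (Q + 1)))"
      using a0 r0 x0 Q0 by (intro K(2)[OF f]) auto
    then show ?thesis by (simp add: c_def r_def x_def mult_ac)
  qed
  moreover have "c > 0" using a0 K(1) Q0 by (simp add: c_def)
  ultimately show ?thesis using that by blast
qed

section \<open>The tangent approximation\<close>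

lemma weight_sup_bounds:
  assumes "weights n \<gamma>"
  shows "0 < weight_sup n \<gamma>" "weight_sup n \<gamma> \<le> 1"
proof -
  have pos: "\<gamma> k \<ge> 0" if "k < n" for k using assms that by (simp add: weights_def)
  have sum: "(\<Sum>k<n. \<gamma> k) = 1" using assms by (simp add: weights_def)
  have n: "n > 0" using sum by (cases n) auto
  have "\<exists>k<n. \<gamma> k > 0"
  proof (rule ccontr)
    assume "\<not> ?thesis"
    then have "(\<Sum>k<n. \<gamma> k) \<le> 0" by (intro sum_nonpos) (use not_less in blast)
    then show False using sum by simp
  qed
  then obtain k where k: "k < n" "\<gamma> k > 0" by blast
  have "\<bar>\<gamma> k\<bar> \<le> weight_sup n \<gamma>" unfolding weight_sup_def using k(1) by (intro cSUP_upper) auto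
  then show "0 < weight_sup n \<gamma>" using k(2) by simp
  show "weight_sup n \<gamma> \<le> 1"
    unfolding weight_sup_def
  proof (rule cSUP_least)
    fix k assume k: "k \<in> {..<n}"
    have "\<gamma> k \<le> (\<Sum>k<n. \<gamma> k)" using k pos by (intro member_le_sum) auto
    then show "\<bar>\<gamma> k\<bar> \<le> 1" using sum pos k by simp
  qed (use n in auto)
qed

text \<open>
  Since \<open>weight_sup\<close> is at most one, the constant term of \<open>1 + \<bar>k - Tu2\<^bsup>-j\<^esup>\<bar>\<close> is also bounded by a negative power of it.
\<close>

lemma weighted_polynomial_moments:
  assumes w: "weights n \<gamma>"
    and B: "weight_moment 1 u j T n \<gamma> \<le> B * (1 / weight_sup n \<gamma>)" "weight_moment 2 u j T n \<gamma> \<le> B * (1 / (weight_sup n \<gamma>)\<^sup>2)"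
  defines "x \<equiv> \<lambda>k. \<bar>real k - real T * u / 2 ^ j\<bar>"
  shows "(\<Sum>k<n. \<gamma> k * (1 + x k)) \<le> (1 + B) / weight_sup n \<gamma>"
    and "(\<Sum>k<n. \<gamma> k * (1 + x k)\<^sup>2) \<le> 2 * (1 + B) / (weight_sup n \<gamma>)\<^sup>2"
proof -
  let ?d = "weight_sup n \<gamma>"
  note d = weight_sup_bounds[OF w]
  have pos: "\<gamma> k \<ge> 0" if "k < n" for k using w that by (simp add: weights_def)
  have sum: "(\<Sum>k<n. \<gamma> k) = 1" using w by (simp add: weights_def)
  have m: "weight_moment q u j T n \<gamma> = (\<Sum>k<n. \<gamma> k * x k ^ q)" for q
    unfolding weight_moment_def x_def by (intro sum.cong) (auto simp: pos)
  have "(\<Sum>k<n. \<gamma> k * (1 + x k)) = 1 + weight_moment 1 u j T n \<gamma>"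
    by (simp add: m distrib_left sum.distrib sum)
  also have "\<dots> \<le> 1 / ?d + B * (1 / ?d)" using B(1) d by (intro add_mono) auto
  finally show "(\<Sum>k<n. \<gamma> k * (1 + x k)) \<le> (1 + B) / ?d" by (simp add: add_divide_distrib)
  have "(\<Sum>k<n. \<gamma> k * (1 + x k)\<^sup>2) \<le> (\<Sum>k<n. \<gamma> k * (2 + 2 * (x k)\<^sup>2))"
  proof (intro sum_mono mult_left_mono)
    fix k show "(1 + x k)\<^sup>2 \<le> 2 + 2 * (x k)\<^sup>2"
      using sum_squares_bound[of 1 "x k"] by (simp add: power2_sum)
  qed (use pos in auto)
  also have "\<dots> = 2 * (1 + weight_moment 2 u j T n \<gamma>)"
    by (simp add: m distrib_left sum.distrib sum_distrib_left sum mult_ac flip: sum_distrib_right)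
  also have "\<dots> \<le> 2 * (1 / ?d\<^sup>2 + B * (1 / ?d\<^sup>2))"
    using B(2) d by (intro mult_left_mono add_mono) (auto simp: power_le_one)
  finally show "(\<Sum>k<n. \<gamma> k * (1 + x k)\<^sup>2) \<le> 2 * (1 + B) / ?d\<^sup>2" by (simp add: add_divide_distrib)
qed

theorem proposition1:
  fixes P :: "'a measure"
    and Z :: "real \<Rightarrow> 'a \<Rightarrow> complex"
    and \<epsilon> :: "int \<Rightarrow> 'a \<Rightarrow> real"
    and X :: "int \<Rightarrow> nat \<Rightarrow> 'a \<Rightarrow> real"
    and Y :: "int \<Rightarrow> 'a \<Rightarrow> real"
    and A0 :: "int \<Rightarrow> nat \<Rightarrow> real \<Rightarrow> complex"
    and A :: "real \<Rightarrow> real \<Rightarrow> complex"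
    and \<phi> \<psi> :: "real \<Rightarrow> real"
    and p M :: nat
    and u d \<alpha> :: real
    and N :: "nat \<Rightarrow> nat \<Rightarrow> nat"
    and \<gamma> :: "nat \<Rightarrow> nat \<Rightarrow> nat \<Rightarrow> real"
    and J :: "nat \<Rightarrow> nat"
  defines "\<delta> \<equiv> \<lambda>T. weight_sup (N (J T) T) (\<gamma> (J T) T)"
    and "\<sigma>hat \<equiv> \<lambda>T. scalogram (N (J T) T) (\<gamma> (J T) T) (wavelet_coeff \<phi> \<psi> X (J T) T)"
    and "\<sigma>tilde \<equiv> \<lambda>T. scalogram (N (J T) T) (\<gamma> (J T) T) (tangent_coeff p \<phi> \<psi> Y (J T))"
  assumes "prob_space P"
    and "u \<in> {0..1}"
    and "d < real p + 1/2"
    and "model_assumption P Z \<epsilon> X p A0 A u d"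
    and "tangent_differences P Z A u Y"
    and "wavelet_conditions \<phi> \<psi> M \<alpha>"
    and "real M \<ge> max (real p) (d - 1/2)"
    and "\<alpha> > 1/2 - d"
    and "available_coeffs \<phi> \<psi> N"
    and "\<forall>\<^sub>F T in at_top. weights (N (J T) T) (\<gamma> (J T) T)"
    and "\<forall>q \<in> {0, 1, 2}.
           (\<lambda>T. weight_moment q u (J T) T (N (J T) T) (\<gamma> (J T) T)) \<in> O(\<lambda>T. 1 / \<delta> T ^ q)"
  shows "(\<forall>\<^sub>F T in at_top. integrable P (\<lambda>\<omega>. (\<sigma>hat T \<omega> - \<sigma>tilde T \<omega>)\<^sup>2)) \<and>
         (\<lambda>T. LINT \<omega>|P. (\<sigma>hat T \<omega> - \<sigma>tilde T \<omega>)\<^sup>2) \<in>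
           O(\<lambda>T. 2 powr ((6 + 4 * real p) * real (J T)) / (real T ^ 4 * \<delta> T ^ 4)
                + 2 powr ((3 + 2 * real p + 2 * d) * real (J T)) / (real T ^ 2 * \<delta> T ^ 2))"
proof -
  have pM: "p \<le> M" using assms(10) by simp
  obtain c where c: "c > 0" and diff: "\<And>j T k. T \<ge> 1 \<Longrightarrow> k < N j T \<Longrightarrow>
      L4_norm_le P (\<lambda>\<omega>. wavelet_coeff \<phi> \<psi> X j T k \<omega> - tangent_coeff p \<phi> \<psi> Y j k \<omega>)
        (c * (2 powr ((real p + 3/2) * real j) / real T) * (1 + \<bar>real k - real T * u / 2 ^ j\<bar>))"
    using coeff_difference_L4_norm[OF assms(4,7,5,8,9) pM assms(12)] by blast
  obtain e where e: "e > 0" and tang: "\<And>j k. L4_norm_le P (tangent_coeff p \<phi> \<psi> Y j k) (e * 2 powr (d * real j))"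
    using tangent_coeff_L4_norm[OF assms(4,7,8,9) pM assms(6,11)] by blast
  have "\<exists>B. \<forall>\<^sub>F T in at_top. weight_moment q u (J T) T (N (J T) T) (\<gamma> (J T) T) \<le> B * (1 / \<delta> T ^ q)" if "q \<in> {0, 1, 2}" for q
  proof -
    have "(\<lambda>T. weight_moment q u (J T) T (N (J T) T) (\<gamma> (J T) T)) \<in> O(\<lambda>T. 1 / \<delta> T ^ q)"
      using assms(14) that by blast
    then obtain B where B: "B > 0" "\<forall>\<^sub>F T in at_top. norm (weight_moment q u (J T) T (N (J T) T) (\<gamma> (J T) T)) \<le> B * norm (1 / \<delta> T ^ q)"
      by (elim landau_o.bigE)
    have "\<forall>\<^sub>F T in at_top. weight_moment q u (J T) T (N (J T) T) (\<gamma> (J T) T) \<le> B * (1 / \<delta> T ^ q)"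
      using B(2) assms(13)
    proof eventually_elim
      case (elim T)
      have "\<delta> T > 0" unfolding \<delta>_def by (rule weight_sup_bounds(1)[OF elim(2)])
      then show ?case using elim(1) by simp
    qed
    then show ?thesis by blast
  qed
  from this[of 1] this[of 2] obtain B1 B2 where
    B1: "\<forall>\<^sub>F T in at_top. weight_moment 1 u (J T) T (N (J T) T) (\<gamma> (J T) T) \<le> B1 * (1 / \<delta> T)" and
    B2: "\<forall>\<^sub>F T in at_top. weight_moment 2 u (J T) T (N (J T) T) (\<gamma> (J T) T) \<le> B2 * (1 / (\<delta> T)\<^sup>2)"
    by auto
  define B where "B = max 0 (max B1 B2)"
  \<comment> \<open>The two constants belong to the squares and to the products, respectively.\<close>
  define C where "C = max (2 * (c\<^sup>2 * (2 * (1 + B)))\<^sup>2) (8 * e\<^sup>2 * (c * (1 + B))\<^sup>2)"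
  let ?bound = "\<lambda>T. 2 powr ((6 + 4 * real p) * real (J T)) / (real T ^ 4 * \<delta> T ^ 4)
                + 2 powr ((3 + 2 * real p + 2 * d) * real (J T)) / (real T ^ 2 * \<delta> T ^ 2)"
  have main: "\<forall>\<^sub>F T in at_top. integrable P (\<lambda>\<omega>. (\<sigma>hat T \<omega> - \<sigma>tilde T \<omega>)\<^sup>2) \<and>
      (LINT \<omega>|P. (\<sigma>hat T \<omega> - \<sigma>tilde T \<omega>)\<^sup>2) \<le> C * ?bound T"
    using B1 B2 assms(13) eventually_ge_at_top[of "1::nat"]
  proof eventually_elim
    case (elim T)
    define j where "j = J T"
    define n where "n = N j T"
    define g where "g = \<gamma> j T"
    define D where "D = \<delta> T"
    define x where "x k = \<bar>real k - real T * u / 2 ^ j\<bar>" for k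
    define r where "r = 2 powr ((real p + 3/2) * real j) / real T"
    \<comment> \<open>Here \<open>m k\<close> bounds the \<open>L\<^sup>4\<close> norm of the difference of the coefficients, and \<open>s\<close> that of the tangent coefficients.\<close>
    define m where "m k = c * r * (1 + x k)" for k
    define s where "s = e * 2 powr (d * real j)"
    have w: "weights n g" using elim(3) by (simp add: n_def g_def j_def)
    have Deq: "D = weight_sup n g" by (simp add: D_def \<delta>_def n_def g_def j_def)
    have D: "D > 0" unfolding Deq by (rule weight_sup_bounds(1)[OF w])
    have r: "r > 0" using elim(4) by (simp add: r_def)
    have mom: "weight_moment 1 u j T n g \<le> B * (1 / weight_sup n g)" "weight_moment 2 u j T n g \<le> B * (1 / (weight_sup n g)\<^sup>2)"
    proof -
      have "B1 * (1 / D) \<le> B * (1 / D)" "B2 * (1 / D\<^sup>2) \<le> B * (1 / D\<^sup>2)"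
        using D by (auto intro!: divide_right_mono simp: B_def)
      then show "weight_moment 1 u j T n g \<le> B * (1 / weight_sup n g)" "weight_moment 2 u j T n g \<le> B * (1 / (weight_sup n g)\<^sup>2)"
        using elim(1,2) unfolding Deq[symmetric] by (simp_all add: n_def g_def j_def D_def)
    qed
    note mm = weighted_polynomial_moments[OF w mom, folded x_def Deq]
    have gpos: "g k \<ge> 0" if "k < n" for k using w that by (simp add: weights_def)
    have fm: "integrable P (\<lambda>\<omega>. (\<sigma>hat T \<omega> - \<sigma>tilde T \<omega>)\<^sup>2)"
      "(LINT \<omega>|P. (\<sigma>hat T \<omega> - \<sigma>tilde T \<omega>)\<^sup>2) \<le> 2 * (\<Sum>k<n. g k * (m k)\<^sup>2)\<^sup>2 + 8 * s\<^sup>2 * (\<Sum>k<n. g k * m k)\<^sup>2"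
    proof -
      have mpos: "m k > 0" if "k < n" for k using c r by (simp add: m_def x_def add_pos_nonneg)
      have spos: "s > 0" if "k < n" for k :: nat using e by (simp add: s_def)
      have dd: "L4_norm_le P (\<lambda>\<omega>. wavelet_coeff \<phi> \<psi> X j T k \<omega> - tangent_coeff p \<phi> \<psi> Y j k \<omega>) (m k)" if "k < n" for k
        using diff[OF elim(4), of k j] that by (simp add: m_def r_def x_def n_def)
      have tt: "L4_norm_le P (tangent_coeff p \<phi> \<psi> Y j k) s" for k
        using tang[of j k] by (simp add: s_def)
      note sd = scalogram_difference_second_moment[where n = n and \<gamma> = g and m = m and s = s and P = P
          and V = "wavelet_coeff \<phi> \<psi> X j T" and W = "tangent_coeff p \<phi> \<psi> Y j", OF gpos mpos spos dd tt]
      show "integrable P (\<lambda>\<omega>. (\<sigma>hat T \<omega> - \<sigma>tilde T \<omega>)\<^sup>2)"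
        "(LINT \<omega>|P. (\<sigma>hat T \<omega> - \<sigma>tilde T \<omega>)\<^sup>2) \<le> 2 * (\<Sum>k<n. g k * (m k)\<^sup>2)\<^sup>2 + 8 * s\<^sup>2 * (\<Sum>k<n. g k * m k)\<^sup>2"
        using sd by (simp_all add: \<sigma>hat_def \<sigma>tilde_def n_def g_def j_def)
    qed
    have m1: "(\<Sum>k<n. g k * m k) \<le> c * r * ((1 + B) / D)"
    proof -
      have "(\<Sum>k<n. g k * m k) = c * r * (\<Sum>k<n. g k * (1 + x k))"
        unfolding sum_distrib_left by (intro sum.cong) (auto simp: m_def)
      then show ?thesis using mult_left_mono[OF mm(1), of "c * r"] c r by simp
    qed
    have m2: "(\<Sum>k<n. g k * (m k)\<^sup>2) \<le> (c * r)\<^sup>2 * (2 * (1 + B) / D\<^sup>2)"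
    proof -
      have "(\<Sum>k<n. g k * (m k)\<^sup>2) = (c * r)\<^sup>2 * (\<Sum>k<n. g k * (1 + x k)\<^sup>2)"
        unfolding sum_distrib_left by (intro sum.cong) (auto simp: m_def power_mult_distrib)
      then show ?thesis using mult_left_mono[OF mm(2), of "(c * r)\<^sup>2"] by simp
    qed
    have m0: "0 \<le> (\<Sum>k<n. g k * m k)" "0 \<le> (\<Sum>k<n. g k * (m k)\<^sup>2)"
      using gpos c r by (auto intro!: sum_nonneg mult_nonneg_nonneg simp: m_def x_def)
    have r4: "r ^ 4 = 2 powr ((6 + 4 * real p) * real j) / real T ^ 4"
      by (simp add: r_def power_divide powr_power algebra_simps)
    have r2: "r\<^sup>2 * (2 powr (d * real j))\<^sup>2 = 2 powr ((3 + 2 * real p + 2 * d) * real j) / (real T)\<^sup>2"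
      by (simp add: r_def power_divide powr_power powr_add[symmetric] algebra_simps)
    have "(LINT \<omega>|P. (\<sigma>hat T \<omega> - \<sigma>tilde T \<omega>)\<^sup>2) \<le> 2 * ((c * r)\<^sup>2 * (2 * (1 + B) / D\<^sup>2))\<^sup>2 + 8 * s\<^sup>2 * (c * r * ((1 + B) / D))\<^sup>2"
      by (rule order.trans[OF fm(2)]) (intro add_mono mult_left_mono power_mono m1 m2 m0, auto)
    also have "\<dots> = (2 * (c\<^sup>2 * (2 * (1 + B)))\<^sup>2) * (r ^ 4 / D ^ 4) + (8 * e\<^sup>2 * (c * (1 + B))\<^sup>2) * ((r\<^sup>2 * (2 powr (d * real j))\<^sup>2) / D\<^sup>2)"
      by (simp add: s_def power_mult_distrib power_divide mult_ac)
    also have "\<dots> \<le> C * (r ^ 4 / D ^ 4) + C * ((r\<^sup>2 * (2 powr (d * real j))\<^sup>2) / D\<^sup>2)"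
      using r D by (intro add_mono mult_right_mono) (auto simp: C_def)
    also have "\<dots> = C * ?bound T"
      unfolding r4 r2 by (simp add: D_def j_def distrib_left)
    finally show ?case using fm(1) by simp
  qed
  show ?thesis
  proof
    show "\<forall>\<^sub>F T in at_top. integrable P (\<lambda>\<omega>. (\<sigma>hat T \<omega> - \<sigma>tilde T \<omega>)\<^sup>2)"
      using main by (auto elim!: eventually_mono)
    show "(\<lambda>T. LINT \<omega>|P. (\<sigma>hat T \<omega> - \<sigma>tilde T \<omega>)\<^sup>2) \<in> O(?bound)"
    proof (rule bigoI[where c = C])
      show "\<forall>\<^sub>F T in at_top. norm (LINT \<omega>|P. (\<sigma>hat T \<omega> - \<sigma>tilde T \<omega>)\<^sup>2) \<le> C * norm (?bound T)"
        using main
      proof eventually_elim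
        case (elim T)
        have "0 \<le> ?bound T" by simp
        moreover have "0 \<le> (LINT \<omega>|P. (\<sigma>hat T \<omega> - \<sigma>tilde T \<omega>)\<^sup>2)" by simp
        ultimately show ?case using elim unfolding real_norm_def by (simp only: abs_of_nonneg)
      qed
    qed
  qed
qed

end
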